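(* Let $\beta\in(0,1]$, $R>0$, $n\in\mathbb{N}$, and let $\Phi:\mathbb{R}\to\mathbb{R}$ be weakly differentiable with derivative $\Phi'\in L^1_{loc}(\mathbb{R})$. Suppose that for every $g\in\mathcal{C}^\beta(R)$ the quantity $$\frac{1}{n}\int_0^1\int_{0}^\infty\big(\Phi'(g(x)+u)\big)^2\,\mathbb{P}_g\big(\hat{g}^{MLE}(x)-g(x)\ge u\big)\,du\,dx$$ is finite. Then the estimator $$\hat F_\Phi=\int_0^1\Phi(\hat{g}^{MLE}(x))\,dx-\frac{1}{n}\sum_{j\ge 1}\Phi'(Y_j)\mathbf{1}\big(\hat{g}^{MLE}(X_j)\ge Y_j\big)$$ of $F_\Phi(g)=\int_0^1\Phi(g(x))\,dx$ is UMVU (uniformly of minimum variance among all unbiased estimators) over $g\in\mathcal{C}^\beta(R)$, and for every $g\in\mathcal{C}^\beta(R)$ its variance is $$\operatorname{Var}_g(\hat F_\Phi)=\frac{1}{n}\int_0^1\int_{0}^\infty\big(\Phi'(g(x)+u)\big)^2\,\mathbb{P}_g\big(\hat{g}^{MLE}(x)-g(x)\ge u\big)\,du\,dx.$$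
   Context: Model (PPP model): one observes the support points $(X_j,Y_j)_{j\ge1}$ of a Poisson point process on $[0,1]\times\mathbb{R}$ with intensity function $\lambda_g(x,y)=n\mathbf{1}(y\ge g(x))$, $x\in[0,1]$, $y\in\mathbb{R}$, where $g$ is an unknown support boundary curve. $\mathbb{P}_g$, $\mathbb{E}_g$, $\operatorname{Var}_g$ denote probability, expectation and variance under this law. The parameters $\beta,R,n$ are known. Hölder ball: $\mathcal{C}^\beta(R)=\{g:[0,1]\to\mathbb{R}: |g(x)-g(y)|\le R|x-y|^\beta\ \forall x,y\in[0,1]\}$. The maximum-likelihood estimator over $\mathcal{C}^\beta(R)$ is $\hat g^{MLE}(x)=\min_{k\ge 1}\big(Y_k+R|x-X_k|^{\beta}\big)$, $x\in[0,1]$. Weak differentiability of $\Phi$ with derivative $\Phi'\in L^1_{loc}(\mathbb{R})$ means $\Phi(u)=\Phi(0)+\int_0^u\Phi'(v)\,dv$ for all $u\in\mathbb{R}$. UMVU over $\mathcal{C}^\beta(R)$ means: the estimator is unbiased, i.e. $\mathbb{E}_g[\hat F_\Phi]=F_\Phi(g)$ for all $g\in\mathcal{C}^\beta(R)$, and for any other estimator $\tilde F$ (measurable function of the observed point process) with $\mathbb{E}_g[\tilde F]=F_\Phi(g)$ for all $g\in\mathcal{C}^\beta(R)$ one has $\operatorname{Var}_g(\hat F_\Phi)\le\operatorname{Var}_g(\tilde F)$ for all $g\in\mathcal{C}^\beta(R)$. *)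

theory Defs
  imports "HOL-Probability.Probability"
begin

section \<open>Poisson point processes\<close>

text \<open>
  A point configuration is identified with its support: a subset of the state space that has only
  finitely many points in every bounded set. For intensity measures without atoms this loses
  nothing, as the process then almost surely has no multiple points.
\<close>

definition configurations :: "'a::metric_space set \<Rightarrow> 'a set set" where
  "configurations E = {\<omega>. \<omega> \<subseteq> E \<and> (\<forall>B. bounded B \<longrightarrow> finite (\<omega> \<inter> B))}"

definition num_points :: "'a set \<Rightarrow> 'a set \<Rightarrow> ennreal" where
  "num_points A \<omega> = emeasure (count_space UNIV) (\<omega> \<inter> A)"

text \<open>
  The sigma-algebra on configurations is the smallest one that makes all counts of points in
  measurable sets measurable. Only \<open>space M\<close> and \<open>sets M\<close> matter here.
\<close>

definition config_space :: "'a::metric_space measure \<Rightarrow> 'a set measure" where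
  "config_space M = sigma (configurations (space M))
     {{\<omega> \<in> configurations (space M). num_points A \<omega> \<in> S} | A S. A \<in> sets M \<and> S \<in> sets borel}"

text \<open>
  \<open>poisson_process \<mu> P\<close>: the probability measure \<open>P\<close> on configurations is the law of a Poisson point
  process with intensity measure \<open>\<mu>\<close>. The Poisson law of infinite mean is the point mass at \<open>\<infinity>\<close>.
\<close>

definition poisson_process :: "'a::metric_space measure \<Rightarrow> 'a set measure \<Rightarrow> bool" where
  "poisson_process \<mu> P \<longleftrightarrow>
     prob_space P \<and> sets P = sets (config_space \<mu>) \<and>
     (\<forall>A\<in>sets \<mu>. emeasure \<mu> A < \<infinity> \<longrightarrow>
        (\<forall>k::nat. measure P {\<omega> \<in> space P. num_points A \<omega> = of_nat k}
           = measure \<mu> A ^ k / fact k * exp (- measure \<mu> A))) \<and>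
     (\<forall>A\<in>sets \<mu>. emeasure \<mu> A = \<infinity> \<longrightarrow> (AE \<omega> in P. num_points A \<omega> = \<infinity>)) \<and>
     (\<forall>(m::nat) A. (\<forall>i<m. A i \<in> sets \<mu>) \<and> disjoint_family_on A {..<m} \<longrightarrow>
        prob_space.indep_vars P (\<lambda>_. borel) (\<lambda>i \<omega>. num_points (A i) \<omega>) {..<m})"


section \<open>Unbiased estimators of minimum variance\<close>

text \<open>
  The variance takes values in \<open>[0, \<infinity>]\<close>, so that integrable statistics that are not square
  integrable have infinite variance (and not the default value \<open>0\<close> of the Bochner integral).
\<close>

definition evariance :: "'b measure \<Rightarrow> ('b \<Rightarrow> real) \<Rightarrow> ennreal" where
  "evariance P F = (\<integral>\<^sup>+\<omega>. ennreal ((F \<omega> - (LINT \<omega>'|P. F \<omega>'))\<^sup>2) \<partial>P)"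

text \<open>
  \<open>S\<close> is the measurable space of observations, \<open>P g\<close> the law of the observation under the parameter
  \<open>g \<in> \<Theta>\<close>, and \<open>\<theta> g\<close> the quantity to be estimated.
\<close>

definition unbiased_estimator ::
  "'b measure \<Rightarrow> ('p \<Rightarrow> 'b measure) \<Rightarrow> 'p set \<Rightarrow> ('p \<Rightarrow> real) \<Rightarrow> ('b \<Rightarrow> real) \<Rightarrow> bool" where
  "unbiased_estimator S P \<Theta> \<theta> F \<longleftrightarrow>
     F \<in> borel_measurable S \<and> (\<forall>g\<in>\<Theta>. integrable (P g) F \<and> (LINT \<omega>|P g. F \<omega>) = \<theta> g)"

definition UMVU ::
  "'b measure \<Rightarrow> ('p \<Rightarrow> 'b measure) \<Rightarrow> 'p set \<Rightarrow> ('p \<Rightarrow> real) \<Rightarrow> ('b \<Rightarrow> real) \<Rightarrow> bool" where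
  "UMVU S P \<Theta> \<theta> F \<longleftrightarrow>
     unbiased_estimator S P \<Theta> \<theta> F \<and>
     (\<forall>F'. unbiased_estimator S P \<Theta> \<theta> F' \<longrightarrow> (\<forall>g\<in>\<Theta>. evariance (P g) F \<le> evariance (P g) F'))"


section \<open>The support boundary model\<close>

text \<open>
  Boundary curves are functions on all of \<open>\<real>\<close> of which only the values on \<open>[0,1]\<close> matter.
\<close>

definition holder_ball :: "real \<Rightarrow> real \<Rightarrow> (real \<Rightarrow> real) set" where
  "holder_ball \<beta> R = {g. \<forall>x\<in>{0..1}. \<forall>y\<in>{0..1}. \<bar>g x - g y\<bar> \<le> R * \<bar>x - y\<bar> powr \<beta>}"

definition strip :: "(real \<times> real) measure" where
  "strip = restrict_space lborel ({0..1} \<times> UNIV)"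

definition boundary_intensity :: "nat \<Rightarrow> (real \<Rightarrow> real) \<Rightarrow> (real \<times> real) measure" where
  "boundary_intensity n g = density strip (\<lambda>(x, y). ennreal (real n * indicator {g x..} y))"

text \<open>
  The infimum is almost surely a minimum; it has an unspecified value only on the null set of
  configurations that are empty or contain points \<open>(x, y)\<close> with arbitrarily small \<open>y\<close>.
\<close>

definition mle :: "real \<Rightarrow> real \<Rightarrow> (real \<times> real) set \<Rightarrow> real \<Rightarrow> real" where
  "mle \<beta> R \<omega> x = (INF (X, Y)\<in>\<omega>. Y + R * \<bar>x - X\<bar> powr \<beta>)"

definition weak_derivative :: "(real \<Rightarrow> real) \<Rightarrow> (real \<Rightarrow> real) \<Rightarrow> bool" where
  "weak_derivative \<Phi> \<Phi>' \<longleftrightarrow>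
     (\<forall>a b. set_integrable lborel {a..b} \<Phi>') \<and>
     (\<forall>u::real. \<Phi> u = \<Phi> 0 + (LBINT v=ereal 0..ereal u. \<Phi>' v))"

definition functional :: "(real \<Rightarrow> real) \<Rightarrow> (real \<Rightarrow> real) \<Rightarrow> real" where
  "functional \<Phi> g = (LINT x:{0..1}|lborel. \<Phi> (g x))"

definition functional_estimator ::
  "real \<Rightarrow> real \<Rightarrow> nat \<Rightarrow> (real \<Rightarrow> real) \<Rightarrow> (real \<Rightarrow> real) \<Rightarrow> (real \<times> real) set \<Rightarrow> real" where
  "functional_estimator \<beta> R n \<Phi> \<Phi>' \<omega> =
     (LINT x:{0..1}|lborel. \<Phi> (mle \<beta> R \<omega> x)) -
     1 / real n * (\<Sum>\<^sub>\<infinity>(X, Y)\<in>\<omega>. \<Phi>' Y * of_bool (mle \<beta> R \<omega> X \<ge> Y))"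

definition variance_formula ::
  "real \<Rightarrow> real \<Rightarrow> nat \<Rightarrow> (real \<Rightarrow> real) \<Rightarrow> (real \<times> real) set measure \<Rightarrow> (real \<Rightarrow> real) \<Rightarrow> ennreal" where
  "variance_formula \<beta> R n \<Phi>' P g =
     ennreal (1 / real n) *
     (\<integral>\<^sup>+x\<in>{0..1}. (\<integral>\<^sup>+u\<in>{0..}.
        ennreal ((\<Phi>' (g x + u))\<^sup>2) * emeasure P {\<omega> \<in> space P. mle \<beta> R \<omega> x - g x \<ge> u}
      \<partial>lborel) \<partial>lborel)"

end

theory Submission
  imports Defs
begin

text \<open>
  The \<open>mle\<close> at \<open>x\<close> is at least \<open>y\<close> iff no point lies in the downward cusp below \<open>(x, y)\<close>, its shadow.
  Up to a factor \<open>- 1 / n\<close> the error of the estimator is therefore the compensated sum of \<open>\<Phi>'\<close> over the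
  points with an empty shadow. By Mecke's formula this sum is centred, and its covariances vanish
  because two points are never in each other's shadow; this gives unbiasedness and the variance,
  first for truncations of \<open>\<Phi>'\<close> and then in general by Fatou's lemma.

  For \<open>g0 \<le> g\<close> the law under \<open>g\<close> is the law under \<open>g0\<close> conditioned on \<open>mle \<ge> g\<close>. Hence an unbiased
  estimator of zero integrates to zero over each event \<open>mle \<ge> g\<close>. These events are stable under
  intersection, so it is orthogonal to all functions of the \<open>mle\<close>. The estimator is such a function,
  since the points on the graph of the \<open>mle\<close> are its local minima. So adding an unbiased estimator of
  zero only increases the variance.
\<close>

section \<open>Void events generate the configuration space\<close>

text \<open>Two features of the Hoelder ball carry the optimality. The pointwise maximum of two of
  its curves stays in the ball, which is where the stability under intersection comes from. The ball
  also contains the reflected cusps \<open>t - \<kappa> (q - x)\<close>, for which the event says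
  just that the estimator at \<open>q\<close> is at least \<open>t\<close>; so these events generate
  everything that the estimator determines. In the variance the asymmetry of the shadow relation
  plays the role that a time order has for martingale increments, although no filtration appears.
  The obstacle is that this computation multiplies the sum by itself and needs products that are
  integrable over configurations and points together. That is clear for bounded functions of bounded
  support, but not for \<Phi>' itself, which forces the truncation. Squaring the error produces two
  factors \<open>1 / n\<close>; the density \<open>n\<close> of the intensity cancels one of
  them.\<close>

definition void :: "'a::metric_space measure \<Rightarrow> 'a set \<Rightarrow> 'a set set" where
  "void M A = {\<omega> \<in> configurations (space M). \<omega> \<inter> A = {}}"

lemma configurations_subset: "\<omega> \<in> configurations E \<Longrightarrow> \<omega> \<subseteq> E"
  by (simp add: configurations_def)

lemma configurations_finite: "\<omega> \<in> configurations E \<Longrightarrow> bounded B \<Longrightarrow> finite (\<omega> \<inter> B)"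
  by (simp add: configurations_def)

lemma insert_configurations:
  "\<omega> \<in> configurations E \<Longrightarrow> z \<in> E \<Longrightarrow> insert z \<omega> \<in> configurations E"
  by (auto simp: configurations_def Int_insert_left)

lemma space_config_space: "space (config_space M) = configurations (space M)"
  unfolding config_space_def by (rule space_measure_of) auto

lemma config_space_cong:
  "space M = space N \<Longrightarrow> sets M = sets N \<Longrightarrow> config_space M = config_space N"
  by (simp add: config_space_def)

lemma measurable_num_points [measurable]:
  assumes "A \<in> sets M"
  shows "num_points A \<in> borel_measurable (config_space M)"
proof (rule measurableI)
  fix S :: "ennreal set" assume "S \<in> sets borel"
  have "{\<omega> \<in> configurations (space M). num_points A \<omega> \<in> S} \<in> sets (config_space M)"
    unfolding config_space_def
    by (rule in_measure_of) (use assms \<open>S \<in> sets borel\<close> in blast)+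
  also have "{\<omega> \<in> configurations (space M). num_points A \<omega> \<in> S} = num_points A -` S \<inter> space (config_space M)"
    by (auto simp: space_config_space)
  finally show "num_points A -` S \<inter> space (config_space M) \<in> sets (config_space M)" .
qed simp

lemma num_points_eq_0: "num_points A \<omega> = 0 \<longleftrightarrow> \<omega> \<inter> A = {}"
  by (simp add: num_points_def emeasure_count_space_eq_0)

lemma num_points_finite: "finite (\<omega> \<inter> A) \<Longrightarrow> num_points A \<omega> = of_nat (card (\<omega> \<inter> A))"
  by (simp add: num_points_def)

lemma nn_integral_indicator_count_space:
  assumes "finite (\<omega> \<inter> B)"
  shows "(\<integral>\<^sup>+z. indicator B z \<partial>count_space \<omega>) = num_points B \<omega>"
proof -
  have "(\<integral>\<^sup>+z. indicator B z \<partial>count_space \<omega>) = (\<integral>\<^sup>+z. indicator (\<omega> \<inter> B) z \<partial>count_space \<omega>)"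
    by (intro nn_integral_cong) (auto split: split_indicator)
  also have "\<dots> = num_points B \<omega>" using assms by (simp add: num_points_finite)
  finally show ?thesis .
qed

lemma void_eq: "void M A = {\<omega> \<in> space (config_space M). num_points A \<omega> = 0}"
  by (auto simp: void_def space_config_space num_points_eq_0)

lemma void_in_sets [measurable]: "A \<in> sets M \<Longrightarrow> void M A \<in> sets (config_space M)"
  unfolding void_eq by measurable

lemma void_Int: "void M A \<inter> void M B = void M (A \<union> B)"
  by (auto simp: void_def)

lemma void_empty: "void M {} = configurations (space M)"
  by (auto simp: void_def)

lemma Int_stable_void: "Int_stable {void M A |A. A \<in> sets M}"
  by (auto simp: Int_stable_def void_Int) (metis sets.Un)

text \<open>Locally finite sets are simple: distinct points are separated by finitely many disjoint
  basic open sets. This is why void events determine all counts.\<close>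

lemma num_points_SUP:
  fixes \<omega> :: "'a::metric_space set"
  assumes B: "topological_basis B"
  shows "num_points A \<omega> =
    (SUP V\<in>{V. finite V \<and> V \<subseteq> B \<and> disjoint V}. \<Sum>U\<in>V. if \<omega> \<inter> (A \<inter> U) = {} then 0 else 1)" (is "_ = ?S")
proof (rule antisym)
  have le: "ennreal (card F) \<le> ?S" if F: "finite F" "F \<subseteq> \<omega> \<inter> A" for F
  proof -
    obtain d where d: "d > 0" "\<And>x y. x \<in> F \<Longrightarrow> y \<in> F \<Longrightarrow> x \<noteq> y \<Longrightarrow> d \<le> dist x y"
    proof
      \<comment> \<open>The entry 1 keeps the set nonempty when \<open>F\<close> has at most one
        point. Balls of half the least distance are disjoint, which is what \<open>d/2\<close> is
        for below.\<close>
      let ?D = "insert 1 ((\<lambda>p. dist (fst p) (snd p)) ` (F \<times> F - Id))"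
      have fin: "finite ?D" using F by simp
      then have "Min ?D \<in> ?D" by (intro Min_in) auto
      then show "Min ?D > 0" by auto
      fix x y assume "x \<in> F" "y \<in> F" "x \<noteq> y"
      then have "dist x y \<in> ?D" by (intro insertI2 image_eqI[where x = "(x, y)"]) auto
      then show "Min ?D \<le> dist x y" by (rule Min_le[OF fin])
    qed
    have "\<exists>U\<in>B. x \<in> U \<and> U \<subseteq> ball x (d/2)" for x
      by (rule topological_basisE[OF B, of "ball x (d/2)" x]) (use d(1) in \<open>auto intro: bexI\<close>)
    then have "\<forall>x. \<exists>U. U \<in> B \<and> x \<in> U \<and> U \<subseteq> ball x (d/2)" by blast
    from choice[OF this] obtain U where U: "\<And>x. U x \<in> B" "\<And>x. x \<in> U x" "\<And>x. U x \<subseteq> ball x (d/2)" by blast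
    have disj: "U x \<inter> U y = {}" if "x \<in> F" "y \<in> F" "x \<noteq> y" for x y
    proof (rule ccontr)
      assume "U x \<inter> U y \<noteq> {}"
      then obtain z where "z \<in> U x" "z \<in> U y" by auto
      with U(3)[of x] U(3)[of y] have "dist x z < d/2" "dist y z < d/2" by auto
      with d(2)[OF that] dist_triangle2[of x y z] show False by linarith
    qed
    have inj: "inj_on U F" using disj U(2) by (fastforce simp: inj_on_def)
    have V: "U ` F \<in> {V. finite V \<and> V \<subseteq> B \<and> disjoint V}"
      using F U(1) disj by (auto simp: disjoint_def)
    have "(\<Sum>W\<in>U ` F. if \<omega> \<inter> (A \<inter> W) = {} then 0 else 1::ennreal) = (\<Sum>x\<in>F. 1)"
      unfolding sum.reindex[OF inj] o_def using F U(2) by (intro sum.cong) auto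
    also have "\<dots> = ennreal (card F)" by (simp add: ennreal_of_nat_eq_real_of_nat)
    finally show ?thesis using SUP_upper[OF V, of "\<lambda>V. \<Sum>W\<in>V. if \<omega> \<inter> (A \<inter> W) = {} then 0 else 1::ennreal"] by simp
  qed
  show "num_points A \<omega> \<le> ?S"
  proof (cases "finite (\<omega> \<inter> A)")
    case True
    then show ?thesis using le[of "\<omega> \<inter> A"] by (simp add: num_points_finite ennreal_of_nat_eq_real_of_nat)
  next
    case False
    have "of_nat k \<le> ?S" for k :: nat
    proof -
      obtain F where "finite F" "card F = k" "F \<subseteq> \<omega> \<inter> A"
        using infinite_arbitrarily_large[OF False, of k] by blast
      then show ?thesis using le[of F] by (simp only: ennreal_of_nat_eq_real_of_nat)
    qed
    moreover have "\<exists>k. ?S < of_nat k" if "?S < top" using ennreal_Ex_less_of_nat[of ?S] that by (simp add: less_top)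
    ultimately have "?S = top" unfolding less_top not_le[symmetric] by (meson leD less_top)
    then show ?thesis by (simp only: top_greatest)
  qed
  show "?S \<le> num_points A \<omega>"
  proof (rule SUP_least)
    fix V assume "V \<in> {V. finite V \<and> V \<subseteq> B \<and> disjoint V}"
    then have V: "finite V" "disjoint V" by auto
    have "(\<Sum>U\<in>V. if \<omega> \<inter> (A \<inter> U) = {} then 0 else 1) \<le> (\<Sum>U\<in>V. emeasure (count_space UNIV) (\<omega> \<inter> A \<inter> U))"
    proof (intro sum_mono)
      fix U assume "U \<in> V"
      have "1 \<le> emeasure (count_space UNIV) X" if "X \<noteq> {}" for X :: "'a set"
      proof -
        from that obtain x where "{x} \<subseteq> X" by auto
        then have "emeasure (count_space UNIV) {x} \<le> emeasure (count_space UNIV) X" by (intro emeasure_mono) auto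
        then show ?thesis by simp
      qed
      then show "(if \<omega> \<inter> (A \<inter> U) = {} then 0 else 1) \<le> emeasure (count_space UNIV) (\<omega> \<inter> A \<inter> U)"
        by (auto simp: Int_assoc)
    qed
    also have "\<dots> = emeasure (count_space UNIV) (\<Union>U\<in>V. \<omega> \<inter> A \<inter> U)"
      using V by (intro sum_emeasure) (auto simp: disjoint_family_on_def disjoint_def)
    also have "\<dots> \<le> num_points A \<omega>"
      unfolding num_points_def by (intro emeasure_mono) auto
    finally show "(\<Sum>U\<in>V. if \<omega> \<inter> (A \<inter> U) = {} then 0 else 1) \<le> num_points A \<omega>" .
  qed
qed

text \<open>Every summand in \<open>num_points_SUP\<close> is decided by a void event, and for a
  countable basis the supremum runs over countably many finite families. Counts are therefore
  measurable for the sigma-algebra that void events generate.\<close>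

lemma sets_config_space_void:
  fixes M :: "'a::{metric_space,second_countable_topology} measure"
  assumes op: "\<And>U. open U \<Longrightarrow> U \<inter> space M \<in> sets M"
  shows "sets (config_space M) = sigma_sets (configurations (space M)) {void M A |A. A \<in> sets M}"
proof -
  let ?\<Omega> = "configurations (space M)" and ?G = "{void M A |A. A \<in> sets M}"
  let ?V = "sigma ?\<Omega> ?G"
  obtain B :: "'a set set" where B: "countable B" "topological_basis B"
    using ex_countable_basis by auto
  have G: "?G \<subseteq> Pow ?\<Omega>" by (auto simp: void_def)
  have sV: "sets ?V = sigma_sets ?\<Omega> ?G" "space ?V = ?\<Omega>"
    using G by (auto simp: space_measure_of_conv)
  have N: "num_points A \<in> borel_measurable ?V" if A: "A \<in> sets M" for A
  proof -
    have 1: "(\<lambda>\<omega>. if \<omega> \<inter> (A \<inter> U) = {} then 0 else 1::ennreal) \<in> borel_measurable ?V" if "U \<in> B" for U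
    proof -
      have "A \<inter> U = A \<inter> (U \<inter> space M)" using A sets.sets_into_space by fastforce
      then have "A \<inter> U \<in> sets M" using A op topological_basis_open[OF B(2) that] by auto
      then have "void M (A \<inter> U) \<in> sets ?V" unfolding sV by (intro sigma_sets.Basic) blast
      moreover have "{\<omega> \<in> space ?V. \<omega> \<inter> (A \<inter> U) = {}} = void M (A \<inter> U)"
        unfolding sV by (auto simp: void_def)
      ultimately show ?thesis by (intro measurable_If) auto
    qed
    have "countable {V. finite V \<and> V \<subseteq> B \<and> disjoint V}"
      by (rule countable_subset[OF _ countable_Collect_finite_subset[OF B(1)]]) auto
    then have "(\<lambda>\<omega>. SUP V\<in>{V. finite V \<and> V \<subseteq> B \<and> disjoint V}. \<Sum>U\<in>V. if \<omega> \<inter> (A \<inter> U) = {} then 0 else 1::ennreal)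
        \<in> borel_measurable ?V"
      by (intro borel_measurable_SUP borel_measurable_sum 1) auto
    then show ?thesis
      by (subst (asm) num_points_SUP[OF B(2), symmetric])
  qed
  show ?thesis
  proof
    have "{\<omega> \<in> ?\<Omega>. num_points A \<omega> \<in> S} \<in> sets ?V" if "A \<in> sets M" "S \<in> sets borel" for A S
    proof -
      have "num_points A -` S \<inter> space ?V \<in> sets ?V" using N that by (auto intro: measurable_sets)
      also have "num_points A -` S \<inter> space ?V = {\<omega> \<in> ?\<Omega>. num_points A \<omega> \<in> S}"
        unfolding sV by auto
      finally show ?thesis .
    qed
    then have "sigma_sets ?\<Omega> {{\<omega> \<in> ?\<Omega>. num_points A \<omega> \<in> S} | A S. A \<in> sets M \<and> S \<in> sets borel}
       \<subseteq> sets ?V"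
      using sets.sigma_sets_subset[of _ ?V] unfolding sV by (smt (verit) mem_Collect_eq subsetI)
    then show "sets (config_space M) \<subseteq> sigma_sets ?\<Omega> ?G"
      unfolding config_space_def by (subst sets_measure_of) (auto simp: sV)
    have "?G \<subseteq> sets (config_space M)" by auto
    then show "sigma_sets ?\<Omega> ?G \<subseteq> sets (config_space M)"
      using sets.sigma_sets_subset[of ?G "config_space M"] by (simp add: space_config_space)
  qed
qed

section \<open>Measurability of sums over the points of a configuration\<close>

lemma measurable_count_kernel:
  fixes M :: "'a::{metric_space,second_countable_topology} measure"
  assumes op: "\<And>U. open U \<Longrightarrow> U \<inter> space M \<in> sets M"
    and \<phi> [measurable]: "\<phi> \<in> N \<rightarrow>\<^sub>M config_space M"
    and h: "(\<lambda>(p, z). h p z) \<in> borel_measurable (N \<Otimes>\<^sub>M M)"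
  shows "(\<lambda>p. \<integral>\<^sup>+z. h p z \<partial>count_space (\<phi> p)) \<in> borel_measurable N"
proof -
  have conf: "\<phi> p \<in> configurations (space M)" if "p \<in> space N" for p
    using measurable_space[OF \<phi> that] by (simp add: space_config_space)
  \<comment> \<open>The centre of the balls is arbitrary. Counts inside \<open>B k\<close> are
    finite, so complements can be treated by subtraction in the induction over measurable sets; the
    cut-off is removed afterwards by monotone convergence.\<close>
  define B where "B k = ball undefined (real k) \<inter> space M" for k :: nat
  have Bs [measurable]: "B k \<in> sets M" for k unfolding B_def by (intro op) auto
  have Bf: "finite (\<phi> p \<inter> B k)" if "p \<in> space N" for p k
    using configurations_finite[OF conf[OF that], of "B k"] unfolding B_def
    by (simp add: bounded_Int)
  have cnt: "(\<integral>\<^sup>+z. indicator Q (p, z) * indicator (B k) z \<partial>count_space (\<phi> p))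
     = of_nat (card {z \<in> \<phi> p \<inter> B k. (p, z) \<in> Q})" if "p \<in> space N" for p k Q
  proof -
    have "(\<integral>\<^sup>+z. indicator Q (p, z) * indicator (B k) z \<partial>count_space (\<phi> p))
      = (\<integral>\<^sup>+z. indicator {z \<in> \<phi> p \<inter> B k. (p, z) \<in> Q} z \<partial>count_space (\<phi> p))"
      by (intro nn_integral_cong) (auto simp: indicator_def)
    also have "\<dots> = emeasure (count_space (\<phi> p)) {z \<in> \<phi> p \<inter> B k. (p, z) \<in> Q}"
      by (intro nn_integral_indicator) auto
    also have "\<dots> = of_nat (card {z \<in> \<phi> p \<inter> B k. (p, z) \<in> Q})"
      by (rule emeasure_count_space_finite) (use Bf[OF that, of k] in \<open>auto intro: finite_subset\<close>)
    finally show ?thesis .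
  qed
  have Qk: "(\<lambda>p. \<integral>\<^sup>+z. indicator Q (p, z) * indicator (B k) z \<partial>count_space (\<phi> p)) \<in> borel_measurable N"
    if "Q \<in> sets (N \<Otimes>\<^sub>M M)" for Q k
    using that unfolding sets_pair_measure
  proof (induct rule: sigma_sets_induct_disjoint[OF Int_stable_pair_measure_generator pair_measure_closed,
      consumes 1, case_names basic empty compl union])
    case (basic Q)
    then obtain X Y where Q: "Q = X \<times> Y" and [measurable]: "X \<in> sets N" "Y \<in> sets M" by auto
    have eq: "(\<integral>\<^sup>+z. indicator Q (p, z) * indicator (B k) z \<partial>count_space (\<phi> p))
       = indicator X p * num_points (Y \<inter> B k) (\<phi> p)" if "p \<in> space N" for p
    proof -
      have "finite (\<phi> p \<inter> (Y \<inter> B k))" using Bf[OF that, of k] by (rule rev_finite_subset) auto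
      moreover have "{z \<in> \<phi> p \<inter> B k. (p, z) \<in> Q} = (if p \<in> X then \<phi> p \<inter> (Y \<inter> B k) else {})"
        using Q by auto
      ultimately show ?thesis unfolding cnt[OF that] by (auto simp: num_points_finite)
    qed
    show ?case by (rule measurable_cong[THEN iffD2], erule eq) measurable
  next
    case empty
    then show ?case by simp
  next
    case (compl Q)
    have eq: "(\<integral>\<^sup>+z. indicator (space N \<times> space M - Q) (p, z) * indicator (B k) z \<partial>count_space (\<phi> p))
       = num_points (B k) (\<phi> p) - (\<integral>\<^sup>+z. indicator Q (p, z) * indicator (B k) z \<partial>count_space (\<phi> p))"
      if "p \<in> space N" for p
    proof -
      have "{z \<in> \<phi> p \<inter> B k. (p, z) \<in> space N \<times> space M - Q} = (\<phi> p \<inter> B k) - {z \<in> \<phi> p \<inter> B k. (p, z) \<in> Q}"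
        using that configurations_subset[OF conf[OF that]] by auto
      then have "card {z \<in> \<phi> p \<inter> B k. (p, z) \<in> space N \<times> space M - Q}
         = card (\<phi> p \<inter> B k) - card {z \<in> \<phi> p \<inter> B k. (p, z) \<in> Q}"
        using Bf[OF that, of k] by (simp only:) (intro card_Diff_subset, auto intro: finite_subset)
      then show ?thesis unfolding cnt[OF that]
        using Bf[OF that, of k] by (simp add: num_points_finite ennreal_of_nat_eq_real_of_nat ennreal_minus
          of_nat_diff card_mono subset_iff)
    qed
    note compl(2) [measurable]
    show ?case by (rule measurable_cong[THEN iffD2], erule eq) measurable
  next
    case (union Q)
    have "(\<integral>\<^sup>+z. indicator (\<Union>i. Q i) (p, z) * indicator (B k) z \<partial>count_space (\<phi> p))
      = (\<Sum>i. \<integral>\<^sup>+z. indicator (Q i) (p, z) * indicator (B k) z \<partial>count_space (\<phi> p))" for p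
      using union(1)
      by (subst nn_integral_suminf[symmetric])
        (auto simp: suminf_indicator[symmetric] ennreal_suminf_multc intro!: nn_integral_cong)
    then show ?case using union(3) by simp
  qed
  have Q: "(\<lambda>p. \<integral>\<^sup>+z. indicator Q (p, z) \<partial>count_space (\<phi> p)) \<in> borel_measurable N"
    if "Q \<in> sets (N \<Otimes>\<^sub>M M)" for Q
  proof -
    have eq: "(\<integral>\<^sup>+z. indicator Q (p, z) \<partial>count_space (\<phi> p))
      = (SUP k. \<integral>\<^sup>+z. indicator Q (p, z) * indicator (B k) z \<partial>count_space (\<phi> p))" if "p \<in> space N" for p
    proof -
      have "(SUP k. indicator Q (p, z) * indicator (B k) z :: ennreal) = indicator Q (p, z)" if "z \<in> \<phi> p" for z
      proof -
        obtain k :: nat where "dist undefined z < real k" using reals_Archimedean2 by blast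
        then have "z \<in> B k" using configurations_subset[OF conf[OF \<open>p \<in> space N\<close>]] that by (auto simp: B_def)
        then show ?thesis by (intro antisym SUP_least SUP_upper2[of k]) (auto simp: indicator_def)
      qed
      then have "(\<integral>\<^sup>+z. indicator Q (p, z) \<partial>count_space (\<phi> p))
        = (\<integral>\<^sup>+z. (SUP k. indicator Q (p, z) * indicator (B k) z) \<partial>count_space (\<phi> p))"
        by (intro nn_integral_cong) auto
      also have "\<dots> = (SUP k. \<integral>\<^sup>+z. indicator Q (p, z) * indicator (B k) z \<partial>count_space (\<phi> p))"
        by (intro nn_integral_monotone_convergence_SUP)
          (auto simp: incseq_def le_fun_def B_def indicator_def)
      finally show ?thesis .
    qed
    note Qk[OF that, measurable]
    show ?thesis by (rule measurable_cong[THEN iffD2], erule eq) measurable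
  qed
  have "(\<lambda>p. \<integral>\<^sup>+z. h' (p, z) \<partial>count_space (\<phi> p)) \<in> borel_measurable N"
    if "h' \<in> borel_measurable (N \<Otimes>\<^sub>M M)" for h'
    using that
  proof induct
    case (cong f g)
    have eq: "(\<integral>\<^sup>+z. f (p, z) \<partial>count_space (\<phi> p)) = (\<integral>\<^sup>+z. g (p, z) \<partial>count_space (\<phi> p))" if "p \<in> space N" for p
      using cong(3) configurations_subset[OF conf[OF that]] that
      by (intro nn_integral_cong) (auto simp: space_pair_measure)
    show ?case by (rule measurable_cong[THEN iffD2], erule eq) (rule cong)
  next
    case (set Q) then show ?case by (rule Q)
  next
    case (mult u c) then show ?case by (simp add: nn_integral_cmult)
  next
    case (add u v) then show ?case by (simp add: nn_integral_add)
  next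
    case (seq U)
    have "(\<integral>\<^sup>+z. (SUP i. U i) (p, z) \<partial>count_space (\<phi> p)) = (SUP i. \<integral>\<^sup>+z. U i (p, z) \<partial>count_space (\<phi> p))" for p
      unfolding SUP_apply using seq(4)
      by (intro nn_integral_monotone_convergence_SUP) (auto simp: incseq_def le_fun_def)
    then show ?case using seq by simp
  qed
  from this[OF h] show ?thesis by simp
qed

text \<open>It is enough to look at preimages of void events, and these are rectangles: after the
  insertion of \<open>z\<close> the set \<open>A\<close> is empty iff it was empty before and
  \<open>z\<close> lies outside \<open>A\<close>.\<close>

lemma measurable_insert_config:
  fixes M :: "'a::{metric_space,second_countable_topology} measure"
  assumes op: "\<And>U. open U \<Longrightarrow> U \<inter> space M \<in> sets M"
  shows "(\<lambda>(\<omega>, z). insert z \<omega>) \<in> config_space M \<Otimes>\<^sub>M M \<rightarrow>\<^sub>M config_space M"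
proof -
  let ?\<Omega> = "configurations (space M)" and ?G = "{void M A |A. A \<in> sets M}"
  have "(\<lambda>(\<omega>, z). insert z \<omega>) \<in> config_space M \<Otimes>\<^sub>M M \<rightarrow>\<^sub>M sigma ?\<Omega> ?G"
  proof (rule measurable_measure_of)
    show "?G \<subseteq> Pow ?\<Omega>" by (auto simp: void_def)
    show "(\<lambda>(\<omega>, z). insert z \<omega>) \<in> space (config_space M \<Otimes>\<^sub>M M) \<rightarrow> ?\<Omega>"
      by (auto simp: space_pair_measure space_config_space intro: insert_configurations)
    fix V assume "V \<in> ?G"
    then obtain A where V: "V = void M A" and [measurable]: "A \<in> sets M" by auto
    have "(\<lambda>(\<omega>, z). insert z \<omega>) -` V \<inter> space (config_space M \<Otimes>\<^sub>M M) = void M A \<times> (space M - A)"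
      by (auto simp: V void_def space_pair_measure space_config_space intro: insert_configurations)
    also have "\<dots> \<in> sets (config_space M \<Otimes>\<^sub>M M)" by measurable
    finally show "(\<lambda>(\<omega>, z). insert z \<omega>) -` V \<inter> space (config_space M \<Otimes>\<^sub>M M) \<in> sets (config_space M \<Otimes>\<^sub>M M)" .
  qed
  also have "(config_space M \<Otimes>\<^sub>M M \<rightarrow>\<^sub>M sigma ?\<Omega> ?G) = (config_space M \<Otimes>\<^sub>M M \<rightarrow>\<^sub>M config_space M)"
    by (rule measurable_cong_sets, simp, subst sets_config_space_void[OF op], assumption, rule sets_measure_of)
      (auto simp: void_def)
  finally show ?thesis .
qed

text \<open>The estimator is defined through \<open>infsum\<close>, while Mecke's formula speaks of
  integrals over \<open>count_space\<close>. Both take the value 0 when the sum does not converge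
  absolutely.\<close>

lemma infsum_eq_integral_count_space:
  fixes f :: "'a \<Rightarrow> real"
  shows "(\<Sum>\<^sub>\<infinity>x\<in>A. f x) = (LINT x|count_space A. f x)"
proof (cases "f summable_on A")
  case True
  then have "Infinite_Sum.abs_summable_on f A" by (rule summable_on_iff_abs_summable_on_real[THEN iffD1])
  then have "Infinite_Set_Sum.abs_summable_on f A" using abs_summable_equivalent by blast
  then show ?thesis by (metis infsetsum_infsum infsetsum_def)
next
  case False
  then have "\<not> Infinite_Sum.abs_summable_on f A" using summable_on_iff_abs_summable_on_real by blast
  then have "\<not> Infinite_Set_Sum.abs_summable_on f A" using abs_summable_equivalent by blast
  then have "\<not> integrable (count_space A) f" by (simp add: Infinite_Set_Sum.abs_summable_on_def)
  then show ?thesis using False by (simp add: infsum_not_exists not_integrable_integral_eq)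
qed

text \<open>The Bochner integral is 0 where the sum does not converge absolutely, so the set of
  these parameters has to be measurable as well. Elsewhere the integral is the difference of the
  sums of the positive and the negative parts.\<close>

lemma measurable_count_integral:
  fixes M :: "'a::{metric_space,second_countable_topology} measure" and h :: "'b \<Rightarrow> 'a \<Rightarrow> real"
  assumes op: "\<And>U. open U \<Longrightarrow> U \<inter> space M \<in> sets M"
    and \<phi>: "\<phi> \<in> N \<rightarrow>\<^sub>M config_space M"
    and h [measurable]: "(\<lambda>(p, z). h p z) \<in> borel_measurable (N \<Otimes>\<^sub>M M)"
  shows "(\<lambda>p. LINT z|count_space (\<phi> p). h p z) \<in> borel_measurable N"
proof -
  note kernel [measurable] = measurable_count_kernel[OF op \<phi>]
  have int: "integrable (count_space (\<phi> p)) (h p) \<longleftrightarrow> (\<integral>\<^sup>+z. ennreal \<bar>h p z\<bar> \<partial>count_space (\<phi> p)) < \<infinity>" for p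
    by (simp add: integrable_iff_bounded)
  have 1: "Measurable.pred N (\<lambda>p. integrable (count_space (\<phi> p)) (h p))"
    unfolding int by measurable
  have "(LINT z|count_space (\<phi> p). h p z) =
      (if integrable (count_space (\<phi> p)) (h p) then
        enn2real (\<integral>\<^sup>+z. ennreal (h p z) \<partial>count_space (\<phi> p)) -
        enn2real (\<integral>\<^sup>+z. ennreal (- h p z) \<partial>count_space (\<phi> p)) else 0)" for p
    by (simp add: real_lebesgue_integral_def not_integrable_integral_eq)
  then show ?thesis using 1 by simp
qed

text \<open>Void events are stable under intersection and generate the sigma-algebra. The void event
  of the empty set is the whole space, so its constant sequence serves as the exhaustion in the
  uniqueness theorem.\<close>

lemma emeasure_void_unique:
  fixes M :: "'a::{metric_space,second_countable_topology} measure"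
  assumes op: "\<And>U. open U \<Longrightarrow> U \<inter> space M \<in> sets M"
    and sets: "sets P = sets (config_space M)" "sets Q = sets (config_space M)"
    and fin: "emeasure P (space P) \<noteq> \<infinity>"
    and eq: "\<And>A. A \<in> sets M \<Longrightarrow> emeasure P (void M A) = emeasure Q (void M A)"
  shows "P = Q"
proof (rule measure_eqI_generator_eq[OF Int_stable_void[of M], where A = "\<lambda>_. void M {}"])
  show "{void M A |A. A \<in> sets M} \<subseteq> Pow (configurations (space M))" by (auto simp: void_def)
  show "sets P = sigma_sets (configurations (space M)) {void M A |A. A \<in> sets M}"
    "sets Q = sigma_sets (configurations (space M)) {void M A |A. A \<in> sets M}"
    using sets sets_config_space_void[OF op] by auto
  have "space P = configurations (space M)"
    using sets_eq_imp_space_eq[OF sets(1)] by (simp add: space_config_space)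
  then show "emeasure P (void M {}) \<noteq> \<infinity>" using fin by (simp add: void_empty)
  show "range (\<lambda>_. void M {}) \<subseteq> {void M A |A. A \<in> sets M}" by blast
qed (auto simp: eq void_empty)

section \<open>Mecke's formula\<close>

text \<open>\<open>bounded_finite\<close> turns balls into an exhaustion by sets of finite
  intensity. \<open>no_atoms\<close> ensures that a fixed point is almost surely not yet present, so
  that inserting it changes the configuration.\<close>

locale poisson_model =
  fixes \<mu> :: "'a::{metric_space,second_countable_topology} measure" and P :: "'a set measure"
  assumes poisson_process: "poisson_process \<mu> P"
    and open_sets: "\<And>U. open U \<Longrightarrow> U \<inter> space \<mu> \<in> sets \<mu>"
    and bounded_finite: "\<And>B. bounded B \<Longrightarrow> B \<in> sets \<mu> \<Longrightarrow> emeasure \<mu> B < \<infinity>"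
    and no_atoms: "\<And>z. z \<in> space \<mu> \<Longrightarrow> emeasure \<mu> {z} = 0"
begin

lemma sets_P [measurable_cong]: "sets P = sets (config_space \<mu>)"
  using poisson_process by (simp add: poisson_process_def)

sublocale prob_space P
  using poisson_process by (simp add: poisson_process_def)

lemma space_P: "space P = configurations (space \<mu>)"
  using sets_eq_imp_space_eq[OF sets_P] by (simp add: space_config_space)

definition exhaustion :: "nat \<Rightarrow> 'a set" where
  "exhaustion k = ball undefined (real k) \<inter> space \<mu>"

lemma exhaustion: "exhaustion k \<in> sets \<mu>" "bounded (exhaustion k)" "(\<Union>k. exhaustion k) = space \<mu>"
proof -
  show "exhaustion k \<in> sets \<mu>" "bounded (exhaustion k)"
    unfolding exhaustion_def by (auto intro: open_sets simp: bounded_Int)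
  have "\<exists>k. x \<in> exhaustion k" if "x \<in> space \<mu>" for x
    using that reals_Archimedean2[of "dist undefined x"] by (auto simp: exhaustion_def)
  then show "(\<Union>k. exhaustion k) = space \<mu>" by (auto simp: exhaustion_def)
qed

sublocale sigma_finite_measure \<mu>
proof
  show "\<exists>A. countable A \<and> A \<subseteq> sets \<mu> \<and> \<Union> A = space \<mu> \<and> (\<forall>a\<in>A. emeasure \<mu> a \<noteq> \<infinity>)"
    using exhaustion bounded_finite by (intro exI[of _ "range exhaustion"]) (auto simp: less_top)
qed

sublocale PM: pair_sigma_finite P \<mu> ..

lemma measurable_insert [measurable]:
  "(\<lambda>(\<omega>, z). insert z \<omega>) \<in> P \<Otimes>\<^sub>M \<mu> \<rightarrow>\<^sub>M config_space \<mu>"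
  using measurable_insert_config[OF open_sets] by (simp cong: measurable_cong_sets add: sets_P)

lemma measurable_insert_pair [measurable]:
  "(\<lambda>(\<omega>, z). (insert z \<omega>, z)) \<in> P \<Otimes>\<^sub>M \<mu> \<rightarrow>\<^sub>M P \<Otimes>\<^sub>M \<mu>"
  by measurable

text \<open>The case distinction matters: \<open>measure \<mu> A\<close> is 0 for a set of infinite
  intensity, which would turn the exponential into 1 instead of 0.\<close>

lemma prob_void:
  assumes "A \<in> sets \<mu>"
  shows "prob (void \<mu> A) = (if emeasure \<mu> A < \<infinity> then exp (- measure \<mu> A) else 0)"
proof (cases "emeasure \<mu> A < \<infinity>")
  case True
  have "measure P {\<omega> \<in> space P. num_points A \<omega> = of_nat 0} = measure \<mu> A ^ 0 / fact 0 * exp (- measure \<mu> A)"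
    using poisson_process assms True unfolding poisson_process_def by blast
  then show ?thesis using True by (simp add: void_eq space_P space_config_space)
next
  case False
  then have "AE \<omega> in P. num_points A \<omega> = \<infinity>"
    using poisson_process assms unfolding poisson_process_def by (auto simp: less_top)
  then have "AE \<omega> in P. \<omega> \<notin> void \<mu> A" by eventually_elim (simp add: void_eq)
  then have "prob (void \<mu> A) = 0" using assms by (subst prob_eq_0) (auto simp: sets_P)
  then show ?thesis using False by simp
qed

lemma AE_void_null:
  assumes "A \<in> sets \<mu>" "emeasure \<mu> A = 0"
  shows "AE \<omega> in P. \<omega> \<inter> A = {}"
proof -
  have "prob (void \<mu> A) = 1" using prob_void[OF assms(1)] assms(2) by (simp add: measure_def)
  then have "AE \<omega> in P. \<omega> \<in> void \<mu> A" using assms(1) by (subst (asm) prob_eq_1) (auto simp: sets_P)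
  then show ?thesis by eventually_elim (simp add: void_def)
qed

lemma nn_integral_num_points:
  assumes A: "A \<in> sets \<mu>" "bounded A"
  shows "(\<integral>\<^sup>+\<omega>. num_points A \<omega> \<partial>P) = emeasure \<mu> A"
proof -
  have fin: "emeasure \<mu> A < \<infinity>" using bounded_finite A by auto
  define m where "m = measure \<mu> A"
  have m: "0 \<le> m" by (simp add: m_def)
  have [measurable]: "num_points A \<in> borel_measurable P"
    using measurable_num_points[OF A(1)] by (simp cong: measurable_cong_sets add: sets_P)
  have "num_points A \<omega> = (\<Sum>k. of_nat k * indicator {\<omega> \<in> space P. num_points A \<omega> = of_nat k} \<omega>)"
    if "\<omega> \<in> space P" for \<omega>
  proof -
    have "finite (\<omega> \<inter> A)" using that A(2) by (auto simp: space_P configurations_finite)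
    then have *: "num_points A \<omega> = of_nat (card (\<omega> \<inter> A))" by (rule num_points_finite)
    have "(\<Sum>k. of_nat k * indicator {\<omega> \<in> space P. num_points A \<omega> = of_nat k} \<omega> :: ennreal)
      = (\<Sum>k\<in>{card (\<omega> \<inter> A)}. of_nat k * indicator {\<omega> \<in> space P. num_points A \<omega> = of_nat k} \<omega>)"
      by (intro suminf_finite) (auto simp: * split: split_indicator)
    then show ?thesis using that * by simp
  qed
  then have "(\<integral>\<^sup>+\<omega>. num_points A \<omega> \<partial>P)
    = (\<integral>\<^sup>+\<omega>. (\<Sum>k. of_nat k * indicator {\<omega> \<in> space P. num_points A \<omega> = of_nat k} \<omega>) \<partial>P)"
    by (rule nn_integral_cong)
  also have "\<dots> = (\<Sum>k. of_nat k * emeasure P {\<omega> \<in> space P. num_points A \<omega> = of_nat k})"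
    by (subst nn_integral_suminf) (auto intro!: suminf_cong simp: nn_integral_cmult_indicator)
  also have "\<dots> = (\<Sum>k. ennreal (real k * (m ^ k / fact k * exp (- m))))"
  proof (intro suminf_cong)
    fix k :: nat
    have "measure P {\<omega> \<in> space P. num_points A \<omega> = of_nat k} = m ^ k / fact k * exp (- m)"
      using poisson_process A fin unfolding poisson_process_def m_def by blast
    then show "of_nat k * emeasure P {\<omega> \<in> space P. num_points A \<omega> = of_nat k} = ennreal (real k * (m ^ k / fact k * exp (- m)))"
      by (simp add: emeasure_eq_measure ennreal_of_nat_eq_real_of_nat ennreal_mult' [symmetric])
  qed
  also have "\<dots> = ennreal m"
  proof (rule suminf_ennreal_eq)
    \<comment> \<open>The term for \<open>k = 0\<close> vanishes, and cancelling \<open>k\<close>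
      against the factorial turns the others into \<open>m * exp (- m)\<close> times the exponential
      series.\<close>
    have "(\<lambda>k. (m * exp (- m)) * (m ^ k /\<^sub>R fact k)) sums ((m * exp (- m)) * exp m)"
      by (intro sums_mult exp_converges)
    moreover have "(m * exp (- m)) * (m ^ k /\<^sub>R fact k) = real (Suc k) * (m ^ Suc k / fact (Suc k) * exp (- m))" for k
      by (simp add: field_simps del: of_nat_Suc)
    ultimately have "(\<lambda>k. real (Suc k) * (m ^ Suc k / fact (Suc k) * exp (- m))) sums m"
      by (simp add: exp_minus field_simps del: of_nat_Suc)
    then show "(\<lambda>k. real k * (m ^ k / fact k * exp (- m))) sums m"
      by (subst (asm) sums_Suc_iff) simp
  qed (simp add: m)
  also have "\<dots> = emeasure \<mu> A" using fin by (simp add: m_def emeasure_eq_ennreal_measure less_top)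
  finally show ?thesis .
qed

text \<open>While \<open>A\<close> is empty, the points in \<open>B\<close> are those in
  \<open>B - A\<close>, and the counts in the disjoint sets \<open>A\<close> and
  \<open>B - A\<close> are independent. The families \<open>C\<close> and \<open>Y\<close> bring the
  two sets and the two functions into the indexed form of \<open>indep_vars\<close>.\<close>

lemma nn_integral_void_num_points:
  assumes [measurable]: "A \<in> sets \<mu>" "B \<in> sets \<mu>" and B: "bounded B"
  shows "(\<integral>\<^sup>+\<omega>. indicator (void \<mu> A) \<omega> * num_points B \<omega> \<partial>P) = emeasure P (void \<mu> A) * emeasure \<mu> (B - A)"
proof -
  define C where "C i = (if i = 0 then A else B - A)" for i :: nat
  define Y where "Y i = (if i = 0 then indicator {0} else id :: ennreal \<Rightarrow> ennreal)" for i :: nat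
  have "(\<forall>i<2. C i \<in> sets \<mu>) \<and> disjoint_family_on C {..<2}"
    by (auto simp: C_def disjoint_family_on_def)
  then have "indep_vars (\<lambda>_. borel) (\<lambda>i \<omega>. num_points (C i) \<omega>) {..<2}"
    using poisson_process unfolding poisson_process_def by blast
  then have "indep_vars (\<lambda>_. borel) (\<lambda>i \<omega>. Y i (num_points (C i) \<omega>)) {..<2}"
    by (rule indep_vars_compose2) (auto simp: Y_def)
  then have *: "(\<integral>\<^sup>+\<omega>. (\<Prod>i<2. Y i (num_points (C i) \<omega>)) \<partial>P) = (\<Prod>i<2. \<integral>\<^sup>+\<omega>. Y i (num_points (C i) \<omega>) \<partial>P)"
    by (intro indep_vars_nn_integral) auto
  have "(\<integral>\<^sup>+\<omega>. indicator (void \<mu> A) \<omega> * num_points B \<omega> \<partial>P) = (\<integral>\<^sup>+\<omega>. (\<Prod>i<2. Y i (num_points (C i) \<omega>)) \<partial>P)"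
  proof (rule nn_integral_cong)
    fix \<omega> assume "\<omega> \<in> space P"
    moreover have "num_points B \<omega> = num_points (B - A) \<omega>" if "\<omega> \<inter> A = {}"
      using that by (auto simp: num_points_def intro!: arg_cong[where f = "emeasure _"])
    ultimately show "indicator (void \<mu> A) \<omega> * num_points B \<omega> = (\<Prod>i<2. Y i (num_points (C i) \<omega>))"
      by (auto simp: Y_def C_def void_def space_P numeral_2_eq_2 lessThan_Suc num_points_eq_0 split: split_indicator)
  qed
  also have "\<dots> = (\<integral>\<^sup>+\<omega>. indicator (void \<mu> A) \<omega> \<partial>P) * (\<integral>\<^sup>+\<omega>. num_points (B - A) \<omega> \<partial>P)"
    unfolding * by (auto simp: Y_def C_def numeral_2_eq_2 lessThan_Suc mult.commute void_def space_P num_points_eq_0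
      intro!: arg_cong2[where f = "(*)"] nn_integral_cong split: split_indicator)
  also have "\<dots> = emeasure P (void \<mu> A) * emeasure \<mu> (B - A)"
    using B by (subst nn_integral_num_points) (auto simp: sets_P intro: bounded_subset)
  finally show ?thesis .
qed

text \<open>The Campbell measure of the process: a configuration together with one of its points,
  every point being counted once. Mecke's formula is the identity of this measure with the image of
  \<open>P \<Otimes>\<^sub>M \<mu>\<close> under insertion.\<close>

definition campbell :: "('a set \<times> 'a) measure" where
  "campbell = measure_of (space (P \<Otimes>\<^sub>M \<mu>)) (sets (P \<Otimes>\<^sub>M \<mu>))
     (\<lambda>Q. \<integral>\<^sup>+\<omega>. \<integral>\<^sup>+z. indicator Q (\<omega>, z) \<partial>count_space \<omega> \<partial>P)"

lemma measurable_sum_points [measurable]: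
  assumes "(\<lambda>(p, z). h p z) \<in> borel_measurable (N \<Otimes>\<^sub>M \<mu>)" "\<phi> \<in> N \<rightarrow>\<^sub>M P"
  shows "(\<lambda>p. \<integral>\<^sup>+z. h p z \<partial>count_space (\<phi> p)) \<in> borel_measurable N"
  using assms by (intro measurable_count_kernel[OF open_sets, of \<phi>]) (auto cong: measurable_cong_sets simp: sets_P)

lemma sets_campbell [measurable_cong]: "sets campbell = sets (P \<Otimes>\<^sub>M \<mu>)"
  by (simp add: campbell_def)

lemma emeasure_campbell:
  assumes "Q \<in> sets (P \<Otimes>\<^sub>M \<mu>)"
  shows "emeasure campbell Q = (\<integral>\<^sup>+\<omega>. \<integral>\<^sup>+z. indicator Q (\<omega>, z) \<partial>count_space \<omega> \<partial>P)"
  unfolding campbell_def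
proof (rule emeasure_measure_of_sigma)
  show "sigma_algebra (space (P \<Otimes>\<^sub>M \<mu>)) (sets (P \<Otimes>\<^sub>M \<mu>))" ..
  show "positive (sets (P \<Otimes>\<^sub>M \<mu>)) (\<lambda>Q. \<integral>\<^sup>+\<omega>. \<integral>\<^sup>+z. indicator Q (\<omega>, z) \<partial>count_space \<omega> \<partial>P)"
    by (simp add: positive_def)
  show "countably_additive (sets (P \<Otimes>\<^sub>M \<mu>)) (\<lambda>Q. \<integral>\<^sup>+\<omega>. \<integral>\<^sup>+z. indicator Q (\<omega>, z) \<partial>count_space \<omega> \<partial>P)"
  proof (rule countably_additiveI)
    fix Q :: "nat \<Rightarrow> _" assume Q: "range Q \<subseteq> sets (P \<Otimes>\<^sub>M \<mu>)" "disjoint_family Q"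
    then have [measurable]: "Q i \<in> sets (P \<Otimes>\<^sub>M \<mu>)" for i by auto
    have "(\<lambda>p. indicator (Q i) p :: ennreal) \<in> borel_measurable (P \<Otimes>\<^sub>M \<mu>)" for i by measurable
    then have m: "(\<lambda>\<omega>. \<integral>\<^sup>+z. indicator (Q i) (\<omega>, z) \<partial>count_space \<omega>) \<in> borel_measurable P" for i
      by (intro measurable_sum_points) auto
    have "(\<Sum>i. \<integral>\<^sup>+\<omega>. \<integral>\<^sup>+z. indicator (Q i) (\<omega>, z) \<partial>count_space \<omega> \<partial>P)
      = (\<integral>\<^sup>+\<omega>. (\<Sum>i. \<integral>\<^sup>+z. indicator (Q i) (\<omega>, z) \<partial>count_space \<omega>) \<partial>P)"
      using m by (subst nn_integral_suminf) auto
    also have "\<dots> = (\<integral>\<^sup>+\<omega>. \<integral>\<^sup>+z. (\<Sum>i. indicator (Q i) (\<omega>, z)) \<partial>count_space \<omega> \<partial>P)"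
      by (subst nn_integral_suminf) auto
    finally show "(\<Sum>i. \<integral>\<^sup>+\<omega>. \<integral>\<^sup>+z. indicator (Q i) (\<omega>, z) \<partial>count_space \<omega> \<partial>P) =
        (\<integral>\<^sup>+\<omega>. \<integral>\<^sup>+z. indicator (\<Union>(range Q)) (\<omega>, z) \<partial>count_space \<omega> \<partial>P)"
      by (simp add: suminf_indicator[OF Q(2)])
  qed
qed fact

lemma nn_integral_campbell:
  assumes "h \<in> borel_measurable (P \<Otimes>\<^sub>M \<mu>)"
  shows "(\<integral>\<^sup>+p. h p \<partial>campbell) = (\<integral>\<^sup>+\<omega>. \<integral>\<^sup>+z. h (\<omega>, z) \<partial>count_space \<omega> \<partial>P)"
proof -
  have m: "(\<lambda>\<omega>. \<integral>\<^sup>+z. u (\<omega>, z) \<partial>count_space \<omega>) \<in> borel_measurable P"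
    if "u \<in> borel_measurable (P \<Otimes>\<^sub>M \<mu>)" for u
    using that by (intro measurable_sum_points) auto
  have h: "h \<in> borel_measurable campbell" using assms by (simp cong: measurable_cong_sets add: sets_campbell)
  have s: "borel_measurable campbell = borel_measurable (P \<Otimes>\<^sub>M \<mu>)"
    by (intro measurable_cong_sets sets_campbell refl)
  from h show ?thesis
  proof induct
    case (cong f g)
    have "(\<integral>\<^sup>+z. f (\<omega>, z) \<partial>count_space \<omega>) = (\<integral>\<^sup>+z. g (\<omega>, z) \<partial>count_space \<omega>)" if "\<omega> \<in> space P" for \<omega>
    proof (rule nn_integral_cong)
      fix z assume "z \<in> space (count_space \<omega>)"
      then have "(\<omega>, z) \<in> space campbell"
        using that by (auto simp: sets_eq_imp_space_eq[OF sets_campbell] space_pair_measure space_P configurations_def)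
      then show "f (\<omega>, z) = g (\<omega>, z)" by (rule cong(3))
    qed
    then have "(\<integral>\<^sup>+\<omega>. \<integral>\<^sup>+z. f (\<omega>, z) \<partial>count_space \<omega> \<partial>P) = (\<integral>\<^sup>+\<omega>. \<integral>\<^sup>+z. g (\<omega>, z) \<partial>count_space \<omega> \<partial>P)"
      by (rule nn_integral_cong)
    with cong show ?case using nn_integral_cong[of campbell f g] by simp
  next
    case (set Q) then show ?case by (simp add: emeasure_campbell sets_campbell)
  next
    case (mult u c)
    then show ?case using m[of u] by (simp add: nn_integral_cmult s)
  next
    case (add u v)
    then show ?case using m[of u] m[of v] by (simp add: nn_integral_add s)
  next
    case (seq U)
    have "(\<integral>\<^sup>+p. (SUP i. U i) p \<partial>campbell) = (SUP i. \<integral>\<^sup>+p. U i p \<partial>campbell)"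
      unfolding SUP_apply using seq by (intro nn_integral_monotone_convergence_SUP) auto
    also have "\<dots> = (SUP i. \<integral>\<^sup>+\<omega>. \<integral>\<^sup>+z. U i (\<omega>, z) \<partial>count_space \<omega> \<partial>P)" using seq by simp
    also have "\<dots> = (\<integral>\<^sup>+\<omega>. (SUP i. \<integral>\<^sup>+z. U i (\<omega>, z) \<partial>count_space \<omega>) \<partial>P)"
    proof (rule nn_integral_monotone_convergence_SUP[symmetric])
      show "incseq (\<lambda>i \<omega>. \<integral>\<^sup>+z. U i (\<omega>, z) \<partial>count_space \<omega>)"
        using seq(4) by (auto simp: incseq_def le_fun_def intro!: nn_integral_mono)
      show "(\<lambda>\<omega>. \<integral>\<^sup>+z. U i (\<omega>, z) \<partial>count_space \<omega>) \<in> borel_measurable P" for i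
        using seq(1) m by (simp add: s)
    qed
    also have "\<dots> = (\<integral>\<^sup>+\<omega>. \<integral>\<^sup>+z. (SUP i. U i) (\<omega>, z) \<partial>count_space \<omega> \<partial>P)"
      unfolding SUP_apply using seq(4)
      by (intro nn_integral_cong nn_integral_monotone_convergence_SUP[symmetric]) (auto simp: incseq_def le_fun_def)
    finally show ?case .
  qed
qed

text \<open>The second factor is kept bounded because \<open>nn_integral_void_num_points\<close>
  evaluates the Campbell measure on such rectangles, and it is finite there. Any measurable set is a
  countable union of bounded ones, so they still generate.\<close>

lemma sets_pair_void:
  "sets (P \<Otimes>\<^sub>M \<mu>) = sigma_sets (space P \<times> space \<mu>) {void \<mu> A \<times> B |A B. A \<in> sets \<mu> \<and> B \<in> sets \<mu> \<and> bounded B}"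
proof -
  let ?V = "{void \<mu> A |A. A \<in> sets \<mu>}" and ?B = "{B \<in> sets \<mu>. bounded B}"
  have V: "?V \<subseteq> Pow (space P)" by (auto simp: void_def space_P)
  have B: "?B \<subseteq> Pow (space \<mu>)" using sets.sets_into_space by auto
  have "A \<in> sigma_sets (space \<mu>) ?B" if "A \<in> sets \<mu>" for A
  proof -
    have "A = (\<Union>k. A \<inter> exhaustion k)" using that exhaustion(3) sets.sets_into_space by fastforce
    moreover have "A \<inter> exhaustion k \<in> ?B" for k
      using that exhaustion by (auto intro: bounded_subset)
    then have "(\<Union>k. A \<inter> exhaustion k) \<in> sigma_sets (space \<mu>) ?B"
      by (intro sigma_sets.Union sigma_sets.Basic)
    ultimately show ?thesis by simp
  qed
  moreover have "sigma_sets (space \<mu>) ?B \<subseteq> sets \<mu>" by (rule sets.sigma_sets_subset) auto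
  ultimately have "sets \<mu> = sets (sigma (space \<mu>) ?B)" using B by auto
  moreover have "sets P = sets (sigma (space P) ?V)"
    using V sets_config_space_void[OF open_sets] by (simp add: sets_P space_P)
  ultimately have "sets (P \<Otimes>\<^sub>M \<mu>) = sets (sigma (space P) ?V \<Otimes>\<^sub>M sigma (space \<mu>) ?B)"
    by (intro sets_pair_measure_cong)
  also have "sigma (space P) ?V \<Otimes>\<^sub>M sigma (space \<mu>) ?B = sigma (space P \<times> space \<mu>) {a \<times> b |a b. a \<in> ?V \<and> b \<in> ?B}"
  proof (rule sigma_prod[OF _ V _ B])
    show "\<exists>E\<subseteq>?V. countable E \<and> space P = \<Union>E"
      by (intro exI[of _ "{void \<mu> {}}"]) (use void_empty in \<open>auto simp: space_P\<close>)
    show "\<exists>E\<subseteq>?B. countable E \<and> space \<mu> = \<Union>E"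
      using exhaustion by (intro exI[of _ "range exhaustion"]) auto
  qed
  also have "{a \<times> b |a b. a \<in> ?V \<and> b \<in> ?B} = {void \<mu> A \<times> B |A B. A \<in> sets \<mu> \<and> B \<in> sets \<mu> \<and> bounded B}"
    by blast
  finally show ?thesis using V B by (subst (asm) sets_measure_of) fastforce+
qed

text \<open>On the rectangle \<open>void \<mu> A \<times> B\<close> both sides equal the probability
  of the void event times the intensity of \<open>B - A\<close>: an inserted point of
  \<open>B\<close> leaves \<open>A\<close> empty only if it avoids \<open>A\<close>.\<close>

lemma campbell_eq: "campbell = distr (P \<Otimes>\<^sub>M \<mu>) (P \<Otimes>\<^sub>M \<mu>) (\<lambda>(\<omega>, z). (insert z \<omega>, z))"
proof (rule measure_eqI_generator_eq)
  let ?G = "{void \<mu> A \<times> B |A B. A \<in> sets \<mu> \<and> B \<in> sets \<mu> \<and> bounded B}"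
  show "Int_stable ?G"
  proof (rule Int_stableI)
    fix a b assume "a \<in> ?G" "b \<in> ?G"
    then obtain A B C D where a: "a = void \<mu> A \<times> B" "b = void \<mu> C \<times> D" and
      s: "A \<in> sets \<mu>" "B \<in> sets \<mu>" "C \<in> sets \<mu>" "D \<in> sets \<mu>" "bounded B" by blast
    have "a \<inter> b = void \<mu> (A \<union> C) \<times> (B \<inter> D)" by (simp add: a Times_Int_Times void_Int)
    moreover have "A \<union> C \<in> sets \<mu>" "B \<inter> D \<in> sets \<mu>" "bounded (B \<inter> D)" using s by (auto simp: bounded_Int)
    ultimately show "a \<inter> b \<in> ?G" by blast
  qed
  show "?G \<subseteq> Pow (space P \<times> space \<mu>)"
    using sets.sets_into_space by (fastforce simp: void_def space_P)
  show "sets campbell = sigma_sets (space P \<times> space \<mu>) ?G" by (simp only: sets_campbell sets_pair_void)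
  show "sets (distr (P \<Otimes>\<^sub>M \<mu>) (P \<Otimes>\<^sub>M \<mu>) (\<lambda>(\<omega>, z). (insert z \<omega>, z))) = sigma_sets (space P \<times> space \<mu>) ?G"
    by (simp only: sets_distr sets_pair_void)
  have c: "emeasure campbell (void \<mu> A \<times> B) = emeasure P (void \<mu> A) * emeasure \<mu> (B - A)"
    if [measurable]: "A \<in> sets \<mu>" "B \<in> sets \<mu>" and "bounded B" for A B
  proof -
    have "emeasure campbell (void \<mu> A \<times> B) = (\<integral>\<^sup>+\<omega>. \<integral>\<^sup>+z. indicator (void \<mu> A \<times> B) (\<omega>, z) \<partial>count_space \<omega> \<partial>P)"
      by (rule emeasure_campbell) measurable
    also have "\<dots> = (\<integral>\<^sup>+\<omega>. indicator (void \<mu> A) \<omega> * num_points B \<omega> \<partial>P)"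
    proof (rule nn_integral_cong)
      fix \<omega> assume "\<omega> \<in> space P"
      then have fin: "finite (\<omega> \<inter> B)" using \<open>bounded B\<close> by (auto simp: space_P configurations_finite)
      show "(\<integral>\<^sup>+z. indicator (void \<mu> A \<times> B) (\<omega>, z) \<partial>count_space \<omega>) = indicator (void \<mu> A) \<omega> * num_points B \<omega>"
        using fin by (simp add: indicator_times nn_integral_cmult nn_integral_indicator_count_space)
    qed
    also have "\<dots> = emeasure P (void \<mu> A) * emeasure \<mu> (B - A)"
      using that by (rule nn_integral_void_num_points)
    finally show ?thesis .
  qed
  show "emeasure campbell X = emeasure (distr (P \<Otimes>\<^sub>M \<mu>) (P \<Otimes>\<^sub>M \<mu>) (\<lambda>(\<omega>, z). (insert z \<omega>, z))) X" if "X \<in> ?G" for X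
  proof -
    from that obtain A B where X: "X = void \<mu> A \<times> B" and [measurable]: "A \<in> sets \<mu>" "B \<in> sets \<mu>" and "bounded B" by blast
    have "emeasure (distr (P \<Otimes>\<^sub>M \<mu>) (P \<Otimes>\<^sub>M \<mu>) (\<lambda>(\<omega>, z). (insert z \<omega>, z))) X
      = emeasure (P \<Otimes>\<^sub>M \<mu>) ((\<lambda>(\<omega>, z). (insert z \<omega>, z)) -` X \<inter> space (P \<Otimes>\<^sub>M \<mu>))"
      unfolding X by (rule emeasure_distr) measurable
    also have "(\<lambda>(\<omega>, z). (insert z \<omega>, z)) -` X \<inter> space (P \<Otimes>\<^sub>M \<mu>) = void \<mu> A \<times> (B - A)"
      using sets.sets_into_space[OF \<open>B \<in> sets \<mu>\<close>]
      by (auto simp: X void_def space_pair_measure space_P intro!: insert_configurations)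
    also have "emeasure (P \<Otimes>\<^sub>M \<mu>) (void \<mu> A \<times> (B - A)) = emeasure P (void \<mu> A) * emeasure \<mu> (B - A)"
      by (rule emeasure_pair_measure_Times) measurable
    finally show ?thesis using c \<open>bounded B\<close> by (simp add: X)
  qed
  show "range (\<lambda>k. void \<mu> {} \<times> exhaustion k) \<subseteq> ?G" using exhaustion by blast
  show "(\<Union>k. void \<mu> {} \<times> exhaustion k) = space P \<times> space \<mu>"
    using exhaustion(3) by (auto simp: void_empty space_P)
  show "emeasure campbell (void \<mu> {} \<times> exhaustion k) \<noteq> \<infinity>" for k
    using bounded_finite[of "exhaustion k"] exhaustion(1,2)[of k]
    by (simp add: c ennreal_mult_eq_top_iff less_top emeasure_eq_measure)
qed

theorem mecke:
  assumes h [measurable]: "(\<lambda>(\<omega>, z). h \<omega> z) \<in> borel_measurable (P \<Otimes>\<^sub>M \<mu>)"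
  shows "(\<integral>\<^sup>+\<omega>. \<integral>\<^sup>+z. h \<omega> z \<partial>count_space \<omega> \<partial>P) = (\<integral>\<^sup>+p. h (insert (snd p) (fst p)) (snd p) \<partial>(P \<Otimes>\<^sub>M \<mu>))"
proof -
  have "(\<integral>\<^sup>+\<omega>. \<integral>\<^sup>+z. h \<omega> z \<partial>count_space \<omega> \<partial>P) = (\<integral>\<^sup>+p. (case p of (\<omega>, z) \<Rightarrow> h \<omega> z) \<partial>campbell)"
    by (subst nn_integral_campbell) (auto intro: h)
  also have "\<dots> = (\<integral>\<^sup>+p. h (insert (snd p) (fst p)) (snd p) \<partial>(P \<Otimes>\<^sub>M \<mu>))"
    unfolding campbell_eq by (subst nn_integral_distr) (auto simp: split_beta')
  finally show ?thesis .
qed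

lemma mecke_iterated:
  assumes [measurable]: "(\<lambda>(\<omega>, z). h \<omega> z) \<in> borel_measurable (P \<Otimes>\<^sub>M \<mu>)"
  shows "(\<integral>\<^sup>+\<omega>. \<integral>\<^sup>+z. h \<omega> z \<partial>count_space \<omega> \<partial>P) = (\<integral>\<^sup>+z. \<integral>\<^sup>+\<omega>. h (insert z \<omega>) z \<partial>P \<partial>\<mu>)"
proof -
  have "(\<lambda>p. (case p of (\<omega>, z) \<Rightarrow> h \<omega> z)) \<circ> (\<lambda>(\<omega>, z). (insert z \<omega>, z)) \<in> borel_measurable (P \<Otimes>\<^sub>M \<mu>)"
    by (rule measurable_comp[OF measurable_insert_pair assms])
  then show ?thesis
    unfolding mecke[OF assms] by (subst PM.nn_integral_snd[symmetric]) (auto simp: comp_def split_beta')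
qed

text \<open>Sums of signed terms may diverge on a null set. Positive and negative parts are
  therefore sent through \<open>mecke\<close> as nonnegative sums, and their difference is formed
  almost everywhere, where both are finite.\<close>

lemma mecke_integral:
  fixes h :: "'a set \<Rightarrow> 'a \<Rightarrow> real"
  assumes h [measurable]: "(\<lambda>(\<omega>, z). h \<omega> z) \<in> borel_measurable (P \<Otimes>\<^sub>M \<mu>)"
    and int: "integrable (P \<Otimes>\<^sub>M \<mu>) (\<lambda>p. h (insert (snd p) (fst p)) (snd p))"
  shows "AE \<omega> in P. integrable (count_space \<omega>) (h \<omega>)"
    and "integrable P (\<lambda>\<omega>. LINT z|count_space \<omega>. h \<omega> z)"
    and "(LINT \<omega>|P. LINT z|count_space \<omega>. h \<omega> z) = (\<integral>p. h (insert (snd p) (fst p)) (snd p) \<partial>(P \<Otimes>\<^sub>M \<mu>))"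
proof -
  define a where "a \<omega> = (\<integral>\<^sup>+z. ennreal (h \<omega> z) \<partial>count_space \<omega>)" for \<omega>
  define b where "b \<omega> = (\<integral>\<^sup>+z. ennreal (- h \<omega> z) \<partial>count_space \<omega>)" for \<omega>
  define c where "c \<omega> = (\<integral>\<^sup>+z. ennreal \<bar>h \<omega> z\<bar> \<partial>count_space \<omega>)" for \<omega>
  have [measurable]: "a \<in> borel_measurable P" "b \<in> borel_measurable P" "c \<in> borel_measurable P"
    unfolding a_def b_def c_def by measurable
  have A: "(\<integral>\<^sup>+\<omega>. a \<omega> \<partial>P) = (\<integral>\<^sup>+p. ennreal (h (insert (snd p) (fst p)) (snd p)) \<partial>(P \<Otimes>\<^sub>M \<mu>))"
    unfolding a_def by (rule mecke) measurable
  have B: "(\<integral>\<^sup>+\<omega>. b \<omega> \<partial>P) = (\<integral>\<^sup>+p. ennreal (- h (insert (snd p) (fst p)) (snd p)) \<partial>(P \<Otimes>\<^sub>M \<mu>))"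
    unfolding b_def by (rule mecke) measurable
  have C: "(\<integral>\<^sup>+\<omega>. c \<omega> \<partial>P) = (\<integral>\<^sup>+p. ennreal \<bar>h (insert (snd p) (fst p)) (snd p)\<bar> \<partial>(P \<Otimes>\<^sub>M \<mu>))"
    unfolding c_def by (rule mecke) measurable
  have Cf: "(\<integral>\<^sup>+\<omega>. c \<omega> \<partial>P) < \<infinity>" unfolding C using int by (simp add: integrable_iff_bounded)
  have ac: "a \<omega> \<le> c \<omega>" and bc: "b \<omega> \<le> c \<omega>" for \<omega>
    unfolding a_def b_def c_def by (intro nn_integral_mono ennreal_leI; simp)+
  have Af: "(\<integral>\<^sup>+\<omega>. a \<omega> \<partial>P) < \<infinity>" and Bf: "(\<integral>\<^sup>+\<omega>. b \<omega> \<partial>P) < \<infinity>"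
    using Cf ac bc by (meson le_less_trans nn_integral_mono)+
  have aef: "AE \<omega> in P. c \<omega> \<noteq> \<infinity>" using Cf by (intro nn_integral_PInf_AE) auto
  then show I: "AE \<omega> in P. integrable (count_space \<omega>) (h \<omega>)"
    by eventually_elim (auto simp: integrable_iff_bounded c_def less_top)
  have aef': "AE \<omega> in P. a \<omega> \<noteq> \<infinity>" "AE \<omega> in P. b \<omega> \<noteq> \<infinity>"
    using Af Bf by (intro nn_integral_PInf_AE; simp)+
  have S: "AE \<omega> in P. (LINT z|count_space \<omega>. h \<omega> z) = enn2real (a \<omega>) - enn2real (b \<omega>)"
    using I by eventually_elim (simp add: a_def b_def real_lebesgue_integral_def)
  have ea: "(\<integral>\<^sup>+\<omega>. ennreal (enn2real (a \<omega>)) \<partial>P) = (\<integral>\<^sup>+\<omega>. a \<omega> \<partial>P)"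
  proof (rule nn_integral_cong_AE)
    show "AE \<omega> in P. ennreal (enn2real (a \<omega>)) = a \<omega>"
      using aef'(1) by eventually_elim (simp add: less_top)
  qed
  have eb: "(\<integral>\<^sup>+\<omega>. ennreal (enn2real (b \<omega>)) \<partial>P) = (\<integral>\<^sup>+\<omega>. b \<omega> \<partial>P)"
  proof (rule nn_integral_cong_AE)
    show "AE \<omega> in P. ennreal (enn2real (b \<omega>)) = b \<omega>"
      using aef'(2) by eventually_elim (simp add: less_top)
  qed
  have ia: "integrable P (\<lambda>\<omega>. enn2real (a \<omega>))" and ib: "integrable P (\<lambda>\<omega>. enn2real (b \<omega>))"
    using Af Bf by (auto simp: integrable_iff_bounded ea eb)
  have m: "(\<lambda>\<omega>. LINT z|count_space \<omega>. h \<omega> z) \<in> borel_measurable P"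
    using measurable_count_integral[OF open_sets, of "\<lambda>x. x" P h] h
    by (simp cong: measurable_cong_sets add: sets_P measurable_ident_sets)
  show "integrable P (\<lambda>\<omega>. LINT z|count_space \<omega>. h \<omega> z)"
    by (subst integrable_cong_AE[OF m _ S]) (auto intro: ia ib)
  have "(LINT \<omega>|P. LINT z|count_space \<omega>. h \<omega> z) = (LINT \<omega>|P. enn2real (a \<omega>) - enn2real (b \<omega>))"
    by (rule integral_cong_AE[OF m _ S]) auto
  also have "\<dots> = (LINT \<omega>|P. enn2real (a \<omega>)) - (LINT \<omega>|P. enn2real (b \<omega>))"
    by (rule Bochner_Integration.integral_diff[OF ia ib])
  also have "\<dots> = enn2real (\<integral>\<^sup>+\<omega>. a \<omega> \<partial>P) - enn2real (\<integral>\<^sup>+\<omega>. b \<omega> \<partial>P)"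
    by (simp add: integral_eq_nn_integral ea eb)
  also have "\<dots> = (\<integral>p. h (insert (snd p) (fst p)) (snd p) \<partial>(P \<Otimes>\<^sub>M \<mu>))"
    unfolding A B by (rule real_lebesgue_integral_def[OF int, symmetric])
  finally show "(LINT \<omega>|P. LINT z|count_space \<omega>. h \<omega> z) = (\<integral>p. h (insert (snd p) (fst p)) (snd p) \<partial>(P \<Otimes>\<^sub>M \<mu>))" .
qed

end

section \<open>Compensated sums over points with an empty shadow\<close>

lemma integral_count_space_support:
  fixes h :: "'a \<Rightarrow> real"
  assumes "finite (\<omega> \<inter> B)" "\<And>z. z \<notin> B \<Longrightarrow> h z = 0"
  shows "(LINT z|count_space \<omega>. h z) = (\<Sum>z\<in>\<omega> \<inter> B. h z)"
    and "integrable (count_space \<omega>) h"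
proof -
  have s: "{a \<in> \<omega>. h a \<noteq> 0} \<subseteq> \<omega> \<inter> B" using assms(2) by auto
  then have fin: "finite {a \<in> \<omega>. h a \<noteq> 0}" using assms(1) by (rule finite_subset)
  then have "(LINT z|count_space \<omega>. h z) = (\<Sum>z | z \<in> \<omega> \<and> h z \<noteq> 0. h z)"
    by (rule lebesgue_integral_count_space_finite_support)
  also have "\<dots> = (\<Sum>z\<in>\<omega> \<inter> B. h z)"
    using assms s by (intro sum.mono_neutral_left) auto
  finally show "(LINT z|count_space \<omega>. h z) = (\<Sum>z\<in>\<omega> \<inter> B. h z)" .
  have "(\<integral>\<^sup>+z. norm (h z) \<partial>count_space \<omega>) = (\<Sum>z | z \<in> \<omega> \<and> 0 < ennreal (norm (h z)). ennreal (norm (h z)))"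
    using fin by (intro nn_integral_count_space) (simp add: less_top)
  also have "\<dots> < \<infinity>" by (subst sum_ennreal) auto
  finally show "integrable (count_space \<omega>) h" by (simp add: integrable_iff_bounded)
qed

lemma (in pair_sigma_finite) integrable_mult_pair:
  fixes u :: "'a \<Rightarrow> real" and v :: "'b \<Rightarrow> real"
  assumes u: "integrable M1 u" and v: "integrable M2 v"
  shows "integrable (M1 \<Otimes>\<^sub>M M2) (\<lambda>p. u (fst p) * v (snd p))"
proof -
  have [measurable]: "u \<in> borel_measurable M1" "v \<in> borel_measurable M2" using assms by auto
  show ?thesis
  proof (rule Fubini_integrable)
    show "integrable M1 (\<lambda>x. LINT y|M2. norm (u (fst (x, y)) * v (snd (x, y))))"
      using u by (simp add: abs_mult)
  qed (use v in auto)
qed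

section \<open>Second moments of counts, and bounded test functions\<close>

context poisson_model
begin

lemma finite_Int_bounded: "\<omega> \<in> space P \<Longrightarrow> bounded B \<Longrightarrow> finite (\<omega> \<inter> B)"
  by (simp add: space_P configurations_finite)

lemma AE_not_member: "z \<in> space \<mu> \<Longrightarrow> AE \<omega> in P. z \<notin> \<omega>"
proof -
  assume z: "z \<in> space \<mu>"
  have "{z} = space \<mu> - (- {z}) \<inter> space \<mu>" using z by auto
  also have "\<dots> \<in> sets \<mu>" by (intro sets.Diff open_sets) auto
  finally show ?thesis using AE_void_null[of "{z}"] no_atoms[OF z] by simp
qed

lemma measurable_num_points_P [measurable]: "A \<in> sets \<mu> \<Longrightarrow> num_points A \<in> borel_measurable P"
  using measurable_num_points[of A \<mu>] by (simp cong: measurable_cong_sets add: sets_P)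

text \<open>The square of a count is the sum, over the points in \<open>B\<close>, of the count
  itself. Mecke's formula raises the latter by at most one point, which bounds the second moment by
  \<open>(1 + emeasure \<mu> B) * emeasure \<mu> B\<close>.\<close>

lemma num_points_square_integrable:
  assumes B [measurable]: "B \<in> sets \<mu>" "bounded B"
  shows "integrable P (\<lambda>\<omega>. (real (card (\<omega> \<inter> B)))\<^sup>2)"
    and "integrable P (\<lambda>\<omega>. real (card (\<omega> \<inter> B)))"
proof -
  have card: "num_points B \<omega> = ennreal (real (card (\<omega> \<inter> B)))" if "\<omega> \<in> space P" for \<omega>
    using finite_Int_bounded[OF that B(2)] by (simp add: num_points_finite ennreal_of_nat_eq_real_of_nat)
  have m: "(\<lambda>\<omega>. real (card (\<omega> \<inter> B))) \<in> borel_measurable P"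
    by (rule measurable_cong[THEN iffD1, of P "\<lambda>\<omega>. enn2real (num_points B \<omega>)"]) (simp_all add: card)
  have "(\<integral>\<^sup>+\<omega>. ennreal ((real (card (\<omega> \<inter> B)))\<^sup>2) \<partial>P) = (\<integral>\<^sup>+\<omega>. \<integral>\<^sup>+z. indicator B z * num_points B \<omega> \<partial>count_space \<omega> \<partial>P)"
  proof (rule nn_integral_cong)
    fix \<omega> assume w: "\<omega> \<in> space P"
    have "(\<integral>\<^sup>+z. indicator B z * num_points B \<omega> \<partial>count_space \<omega>) = num_points B \<omega> * num_points B \<omega>"
      using finite_Int_bounded[OF w B(2)] by (simp add: nn_integral_multc nn_integral_indicator_count_space)
    also have "\<dots> = ennreal ((real (card (\<omega> \<inter> B)))\<^sup>2)"
      using w by (simp add: card power2_eq_square ennreal_mult)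
    finally show "ennreal ((real (card (\<omega> \<inter> B)))\<^sup>2) = (\<integral>\<^sup>+z. indicator B z * num_points B \<omega> \<partial>count_space \<omega>)" by simp
  qed
  also have "\<dots> = (\<integral>\<^sup>+z. \<integral>\<^sup>+\<omega>. indicator B z * num_points B (insert z \<omega>) \<partial>P \<partial>\<mu>)"
    by (rule mecke_iterated) measurable
  also have "\<dots> \<le> (\<integral>\<^sup>+z. \<integral>\<^sup>+\<omega>. indicator B z * (1 + num_points B \<omega>) \<partial>P \<partial>\<mu>)"
  proof (intro nn_integral_mono mult_left_mono)
    fix z \<omega>
    have "num_points B (insert z \<omega>) \<le> emeasure (count_space UNIV) ({z} \<union> (\<omega> \<inter> B))"
      unfolding num_points_def by (intro emeasure_mono) auto
    also have "\<dots> \<le> emeasure (count_space UNIV) {z} + emeasure (count_space UNIV) (\<omega> \<inter> B)"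
      by (intro emeasure_subadditive) auto
    finally show "num_points B (insert z \<omega>) \<le> 1 + num_points B \<omega>" by (simp add: num_points_def)
  qed simp
  also have "\<dots> = (1 + emeasure \<mu> B) * emeasure \<mu> B"
    using B by (simp add: nn_integral_cmult nn_integral_add nn_integral_num_points emeasure_space_1
      nn_integral_multc mult.commute)
  also have "\<dots> < \<infinity>"
    using bounded_finite[OF B(2) B(1)] by (simp add: ennreal_mult_less_top)
  finally show 2: "integrable P (\<lambda>\<omega>. (real (card (\<omega> \<inter> B)))\<^sup>2)"
    using m by (simp add: integrable_iff_bounded)
  show "integrable P (\<lambda>\<omega>. real (card (\<omega> \<inter> B)))"
    by (rule square_integrable_imp_integrable[OF m 2])
qed

text \<open>For these functions all sums over a configuration are finite and dominated by a multiple
  of a count, so that second moments exist. Other functions are reached by truncation.\<close>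

definition admissible :: "('a \<Rightarrow> real) \<Rightarrow> bool" where
  "admissible f \<longleftrightarrow> f \<in> borel_measurable \<mu> \<and>
     (\<exists>K B. 0 \<le> K \<and> B \<in> sets \<mu> \<and> bounded B \<and> (\<forall>z. \<bar>f z\<bar> \<le> K * indicator B z))"

lemma admissibleE:
  assumes "admissible f"
  obtains K B where "f \<in> borel_measurable \<mu>" "0 \<le> K" "B \<in> sets \<mu>" "bounded B" "\<And>z. \<bar>f z\<bar> \<le> K * indicator B z"
    "\<And>z. z \<notin> B \<Longrightarrow> f z = 0"
proof -
  from assms obtain K B where *: "f \<in> borel_measurable \<mu>" "0 \<le> K" "B \<in> sets \<mu>" "bounded B" "\<And>z. \<bar>f z\<bar> \<le> K * indicator B z"
    unfolding admissible_def by blast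
  have "f z = 0" if "z \<notin> B" for z using *(5)[of z] that by simp
  with * that show ?thesis by blast
qed

lemma admissible_minorant:
  assumes "admissible f" "g \<in> borel_measurable \<mu>" "\<And>z. \<bar>g z\<bar> \<le> \<bar>f z\<bar>"
  shows "admissible g"
proof -
  from assms(1) obtain K B where "f \<in> borel_measurable \<mu>" "0 \<le> K" "B \<in> sets \<mu>" "bounded B" "\<And>z. \<bar>f z\<bar> \<le> K * indicator B z"
    by (rule admissibleE) blast
  moreover from this(5) have "\<bar>g z\<bar> \<le> K * indicator B z" for z
    using assms(3)[of z] by (rule order_trans[rotated])
  ultimately show ?thesis using assms(2) unfolding admissible_def by blast
qed

lemma admissible_cmult:
  assumes "admissible f"
  shows "admissible (\<lambda>z. c * f z)"
proof -
  from assms obtain K B where B: "f \<in> borel_measurable \<mu>" "0 \<le> K" "B \<in> sets \<mu>" "bounded B" "\<And>z. \<bar>f z\<bar> \<le> K * indicator B z"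
    by (rule admissibleE) blast
  have "\<bar>c * f z\<bar> \<le> (\<bar>c\<bar> * K) * indicator B z" for z
    using mult_left_mono[OF B(5)[of z], of "\<bar>c\<bar>"] by (simp add: abs_mult mult.assoc)
  with B show ?thesis unfolding admissible_def
    by (intro conjI exI[of _ "\<bar>c\<bar> * K"] exI[of _ B]) auto
qed

lemma admissible_diff:
  assumes "admissible f" "admissible g"
  shows "admissible (\<lambda>z. f z - g z)"
proof -
  from assms(1) obtain K B where f [measurable]: "f \<in> borel_measurable \<mu>" "B \<in> sets \<mu>" and f2: "0 \<le> K" "bounded B" "\<And>z. \<bar>f z\<bar> \<le> K * indicator B z"
    unfolding admissible_def by blast
  from assms(2) obtain L C where g [measurable]: "g \<in> borel_measurable \<mu>" "C \<in> sets \<mu>" and g2: "0 \<le> L" "bounded C" "\<And>z. \<bar>g z\<bar> \<le> L * indicator C z"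
    unfolding admissible_def by blast
  have "\<bar>f z - g z\<bar> \<le> (K + L) * indicator (B \<union> C) z" for z
  proof -
    have "K * indicator B z \<le> K * indicator (B \<union> C) z" "L * indicator C z \<le> L * indicator (B \<union> C) z"
      using f2(1) g2(1) by (auto intro!: mult_left_mono simp: indicator_def)
    then show ?thesis using f2(3)[of z] g2(3)[of z] by (simp only: distrib_right)
  qed
  with f g f2 g2 show ?thesis unfolding admissible_def
    by (intro conjI exI[of _ "K + L"] exI[of _ "B \<union> C"]) auto
qed

end

text \<open>Think of \<open>C z\<close> as the region that has to be empty for the point \<open>z\<close> to be counted.\<close>

locale poisson_shadow = poisson_model +
  fixes C :: "'a::{metric_space,second_countable_topology} \<Rightarrow> 'a set"
  assumes measurable_shadow [measurable]: "Measurable.pred (\<mu> \<Otimes>\<^sub>M \<mu>) (\<lambda>(z, z'). z' \<in> C z)"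
    and asym: "z' \<in> C z \<Longrightarrow> z \<notin> C z'"
begin

definition free :: "'a set \<Rightarrow> 'a \<Rightarrow> real" where
  "free \<omega> z = of_bool (\<omega> \<inter> C z = {})"

lemma irrefl: "z \<notin> C z"
  using asym by blast

lemma free_insert: "free (insert z \<omega>) z' = free \<omega> z' * of_bool (z \<notin> C z')"
  by (simp add: free_def)

lemma free_insert_self [simp]: "free (insert z \<omega>) z = free \<omega> z"
  by (simp add: free_insert irrefl)

lemma free_bounds: "0 \<le> free \<omega> z" "free \<omega> z \<le> 1" "\<bar>free \<omega> z\<bar> \<le> 1" "free \<omega> z * free \<omega> z = free \<omega> z" "(free \<omega> z)\<^sup>2 = free \<omega> z"
  by (auto simp: free_def)

lemma measurable_shadow_section: "z \<in> space \<mu> \<Longrightarrow> Measurable.pred \<mu> (\<lambda>z'. z \<in> C z')"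
  using measurable_compose[OF measurable_Pair2' measurable_shadow, of z] unfolding prod.case .

text \<open>This is the part of \<open>f\<close> that is no longer counted once \<open>z\<close> has
  been inserted; it appears in \<open>compensated_insert\<close>.\<close>

lemma admissible_shadow:
  assumes f: "admissible f" and z: "z \<in> space \<mu>"
  shows "admissible (\<lambda>z'. f z' * of_bool (z \<in> C z'))"
proof (rule admissible_minorant[OF f])
  have "f \<in> borel_measurable \<mu>" using f by (simp add: admissible_def)
  moreover have "{z' \<in> space \<mu>. z \<in> C z'} \<in> sets \<mu>"
    using measurable_shadow_section[OF z] unfolding pred_def .
  ultimately have "(\<lambda>z'. if z \<in> C z' then f z' else 0) \<in> borel_measurable \<mu>"
    by (rule measurable_If[OF _ borel_measurable_const])
  moreover have "(\<lambda>z'. if z \<in> C z' then f z' else 0) = (\<lambda>z'. f z' * of_bool (z \<in> C z'))"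
    by (simp add: fun_eq_iff)
  ultimately show "(\<lambda>z'. f z' * of_bool (z \<in> C z')) \<in> borel_measurable \<mu>" by (simp only:)
  show "\<bar>f z' * of_bool (z \<in> C z')\<bar> \<le> \<bar>f z'\<bar>" for z' by simp
qed

text \<open>Emptiness of the shadow is rephrased as the vanishing of a sum over the points, because
  \<open>measurable_sum_points\<close> provides joint measurability for sums.\<close>

lemma measurable_free [measurable]: "(\<lambda>(\<omega>, z). free \<omega> z) \<in> borel_measurable (P \<Otimes>\<^sub>M \<mu>)"
proof -
  have "(\<lambda>p. \<integral>\<^sup>+z'. (if z' \<in> C (snd p) then 1 else 0) \<partial>count_space (fst p)) \<in> borel_measurable (P \<Otimes>\<^sub>M \<mu>)"
  proof (rule measurable_sum_points)
    have "(\<lambda>q. (snd (fst q), snd q)) \<in> (P \<Otimes>\<^sub>M \<mu>) \<Otimes>\<^sub>M \<mu> \<rightarrow>\<^sub>M \<mu> \<Otimes>\<^sub>M \<mu>" by measurable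
    from measurable_compose[OF this measurable_shadow]
    have [measurable]: "Measurable.pred ((P \<Otimes>\<^sub>M \<mu>) \<Otimes>\<^sub>M \<mu>) (\<lambda>q. snd q \<in> C (snd (fst q)))" by simp
    show "(\<lambda>(p, z'). if z' \<in> C (snd p) then 1 else 0 :: ennreal) \<in> borel_measurable ((P \<Otimes>\<^sub>M \<mu>) \<Otimes>\<^sub>M \<mu>)"
      unfolding split_beta' by measurable
  qed simp
  then have [measurable]: "Measurable.pred (P \<Otimes>\<^sub>M \<mu>) (\<lambda>p. (\<integral>\<^sup>+z'. (if z' \<in> C (snd p) then 1 else 0) \<partial>count_space (fst p)) = 0)"
    by measurable
  have "(\<integral>\<^sup>+z'. (if z' \<in> C (snd p) then 1 else 0) \<partial>count_space (fst p)) = 0 \<longleftrightarrow> fst p \<inter> C (snd p) = {}" for p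
    by (subst nn_integral_0_iff_AE) (auto simp: AE_count_space)
  then have "(\<lambda>(\<omega>, z). free \<omega> z) = (\<lambda>p. of_bool ((\<integral>\<^sup>+z'. (if z' \<in> C (snd p) then 1 else 0) \<partial>count_space (fst p)) = 0))"
    by (simp add: free_def fun_eq_iff)
  then show ?thesis by simp
qed

definition point_sum :: "('a \<Rightarrow> real) \<Rightarrow> 'a set \<Rightarrow> real" where
  "point_sum f \<omega> = (LINT z|count_space \<omega>. f z * free \<omega> z)"

text \<open>The integral runs over the free region of the observed configuration, so it is itself
  random. By Mecke's formula it has the same mean as \<open>point_sum f\<close> for admissible
  \<open>f\<close>, since no point lies in its own shadow.\<close>

definition compensator :: "('a \<Rightarrow> real) \<Rightarrow> 'a set \<Rightarrow> real" where
  "compensator f \<omega> = (LINT z|\<mu>. f z * free \<omega> z)"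

definition compensated :: "('a \<Rightarrow> real) \<Rightarrow> 'a set \<Rightarrow> real" where
  "compensated f \<omega> = point_sum f \<omega> - compensator f \<omega>"

lemma measurable_compensated [measurable]:
  assumes [measurable]: "f \<in> borel_measurable \<mu>"
  shows "point_sum f \<in> borel_measurable P" "compensator f \<in> borel_measurable P" "compensated f \<in> borel_measurable P"
proof -
  show 1: "point_sum f \<in> borel_measurable P"
    using measurable_count_integral[OF open_sets, of "\<lambda>x. x" P "\<lambda>\<omega> z. f z * free \<omega> z"]
    unfolding point_sum_def [abs_def] by (simp add: sets_P measurable_ident_sets)
  show 2: "compensator f \<in> borel_measurable P"
    unfolding compensator_def [abs_def] by measurable
  show "compensated f \<in> borel_measurable P" unfolding compensated_def [abs_def] using 1 2 by simp
qed

lemma point_sum_eq: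
  assumes "\<omega> \<in> space P" "bounded B" "\<And>z. z \<notin> B \<Longrightarrow> f z = 0"
  shows "point_sum f \<omega> = (\<Sum>z\<in>\<omega> \<inter> B. f z * free \<omega> z)" "integrable (count_space \<omega>) (\<lambda>z. f z * free \<omega> z)"
proof -
  note supp = integral_count_space_support[OF finite_Int_bounded[OF assms(1,2)], of "\<lambda>z. f z * free \<omega> z"]
  show "point_sum f \<omega> = (\<Sum>z\<in>\<omega> \<inter> B. f z * free \<omega> z)"
    unfolding point_sum_def by (rule supp(1)) (simp add: assms(3))
  show "integrable (count_space \<omega>) (\<lambda>z. f z * free \<omega> z)"
    by (rule supp(2)) (simp add: assms(3))
qed

lemma measurable_free_section [measurable]: "\<omega> \<in> space P \<Longrightarrow> free \<omega> \<in> borel_measurable \<mu>"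
  using measurable_compose_Pair1[OF _ measurable_free, of \<omega>] unfolding prod.case .

lemma integrable_compensator:
  assumes "admissible f" "\<omega> \<in> space P"
  shows "integrable \<mu> (\<lambda>z. f z * free \<omega> z)"
proof -
  note [measurable] = assms(2)
  from assms(1) obtain K B where f [measurable]: "f \<in> borel_measurable \<mu>" "0 \<le> K" "B \<in> sets \<mu>" "bounded B" "\<And>z. \<bar>f z\<bar> \<le> K * indicator B z"
    by (rule admissibleE) blast
  show ?thesis
  proof (rule Bochner_Integration.integrable_bound)
    show "integrable \<mu> (\<lambda>z. K * indicator B z)"
      using bounded_finite[OF f(4) f(3)] by (auto intro!: integrable_mult_right simp: f)
    show "AE z in \<mu>. norm (f z * free \<omega> z) \<le> norm (K * indicator B z)"
      using f(2,5) by (auto simp: free_def intro!: AE_I2)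
  qed measurable
qed

lemma compensated_diff:
  assumes "admissible f" "admissible g" "\<omega> \<in> space P"
  shows "compensated (\<lambda>z. f z - g z) \<omega> = compensated f \<omega> - compensated g \<omega>"
proof -
  obtain K B where f: "bounded B" "\<And>z. z \<notin> B \<Longrightarrow> f z = 0" using assms(1) by (rule admissibleE) blast
  obtain L C where g: "bounded C" "\<And>z. z \<notin> C \<Longrightarrow> g z = 0" using assms(2) by (rule admissibleE) blast
  show ?thesis
    unfolding compensated_def point_sum_def compensator_def
    using point_sum_eq(2)[OF assms(3) f] point_sum_eq(2)[OF assms(3) g]
      integrable_compensator[OF assms(1,3)] integrable_compensator[OF assms(2,3)]
    by (simp add: left_diff_distrib)
qed

lemma compensated_bound:
  assumes f: "f \<in> borel_measurable \<mu>" "0 \<le> K" "B \<in> sets \<mu>" "bounded B" "\<And>z. \<bar>f z\<bar> \<le> K * indicator B z"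
    and w: "\<omega> \<in> space P"
  shows "\<bar>point_sum f \<omega>\<bar> \<le> K * real (card (\<omega> \<inter> B))" "\<bar>compensator f \<omega>\<bar> \<le> K * measure \<mu> B"
    "\<bar>compensated f \<omega>\<bar> \<le> K * (real (card (\<omega> \<inter> B)) + measure \<mu> B)"
proof -
  note [measurable] = f(1,3) w
  have z: "z \<notin> B \<Longrightarrow> f z = 0" for z using f(5)[of z] by simp
  have "\<bar>point_sum f \<omega>\<bar> \<le> (\<Sum>z\<in>\<omega> \<inter> B. \<bar>f z * free \<omega> z\<bar>)"
    using sum_abs[of "\<lambda>z. f z * free \<omega> z" "\<omega> \<inter> B"] point_sum_eq(1)[of \<omega> B f, OF w f(4) z] by simp
  also have "\<dots> \<le> (\<Sum>z\<in>\<omega> \<inter> B. K)"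
  proof (rule sum_mono)
    fix z assume "z \<in> \<omega> \<inter> B"
    then show "\<bar>f z * free \<omega> z\<bar> \<le> K" using f(5)[of z] f(2) by (auto simp: free_def)
  qed
  finally show 1: "\<bar>point_sum f \<omega>\<bar> \<le> K * real (card (\<omega> \<inter> B))" by (simp add: mult.commute)
  have "norm (compensator f \<omega>) \<le> (LINT z|\<mu>. K * indicator B z)"
    unfolding compensator_def
  proof (rule order_trans[OF integral_norm_bound integral_mono])
    show "integrable \<mu> (\<lambda>z. K * indicator B z)"
      using bounded_finite[OF f(4) f(3)] by (auto intro!: integrable_mult_right simp: f)
    show "integrable \<mu> (\<lambda>z. norm (f z * free \<omega> z))"
      by (intro integrable_norm integrable_compensator w) (use f in \<open>unfold admissible_def, blast\<close>)
    show "norm (f z * free \<omega> z) \<le> K * indicator B z" for z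
      using f(5)[of z] f(2) by (auto simp: free_def)
  qed
  also have "\<dots> = K * measure \<mu> B" by simp
  finally show 2: "\<bar>compensator f \<omega>\<bar> \<le> K * measure \<mu> B" by simp
  show "\<bar>compensated f \<omega>\<bar> \<le> K * (real (card (\<omega> \<inter> B)) + measure \<mu> B)"
    using 1 2 by (simp add: compensated_def algebra_simps)
qed

lemma compensated_integrable:
  assumes "admissible f"
  shows "integrable P (compensated f)" "integrable P (\<lambda>\<omega>. (compensated f \<omega>)\<^sup>2)"
    "integrable P (point_sum f)" "integrable P (compensator f)"
proof -
  from assms obtain K B where f [measurable]: "f \<in> borel_measurable \<mu>" "0 \<le> K" "B \<in> sets \<mu>" "bounded B" "\<And>z. \<bar>f z\<bar> \<le> K * indicator B z"
    by (rule admissibleE) blast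
  note b = compensated_bound[OF f]
  note i = num_points_square_integrable[OF f(3,4)]
  have "integrable P (\<lambda>\<omega>. K\<^sup>2 * (2 * (real (card (\<omega> \<inter> B)))\<^sup>2 + 2 * (measure \<mu> B)\<^sup>2))"
    using i by auto
  then show 1: "integrable P (\<lambda>\<omega>. (compensated f \<omega>)\<^sup>2)"
  proof (rule Bochner_Integration.integrable_bound)
    show "AE \<omega> in P. norm ((compensated f \<omega>)\<^sup>2) \<le> norm (K\<^sup>2 * (2 * (real (card (\<omega> \<inter> B)))\<^sup>2 + 2 * (measure \<mu> B)\<^sup>2))"
    proof (rule AE_I2)
      fix \<omega> assume w: "\<omega> \<in> space P"
      have "(compensated f \<omega>)\<^sup>2 \<le> (K * (real (card (\<omega> \<inter> B)) + measure \<mu> B))\<^sup>2"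
        by (rule power2_le_iff_abs_le[THEN iffD2]) (use b(3)[OF w] f(2) in auto)
      also have "\<dots> \<le> K\<^sup>2 * (2 * (real (card (\<omega> \<inter> B)))\<^sup>2 + 2 * (measure \<mu> B)\<^sup>2)"
        unfolding power_mult_distrib
        using sum_squares_bound[of "real (card (\<omega> \<inter> B))" "measure \<mu> B"] by (intro mult_left_mono) (auto simp: power2_sum)
      finally show "norm ((compensated f \<omega>)\<^sup>2) \<le> norm (K\<^sup>2 * (2 * (real (card (\<omega> \<inter> B)))\<^sup>2 + 2 * (measure \<mu> B)\<^sup>2))" by simp
    qed
  qed measurable
  have 2: "integrable P (\<lambda>\<omega>. K * real (card (\<omega> \<inter> B)))" using i by auto
  show 3: "integrable P (point_sum f)"
    by (rule Bochner_Integration.integrable_bound[OF 2]) (use b(1) f(2) in \<open>auto intro!: AE_I2\<close>)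
  show 4: "integrable P (compensator f)"
    by (rule Bochner_Integration.integrable_bound[of P "\<lambda>_. K * measure \<mu> B"]) (use b(2) f(2) in \<open>auto intro!: AE_I2\<close>)
  show "integrable P (compensated f)"
    using 3 4 unfolding compensated_def [abs_def] by auto
qed

text \<open>Mecke's formula evaluates \<open>G\<close> at \<open>insert z \<omega>\<close> with
  \<open>z\<close> in the support of \<open>f\<close>. By \<open>inv\<close> the added point goes
  unnoticed, and what remains is the mean of \<open>G\<close> times the compensator.\<close>

lemma compensated_orthogonal:
  assumes f: "admissible f" and G [measurable]: "G \<in> borel_measurable P" and b: "\<And>\<omega>. \<bar>G \<omega>\<bar> \<le> 1"
    and inv: "\<And>\<omega> z. z \<in> space \<mu> \<Longrightarrow> f z \<noteq> 0 \<Longrightarrow> G (insert z \<omega>) = G \<omega>"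
  shows "(LINT \<omega>|P. G \<omega> * compensated f \<omega>) = 0"
proof -
  from f obtain K B where f' [measurable]: "f \<in> borel_measurable \<mu>" "0 \<le> K" "B \<in> sets \<mu>" "bounded B" "\<And>z. \<bar>f z\<bar> \<le> K * indicator B z"
    by (rule admissibleE) blast
  have bd: "integrable \<mu> (\<lambda>z. K * indicator B z)"
    using bounded_finite[OF f'(4) f'(3)] by (auto intro!: integrable_mult_right simp: f')
  have iP: "integrable (P \<Otimes>\<^sub>M \<mu>) (\<lambda>p. G (fst p) * (f (snd p) * free (fst p) (snd p)))"
  proof (rule Bochner_Integration.integrable_bound)
    show "integrable (P \<Otimes>\<^sub>M \<mu>) (\<lambda>p. (\<lambda>_. 1) (fst p) * (K * indicator B (snd p)))"
      by (rule PM.integrable_mult_pair[OF _ bd]) simp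
    have "\<bar>G (fst p)\<bar> * (\<bar>f (snd p)\<bar> * \<bar>free (fst p) (snd p)\<bar>) \<le> 1 * ((K * indicator B (snd p)) * 1)" for p
      using b f'(2,5) free_bounds(3) by (intro mult_mono) auto
    then show "AE p in P \<Otimes>\<^sub>M \<mu>. norm (G (fst p) * (f (snd p) * free (fst p) (snd p)))
        \<le> norm ((\<lambda>_. 1) (fst p) * (K * indicator B (snd p)))"
      using f'(2) by (auto simp: abs_mult)
  qed measurable
  have eq: "G (insert (snd p) (fst p)) * (f (snd p) * free (insert (snd p) (fst p)) (snd p)) = G (fst p) * (f (snd p) * free (fst p) (snd p))"
    if "p \<in> space (P \<Otimes>\<^sub>M \<mu>)" for p
    using that inv[of "snd p" "fst p"] by (cases "f (snd p) = 0") (auto simp: space_pair_measure)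
  have iP': "integrable (P \<Otimes>\<^sub>M \<mu>) (\<lambda>p. G (insert (snd p) (fst p)) * (f (snd p) * free (insert (snd p) (fst p)) (snd p)))"
    by (subst Bochner_Integration.integrable_cong[OF refl eq]) (auto intro: iP)
  have "(LINT \<omega>|P. G \<omega> * point_sum f \<omega>) = (LINT \<omega>|P. LINT z|count_space \<omega>. G \<omega> * (f z * free \<omega> z))"
    by (simp add: point_sum_def)
  also have "\<dots> = (\<integral>p. G (insert (snd p) (fst p)) * (f (snd p) * free (insert (snd p) (fst p)) (snd p)) \<partial>(P \<Otimes>\<^sub>M \<mu>))"
    by (rule mecke_integral(3)[OF _ iP']) measurable
  also have "\<dots> = (\<integral>p. G (fst p) * (f (snd p) * free (fst p) (snd p)) \<partial>(P \<Otimes>\<^sub>M \<mu>))"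
    by (rule Bochner_Integration.integral_cong[OF refl eq])
  also have "\<dots> = (LINT \<omega>|P. LINT z|\<mu>. G \<omega> * (f z * free \<omega> z))"
    using PM.integral_fst'[OF iP] by simp
  also have "\<dots> = (LINT \<omega>|P. G \<omega> * compensator f \<omega>)"
    by (simp add: compensator_def)
  finally have e: "(LINT \<omega>|P. G \<omega> * point_sum f \<omega>) = (LINT \<omega>|P. G \<omega> * compensator f \<omega>)" .
  have "integrable P (\<lambda>\<omega>. G \<omega> * u \<omega>)" if "integrable P u" for u
    by (rule Bochner_Integration.integrable_bound[OF that])
      (use that b in \<open>auto simp: abs_mult mult_left_le_one_le intro!: AE_I2\<close>)
  then have "integrable P (\<lambda>\<omega>. G \<omega> * point_sum f \<omega>)" "integrable P (\<lambda>\<omega>. G \<omega> * compensator f \<omega>)"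
    using compensated_integrable[OF f] by auto
  then show ?thesis by (simp add: compensated_def right_diff_distrib e)
qed

lemma expectation_compensated:
  assumes "admissible f"
  shows "(LINT \<omega>|P. compensated f \<omega>) = 0"
proof -
  have "(LINT \<omega>|P. 1 * compensated f \<omega>) = 0"
    by (rule compensated_orthogonal[OF assms]) auto
  then show ?thesis by simp
qed

text \<open>The new point brings its own term into the sum and erases the terms of all points whose
  shadow contains it. The compensator loses the same region, so the loss is again a compensated
  sum.\<close>

lemma compensated_insert:
  assumes f: "admissible f" and "z \<in> space \<mu>" and w: "\<omega> \<in> space P" and "z \<notin> \<omega>"
  shows "compensated f (insert z \<omega>) = f z * free \<omega> z + compensated f \<omega> - compensated (\<lambda>z'. f z' * of_bool (z \<in> C z')) \<omega>"
proof -
  let ?g = "\<lambda>z'. f z' * of_bool (z \<in> C z')"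
  from f obtain K B where f' [measurable]: "f \<in> borel_measurable \<mu>" "0 \<le> K" "B \<in> sets \<mu>" "bounded B" "\<And>z. \<bar>f z\<bar> \<le> K * indicator B z"
    and B: "\<And>z. z \<notin> B \<Longrightarrow> f z = 0"
    by (rule admissibleE) blast
  have g: "admissible ?g" by (rule admissible_shadow[OF f \<open>z \<in> space \<mu>\<close>])
  have w': "insert z \<omega> \<in> space P" using w \<open>z \<in> space \<mu>\<close> by (simp add: space_P insert_configurations)
  have *: "f z' * free (insert z \<omega>) z' = (f z' - ?g z') * free \<omega> z'" for z'
    by (cases "z \<in> C z'") (simp_all add: free_insert)
  have fin: "finite (\<omega> \<inter> B)" by (rule finite_Int_bounded[OF w f'(4)])
  have "point_sum f (insert z \<omega>) = (\<Sum>z'\<in>insert z \<omega> \<inter> B. f z' * free (insert z \<omega>) z')"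
    by (rule point_sum_eq[OF w' f'(4) B])
  also have "\<dots> = f z * free \<omega> z + (\<Sum>z'\<in>\<omega> \<inter> B. f z' * free (insert z \<omega>) z')"
    using fin \<open>z \<notin> \<omega>\<close> B by (cases "z \<in> B") (auto simp: Int_insert_left)
  also have "(\<Sum>z'\<in>\<omega> \<inter> B. f z' * free (insert z \<omega>) z') = (\<Sum>z'\<in>\<omega> \<inter> B. (f z' - ?g z') * free \<omega> z')"
    by (simp only: *)
  also have "\<dots> = point_sum (\<lambda>z'. f z' - ?g z') \<omega>"
    by (rule point_sum_eq(1)[OF w f'(4), symmetric]) (simp add: B)
  finally have "compensated f (insert z \<omega>) = f z * free \<omega> z + compensated (\<lambda>z'. f z' - ?g z') \<omega>"
    by (simp add: compensated_def compensator_def *)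
  then show ?thesis by (simp add: compensated_diff[OF f g w])
qed

text \<open>By Mecke's formula the second moment of the compensated sum is governed by the effect of
  adding one point \<open>z\<close>. Besides the term of \<open>z\<close> itself this only removes points \<open>z'\<close> with
  \<open>z \<in> C z'\<close>; since then \<open>z' \<notin> C z\<close>, their compensated contribution is uncorrelated with the event
  that \<open>z\<close> is counted.\<close>

theorem variance_compensated:
  assumes f: "admissible f"
  shows "(LINT \<omega>|P. (compensated f \<omega>)\<^sup>2) = (LINT z|\<mu>. (f z)\<^sup>2 * (LINT \<omega>|P. free \<omega> z))"
proof -
  from f obtain K B where f' [measurable]: "f \<in> borel_measurable \<mu>" "0 \<le> K" "B \<in> sets \<mu>" "bounded B" "\<And>z. \<bar>f z\<bar> \<le> K * indicator B z"
    by (rule admissibleE) blast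
  note b = compensated_bound[OF f']
  let ?D = "compensated f" and ?b = "measure \<mu> B"
  let ?J = "\<lambda>\<omega> z. f z * free \<omega> z"
  have cfi: "?D \<in> borel_measurable (config_space \<mu>)"
    using measurable_compensated(3)[OF f'(1)] by (simp cong: measurable_cong_sets add: sets_P)
  have [measurable]: "(\<lambda>p. ?D (insert (snd p) (fst p))) \<in> borel_measurable (P \<Otimes>\<^sub>M \<mu>)"
    using measurable_compose[OF measurable_insert cfi] by (simp add: split_beta')
  have bd: "integrable \<mu> (\<lambda>z. K * indicator B z)"
    using bounded_finite[OF f'(4) f'(3)] by (auto intro!: integrable_mult_right simp: f')
  have J: "\<bar>?J \<omega> z\<bar> \<le> K * indicator B z" for \<omega> z
    using f'(5)[of z] f'(2) by (auto simp: free_def)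
  \<comment> \<open>The summand 1 leaves room for the inserted point in the bound for
    \<open>?D (insert (snd p) (fst p))\<close>.\<close>
  have dom: "integrable (P \<Otimes>\<^sub>M \<mu>) (\<lambda>p. (K * (real (card (fst p \<inter> B)) + 1 + ?b)) * (K * indicator B (snd p)))"
    using num_points_square_integrable(2)[OF f'(3,4)]
    by (intro PM.integrable_mult_pair[OF _ bd, where u = "\<lambda>\<omega>. K * (real (card (\<omega> \<inter> B)) + 1 + ?b)"]) auto
  have i1: "integrable (P \<Otimes>\<^sub>M \<mu>) (\<lambda>p. ?J (fst p) (snd p) * ?D (insert (snd p) (fst p)))"
  proof (rule Bochner_Integration.integrable_bound[OF dom])
    show "AE p in P \<Otimes>\<^sub>M \<mu>. norm (?J (fst p) (snd p) * ?D (insert (snd p) (fst p))) \<le>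
       norm ((K * (real (card (fst p \<inter> B)) + 1 + ?b)) * (K * indicator B (snd p)))"
    proof (rule AE_I2)
      fix p assume p: "p \<in> space (P \<Otimes>\<^sub>M \<mu>)"
      then have w: "fst p \<in> space P" "insert (snd p) (fst p) \<in> space P"
        by (auto simp: space_P space_pair_measure insert_configurations)
      have "card (insert (snd p) (fst p) \<inter> B) \<le> card (fst p \<inter> B) + 1"
        using finite_Int_bounded[OF w(1) f'(4)] by (simp add: Int_insert_left card_insert_if)
      then have "\<bar>?D (insert (snd p) (fst p))\<bar> \<le> K * (real (card (fst p \<inter> B)) + 1 + ?b)"
        by (intro order_trans[OF b(3)[OF w(2)]] mult_left_mono) (use f'(2) in auto)
      then have "\<bar>?J (fst p) (snd p)\<bar> * \<bar>?D (insert (snd p) (fst p))\<bar>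
          \<le> (K * indicator B (snd p)) * (K * (real (card (fst p \<inter> B)) + 1 + ?b))"
        using J by (intro mult_mono) (auto simp: f'(2))
      also have "\<dots> = norm ((K * (real (card (fst p \<inter> B)) + 1 + ?b)) * (K * indicator B (snd p)))"
        using f'(2) by (simp add: abs_mult)
      finally show "norm (?J (fst p) (snd p) * ?D (insert (snd p) (fst p))) \<le>
         norm ((K * (real (card (fst p \<inter> B)) + 1 + ?b)) * (K * indicator B (snd p)))"
        by (simp only: real_norm_def abs_mult)
    qed
  qed measurable
  have i2: "integrable (P \<Otimes>\<^sub>M \<mu>) (\<lambda>p. ?J (fst p) (snd p) * ?D (fst p))"
  proof (rule Bochner_Integration.integrable_bound[OF dom])
    show "AE p in P \<Otimes>\<^sub>M \<mu>. norm (?J (fst p) (snd p) * ?D (fst p)) \<le>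
       norm ((K * (real (card (fst p \<inter> B)) + 1 + ?b)) * (K * indicator B (snd p)))"
    proof (rule AE_I2)
      fix p assume p: "p \<in> space (P \<Otimes>\<^sub>M \<mu>)"
      then have w: "fst p \<in> space P" by (auto simp: space_pair_measure)
      have "\<bar>?D (fst p)\<bar> \<le> K * (real (card (fst p \<inter> B)) + 1 + ?b)"
        by (intro order_trans[OF b(3)[OF w]] mult_left_mono) (use f'(2) in auto)
      then have "\<bar>?J (fst p) (snd p)\<bar> * \<bar>?D (fst p)\<bar>
          \<le> (K * indicator B (snd p)) * (K * (real (card (fst p \<inter> B)) + 1 + ?b))"
        using J by (intro mult_mono) (auto simp: f'(2))
      also have "\<dots> = norm ((K * (real (card (fst p \<inter> B)) + 1 + ?b)) * (K * indicator B (snd p)))"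
        using f'(2) by (simp add: abs_mult)
      finally show "norm (?J (fst p) (snd p) * ?D (fst p)) \<le>
         norm ((K * (real (card (fst p \<inter> B)) + 1 + ?b)) * (K * indicator B (snd p)))"
        by (simp only: real_norm_def abs_mult)
    qed
  qed measurable
  have i1': "integrable (P \<Otimes>\<^sub>M \<mu>) (\<lambda>p. ?J (insert (snd p) (fst p)) (snd p) * ?D (insert (snd p) (fst p)))"
    using i1 by simp
  have m1: "(\<lambda>(\<omega>, z). ?J \<omega> z * ?D \<omega>) \<in> borel_measurable (P \<Otimes>\<^sub>M \<mu>)"
    by measurable
  have sD: "(LINT z|count_space \<omega>. ?J \<omega> z * ?D \<omega>) = point_sum f \<omega> * ?D \<omega>"
    "(LINT z|\<mu>. ?J \<omega> z * ?D \<omega>) = compensator f \<omega> * ?D \<omega>" for \<omega>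
    by (simp_all add: point_sum_def compensator_def)
  have e1: "(LINT \<omega>|P. point_sum f \<omega> * ?D \<omega>) = (\<integral>p. ?J (fst p) (snd p) * ?D (insert (snd p) (fst p)) \<partial>(P \<Otimes>\<^sub>M \<mu>))"
    using mecke_integral(3)[OF m1 i1'] by (simp only: sD free_insert_self)
  have j1: "integrable P (\<lambda>\<omega>. point_sum f \<omega> * ?D \<omega>)"
    using mecke_integral(2)[OF m1 i1'] by (simp only: sD)
  have e2: "(LINT \<omega>|P. compensator f \<omega> * ?D \<omega>) = (\<integral>p. ?J (fst p) (snd p) * ?D (fst p) \<partial>(P \<Otimes>\<^sub>M \<mu>))"
    using PM.integral_fst'[OF i2] by (simp only: sD fst_conv snd_conv)
  have j2: "integrable P (\<lambda>\<omega>. compensator f \<omega> * ?D \<omega>)"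
    using PM.integrable_fst'[OF i2] by (simp only: sD fst_conv snd_conv)
  \<comment> \<open>One factor of the square is split into sum and compensator while the other is
    kept whole. Mecke's formula then leaves the increment of \<open>?D\<close> caused by inserting
    \<open>z\<close>, weighted by the term of \<open>z\<close>.\<close>
  have "(LINT \<omega>|P. (?D \<omega>)\<^sup>2) = (LINT \<omega>|P. point_sum f \<omega> * ?D \<omega> - compensator f \<omega> * ?D \<omega>)"
    by (simp add: compensated_def power2_eq_square left_diff_distrib)
  also have "\<dots> = (\<integral>p. ?J (fst p) (snd p) * ?D (insert (snd p) (fst p)) - ?J (fst p) (snd p) * ?D (fst p) \<partial>(P \<Otimes>\<^sub>M \<mu>))"
    unfolding Bochner_Integration.integral_diff[OF j1 j2] e1 e2 Bochner_Integration.integral_diff[OF i1 i2] ..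
  also have "\<dots> = (LINT z|\<mu>. LINT \<omega>|P. ?J \<omega> z * ?D (insert z \<omega>) - ?J \<omega> z * ?D \<omega>)"
    using PM.integral_snd[of "\<lambda>\<omega> z. ?J \<omega> z * ?D (insert z \<omega>) - ?J \<omega> z * ?D \<omega>"] i1 i2
    by (simp add: split_beta')
  also have "\<dots> = (LINT z|\<mu>. (f z)\<^sup>2 * (LINT \<omega>|P. free \<omega> z))"
  proof (rule Bochner_Integration.integral_cong[OF refl])
    fix z assume z: "z \<in> space \<mu>"
    let ?g = "\<lambda>z'. f z' * of_bool (z \<in> C z')"
    have mz: "(\<lambda>\<omega>. free \<omega> z) \<in> borel_measurable P"
      using measurable_compose[OF measurable_Pair2'[OF z] measurable_free] unfolding prod.case .
    have mi: "(\<lambda>\<omega>. ?D (insert z \<omega>)) \<in> borel_measurable P"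
      using measurable_compose[OF measurable_Pair2'[OF z] measurable_compose[OF measurable_insert cfi]]
      unfolding prod.case .
    have g: "admissible ?g" by (rule admissible_shadow[OF f z])
    then have mg: "compensated ?g \<in> borel_measurable P" using compensated_integrable by blast
    have "(LINT \<omega>|P. ?J \<omega> z * ?D (insert z \<omega>) - ?J \<omega> z * ?D \<omega>)
       = (LINT \<omega>|P. (f z)\<^sup>2 * free \<omega> z - f z * (free \<omega> z * compensated ?g \<omega>))"
    proof (rule integral_cong_AE)
      show "AE \<omega> in P. ?J \<omega> z * ?D (insert z \<omega>) - ?J \<omega> z * ?D \<omega>
         = (f z)\<^sup>2 * free \<omega> z - f z * (free \<omega> z * compensated ?g \<omega>)"
        using AE_not_member[OF z] AE_space
      proof eventually_elim
        case (elim \<omega>)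
        have "?J \<omega> z * ?D (insert z \<omega>) - ?J \<omega> z * ?D \<omega> = (f z)\<^sup>2 * (free \<omega> z * free \<omega> z) - f z * (free \<omega> z * compensated ?g \<omega>)"
          unfolding compensated_insert[OF f z elim(2,1)] by (simp add: algebra_simps power2_eq_square)
        then show ?case by (simp only: free_bounds)
      qed
    qed (intro borel_measurable_diff borel_measurable_times borel_measurable_const mz mi mg measurable_compensated f')+
    also have "\<dots> = (LINT \<omega>|P. (f z)\<^sup>2 * free \<omega> z) - (LINT \<omega>|P. f z * (free \<omega> z * compensated ?g \<omega>))"
    proof (rule Bochner_Integration.integral_diff)
      have "integrable P (\<lambda>\<omega>. free \<omega> z)"
        by (rule integrable_const_bound[where B = 1]) (simp_all add: free_bounds mz)
      then show "integrable P (\<lambda>\<omega>. (f z)\<^sup>2 * free \<omega> z)" by simp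
      have "integrable P (\<lambda>\<omega>. free \<omega> z * compensated ?g \<omega>)"
        by (rule Bochner_Integration.integrable_bound[OF compensated_integrable(1)[OF g]])
          (simp_all add: borel_measurable_times mz mg, simp add: free_def)
      then show "integrable P (\<lambda>\<omega>. f z * (free \<omega> z * compensated ?g \<omega>))" by simp
    qed
    also have "(LINT \<omega>|P. f z * (free \<omega> z * compensated ?g \<omega>)) = 0"
    proof -
      have "(LINT \<omega>|P. free \<omega> z * compensated ?g \<omega>) = 0"
      proof (rule compensated_orthogonal[OF g])
        show "free (insert z' \<omega>) z = free \<omega> z" if "?g z' \<noteq> 0" for \<omega> z'
          using that asym[of z z'] by (auto simp: free_insert)
      qed (simp_all add: free_bounds mz)
      then show ?thesis by simp
    qed
    finally show "(LINT \<omega>|P. ?J \<omega> z * ?D (insert z \<omega>) - ?J \<omega> z * ?D \<omega>) = (f z)\<^sup>2 * (LINT \<omega>|P. free \<omega> z)"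
      by simp
  qed
  finally show ?thesis .
qed

end

section \<open>The isometry beyond bounded functions of bounded support\<close>

context poisson_shadow
begin

text \<open>In the boundary model, at the point \<open>(x, g x + u)\<close>, this is the probability
  in the variance formula: the estimator exceeds the curve at \<open>x\<close> by at least
  \<open>u\<close>.\<close>

definition hit :: "'a \<Rightarrow> ennreal" where
  "hit z = (\<integral>\<^sup>+\<omega>. ennreal (free \<omega> z) \<partial>P)"

lemma measurable_hit [measurable]: "hit \<in> borel_measurable \<mu>"
proof -
  have "(\<lambda>p. ennreal (free (snd p) (fst p))) \<in> borel_measurable (\<mu> \<Otimes>\<^sub>M P)"
    using measurable_compose[OF measurable_pair_swap' measurable_free] by (simp add: split_beta')
  then show ?thesis unfolding hit_def [abs_def] by measurable
qed

text \<open>Fatou's lemma and dominated convergence are applied below to nonnegative integrals,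
  which is why the identity is needed in this form.\<close>

lemma variance_compensated_nn:
  assumes f: "admissible f"
  shows "(\<integral>\<^sup>+\<omega>. ennreal ((compensated f \<omega>)\<^sup>2) \<partial>P) = (\<integral>\<^sup>+z. ennreal ((f z)\<^sup>2) * hit z \<partial>\<mu>)"
proof -
  from f obtain K B where f' [measurable]: "f \<in> borel_measurable \<mu>" "0 \<le> K" "B \<in> sets \<mu>" "bounded B" "\<And>z. \<bar>f z\<bar> \<le> K * indicator B z"
    by (rule admissibleE) blast
  have free: "integrable P (\<lambda>\<omega>. free \<omega> z)" "(LINT \<omega>|P. free \<omega> z) \<le> 1" "0 \<le> (LINT \<omega>|P. free \<omega> z)"
    if z: "z \<in> space \<mu>" for z
  proof -
    have mz: "(\<lambda>\<omega>. free \<omega> z) \<in> borel_measurable P"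
      using measurable_compose[OF measurable_Pair2'[OF z] measurable_free] unfolding prod.case .
    show 1: "integrable P (\<lambda>\<omega>. free \<omega> z)"
      by (rule integrable_const_bound[where B = 1]) (simp_all add: free_bounds mz)
    show "(LINT \<omega>|P. free \<omega> z) \<le> 1" by (rule integral_le_const[OF 1]) (simp add: free_bounds)
    show "0 \<le> (LINT \<omega>|P. free \<omega> z)" by (simp add: free_bounds)
  qed
  have hit: "hit z = ennreal (LINT \<omega>|P. free \<omega> z)" if "z \<in> space \<mu>" for z
    unfolding hit_def using free(1)[OF that] by (intro nn_integral_eq_integral) (simp_all add: free_bounds)
  have m: "(\<lambda>z. LINT \<omega>|P. free \<omega> z) \<in> borel_measurable \<mu>"
  proof -
    have "(\<lambda>p. free (snd p) (fst p)) \<in> borel_measurable (\<mu> \<Otimes>\<^sub>M P)"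
      using measurable_compose[OF measurable_pair_swap' measurable_free] by (simp add: split_beta')
    then show ?thesis
      by (intro sigma_finite_measure.borel_measurable_lebesgue_integral[OF prob_space_imp_sigma_finite[OF prob_space_axioms]])
        (simp add: split_beta')
  qed
  have i: "integrable \<mu> (\<lambda>z. (f z)\<^sup>2 * (LINT \<omega>|P. free \<omega> z))"
  proof (rule Bochner_Integration.integrable_bound)
    show "integrable \<mu> (\<lambda>z. K\<^sup>2 * indicator B z)"
      using bounded_finite[OF f'(4) f'(3)] by (auto intro!: integrable_mult_right simp: f')
    have "norm ((f z)\<^sup>2 * (LINT \<omega>|P. free \<omega> z)) \<le> norm (K\<^sup>2 * indicator B z)" if "z \<in> space \<mu>" for z
    proof -
      have "(f z)\<^sup>2 \<le> (K * indicator B z)\<^sup>2"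
        by (rule power2_le_iff_abs_le[THEN iffD2]) (use f' in auto)
      then have "(f z)\<^sup>2 * (LINT \<omega>|P. free \<omega> z) \<le> (K * indicator B z)\<^sup>2 * 1"
        using free[OF that] by (intro mult_mono) auto
      then show ?thesis using free[OF that] by (cases "z \<in> B") (simp_all add: power_mult_distrib)
    qed
    then show "AE z in \<mu>. norm ((f z)\<^sup>2 * (LINT \<omega>|P. free \<omega> z)) \<le> norm (K\<^sup>2 * indicator B z)"
      by (rule AE_I2)
    show "(\<lambda>z. (f z)\<^sup>2 * (LINT \<omega>|P. free \<omega> z)) \<in> borel_measurable \<mu>"
      by (intro borel_measurable_times borel_measurable_power f' m)
  qed
  have "(\<integral>\<^sup>+\<omega>. ennreal ((compensated f \<omega>)\<^sup>2) \<partial>P) = ennreal (LINT z|\<mu>. (f z)\<^sup>2 * (LINT \<omega>|P. free \<omega> z))"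
    unfolding variance_compensated[OF f, symmetric]
    by (rule nn_integral_eq_integral[OF compensated_integrable(2)[OF f]]) simp
  also have "\<dots> = (\<integral>\<^sup>+z. ennreal ((f z)\<^sup>2 * (LINT \<omega>|P. free \<omega> z)) \<partial>\<mu>)"
    by (rule nn_integral_eq_integral[OF i, symmetric]) (use free in \<open>auto intro!: AE_I2\<close>)
  also have "\<dots> = (\<integral>\<^sup>+z. ennreal ((f z)\<^sup>2) * hit z \<partial>\<mu>)"
    by (rule nn_integral_cong) (simp add: hit free ennreal_mult)
  finally show ?thesis .
qed

text \<open>Large values and values at remote points are replaced by 0 instead of being clipped.
  Each value of the truncation is then 0 or that of \<open>f\<close>. Hence
  \<open>f - 2 * truncate k f\<close> has the same absolute value as \<open>f\<close>, and the
  squares of the truncation and of the remainder add up to the square of \<open>f\<close>.\<close>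

definition truncate :: "nat \<Rightarrow> ('a \<Rightarrow> real) \<Rightarrow> 'a \<Rightarrow> real" where
  "truncate k f z = (if z \<in> exhaustion k \<and> \<bar>f z\<bar> \<le> real k then f z else 0)"

lemma exhaustion_mono: "k \<le> m \<Longrightarrow> exhaustion k \<subseteq> exhaustion m"
  by (auto simp: exhaustion_def)

lemma truncate_mono: "k \<le> m \<Longrightarrow> truncate k f z \<noteq> 0 \<Longrightarrow> truncate m f z = f z \<and> truncate k f z = f z"
  using exhaustion_mono[of k m] by (auto simp: truncate_def split: if_splits)

lemma truncate_eventually:
  assumes "z \<in> space \<mu>"
  shows "\<forall>\<^sub>F k in sequentially. truncate k f z = f z"
proof -
  obtain m where m: "z \<in> exhaustion m" using assms exhaustion(3) by auto
  obtain l :: nat where l: "\<bar>f z\<bar> \<le> real l" using real_arch_simple by blast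
  show ?thesis
  proof (rule eventually_sequentiallyI[of "max m l"])
    fix k assume "max m l \<le> k"
    then show "truncate k f z = f z" using m l exhaustion_mono[of m k] by (auto simp: truncate_def)
  qed
qed

lemma admissible_truncate:
  assumes "f \<in> borel_measurable \<mu>"
  shows "admissible (truncate k f)"
proof -
  have "truncate k f = (\<lambda>z. indicator (exhaustion k) z * (if \<bar>f z\<bar> \<le> real k then f z else 0))"
    by (auto simp: truncate_def fun_eq_iff)
  also have "\<dots> \<in> borel_measurable \<mu>"
    using exhaustion(1)[of k] assms by measurable
  finally show ?thesis
    unfolding admissible_def using exhaustion(1,2)[of k]
    by (intro conjI exI[of _ "real k"] exI[of _ "exhaustion k"]) (auto simp: truncate_def)
qed

text \<open>For one configuration the sum has finitely many nonzero terms, each of which is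
  eventually untouched by the truncation. The compensator converges by domination with
  \<open>f z * free \<omega> z\<close>.\<close>

lemma tendsto_compensated_truncate:
  assumes f [measurable]: "f \<in> borel_measurable \<mu>" and w: "\<omega> \<in> space P"
    and fin: "finite {z \<in> \<omega>. free \<omega> z \<noteq> 0}" and int: "integrable \<mu> (\<lambda>z. f z * free \<omega> z)"
  shows "(\<lambda>k. compensated (truncate k f) \<omega>) \<longlonglongrightarrow> compensated f \<omega>"
proof -
  have sub: "\<omega> \<subseteq> space \<mu>" using w by (simp add: space_P configurations_subset)
  have ps: "point_sum h \<omega> = (\<Sum>z | z \<in> \<omega> \<and> free \<omega> z \<noteq> 0. h z * free \<omega> z)" for h
  proof -
    have "finite {z \<in> \<omega>. h z * free \<omega> z \<noteq> 0}" using fin by (rule rev_finite_subset) auto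
    then have "point_sum h \<omega> = (\<Sum>z | z \<in> \<omega> \<and> h z * free \<omega> z \<noteq> 0. h z * free \<omega> z)"
      unfolding point_sum_def by (rule lebesgue_integral_count_space_finite_support)
    also have "\<dots> = (\<Sum>z | z \<in> \<omega> \<and> free \<omega> z \<noteq> 0. h z * free \<omega> z)"
      using fin by (intro sum.mono_neutral_left) auto
    finally show ?thesis .
  qed
  have "(\<lambda>k. point_sum (truncate k f) \<omega>) \<longlonglongrightarrow> point_sum f \<omega>"
    unfolding ps
    by (intro tendsto_sum tendsto_mult tendsto_const tendsto_eventually truncate_eventually) (use sub in auto)
  moreover have "(\<lambda>k. compensator (truncate k f) \<omega>) \<longlonglongrightarrow> compensator f \<omega>"
    unfolding compensator_def
  proof (rule integral_dominated_convergence[where w = "\<lambda>z. norm (f z * free \<omega> z)"])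
    show "(\<lambda>z. truncate k f z * free \<omega> z) \<in> borel_measurable \<mu>" for k
      using admissible_truncate[OF f, of k] measurable_free_section[OF w]
      by (intro borel_measurable_times) (auto simp: admissible_def)
    show "AE z in \<mu>. (\<lambda>k. truncate k f z * free \<omega> z) \<longlonglongrightarrow> f z * free \<omega> z"
      by (intro AE_I2 tendsto_mult tendsto_const tendsto_eventually truncate_eventually)
    show "AE z in \<mu>. norm (truncate k f z * free \<omega> z) \<le> norm (f z * free \<omega> z)" for k
      by (auto simp: truncate_def)
  qed (use int in auto)
  ultimately show ?thesis unfolding compensated_def by (rule tendsto_diff)
qed

text \<open>The isometry extends from truncations to \<open>f\<close>. Fatou's lemma bounds the second moment of
  \<open>compensated f - c * compensated (truncate k f)\<close> from above for \<open>c = 0, 1, 2\<close>, and the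
  parallelogram law turns the bound for \<open>c = 2\<close> into a lower bound for \<open>c = 0\<close>.\<close>

theorem compensated_isometry:
  assumes f [measurable]: "f \<in> borel_measurable \<mu>"
    and fin: "AE \<omega> in P. finite {z \<in> \<omega>. free \<omega> z \<noteq> 0}"
    and int: "AE \<omega> in P. integrable \<mu> (\<lambda>z. f z * free \<omega> z)"
    and V: "(\<integral>\<^sup>+z. ennreal ((f z)\<^sup>2) * hit z \<partial>\<mu>) < \<infinity>"
  shows "integrable P (compensated f)" "(LINT \<omega>|P. compensated f \<omega>) = 0"
    "(\<integral>\<^sup>+\<omega>. ennreal ((compensated f \<omega>)\<^sup>2) \<partial>P) = (\<integral>\<^sup>+z. ennreal ((f z)\<^sup>2) * hit z \<partial>\<mu>)"
proof -
  let ?D = "compensated f" and ?T = "\<lambda>k. truncate k f"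
  let ?V = "\<integral>\<^sup>+z. ennreal ((f z)\<^sup>2) * hit z \<partial>\<mu>"
  define v where "v k = (\<integral>\<^sup>+\<omega>. ennreal ((compensated (?T k) \<omega>)\<^sup>2) \<partial>P)" for k
  note adm = admissible_truncate[OF f]
  have Tm: "?T k \<in> borel_measurable \<mu>" for k using adm[of k] by (simp add: admissible_def)
  note Dm = measurable_compensated(3)[OF f] and Dkm = measurable_compensated(3)[OF Tm]
  have conv: "AE \<omega> in P. (\<lambda>k. compensated (?T k) \<omega>) \<longlonglongrightarrow> ?D \<omega>"
    using fin int AE_space by eventually_elim (rule tendsto_compensated_truncate[OF f])
  have fatou: "(\<integral>\<^sup>+\<omega>. ennreal ((?D \<omega> - c * compensated (?T k) \<omega>)\<^sup>2) \<partial>P)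
      \<le> (\<integral>\<^sup>+z. ennreal ((f z - c * ?T k z)\<^sup>2) * hit z \<partial>\<mu>)" for c k
  proof -
    have lin: "compensated (?T (m + k)) \<omega> - c * compensated (?T k) \<omega> = compensated (\<lambda>z. ?T (m + k) z - c * ?T k z) \<omega>"
      if w: "\<omega> \<in> space P" for \<omega> m
    proof -
      have "compensated (\<lambda>z. c * ?T k z) \<omega> = c * compensated (?T k) \<omega>"
        by (simp add: compensated_def point_sum_def compensator_def mult.assoc right_diff_distrib)
      then show ?thesis using compensated_diff[OF adm admissible_cmult[OF adm] w] by simp
    qed
    have "(\<integral>\<^sup>+\<omega>. ennreal ((?D \<omega> - c * compensated (?T k) \<omega>)\<^sup>2) \<partial>P)
       = (\<integral>\<^sup>+\<omega>. liminf (\<lambda>m. ennreal ((compensated (?T (m + k)) \<omega> - c * compensated (?T k) \<omega>)\<^sup>2)) \<partial>P)"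
    proof (rule nn_integral_cong_AE)
      show "AE \<omega> in P. ennreal ((?D \<omega> - c * compensated (?T k) \<omega>)\<^sup>2) =
         liminf (\<lambda>m. ennreal ((compensated (?T (m + k)) \<omega> - c * compensated (?T k) \<omega>)\<^sup>2))"
        using conv
      proof eventually_elim
        case (elim \<omega>)
        from LIMSEQ_ignore_initial_segment[OF this, of k]
        have "(\<lambda>m. ennreal ((compensated (?T (m + k)) \<omega> - c * compensated (?T k) \<omega>)\<^sup>2))
           \<longlonglongrightarrow> ennreal ((?D \<omega> - c * compensated (?T k) \<omega>)\<^sup>2)"
          by (intro tendsto_ennrealI tendsto_power tendsto_diff tendsto_const)
        then show ?case by (intro lim_imp_Liminf[symmetric]) auto
      qed
    qed
    also have "\<dots> \<le> liminf (\<lambda>m. \<integral>\<^sup>+\<omega>. ennreal ((compensated (?T (m + k)) \<omega> - c * compensated (?T k) \<omega>)\<^sup>2) \<partial>P)"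
      by (intro nn_integral_liminf measurable_compose[OF _ measurable_ennreal] borel_measurable_power
          borel_measurable_diff borel_measurable_times borel_measurable_const Dkm)
    also have "\<dots> \<le> (\<integral>\<^sup>+z. ennreal ((f z - c * ?T k z)\<^sup>2) * hit z \<partial>\<mu>)"
    proof -
      have "(\<integral>\<^sup>+\<omega>. ennreal ((compensated (?T (m + k)) \<omega> - c * compensated (?T k) \<omega>)\<^sup>2) \<partial>P)
         \<le> (\<integral>\<^sup>+z. ennreal ((f z - c * ?T k z)\<^sup>2) * hit z \<partial>\<mu>)" for m
      proof -
        have "admissible (\<lambda>z. ?T (m + k) z - c * ?T k z)"
          by (intro admissible_diff admissible_cmult adm)
        from variance_compensated_nn[OF this]
        have "(\<integral>\<^sup>+\<omega>. ennreal ((compensated (?T (m + k)) \<omega> - c * compensated (?T k) \<omega>)\<^sup>2) \<partial>P)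
          = (\<integral>\<^sup>+z. ennreal ((?T (m + k) z - c * ?T k z)\<^sup>2) * hit z \<partial>\<mu>)"
          by (subst nn_integral_cong[OF arg_cong[where f = "\<lambda>x. ennreal (x\<^sup>2)", OF lin]]) auto
        also have "\<dots> \<le> (\<integral>\<^sup>+z. ennreal ((f z - c * ?T k z)\<^sup>2) * hit z \<partial>\<mu>)"
        proof (intro nn_integral_mono mult_right_mono ennreal_leI)
          fix z
          show "(?T (m + k) z - c * ?T k z)\<^sup>2 \<le> (f z - c * ?T k z)\<^sup>2"
          \<comment> \<open>If \<open>?T k z\<close> is zero, the longer truncation is 0 or
            \<open>f z\<close>. If not, both truncations equal \<open>f z\<close> and the two sides
            agree.\<close>
          proof (cases "?T k z = 0")
            case True
            then show ?thesis by (simp add: truncate_def)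
          next
            case False
            then show ?thesis using truncate_mono[of k "m + k" f z] by simp
          qed
        qed simp
        finally show ?thesis .
      qed
      then show ?thesis by (intro Liminf_le) auto
    qed
    finally show ?thesis .
  qed
  have upper: "(\<integral>\<^sup>+\<omega>. ennreal ((?D \<omega>)\<^sup>2) \<partial>P) \<le> ?V" using fatou[of 0 0] by simp
  have vk: "v k = (\<integral>\<^sup>+z. ennreal ((?T k z)\<^sup>2) * hit z \<partial>\<mu>)" for k
    unfolding v_def by (rule variance_compensated_nn[OF adm])
  have vlim: "v \<longlonglongrightarrow> ?V"
    unfolding vk [abs_def]
  proof (rule nn_integral_dominated_convergence[OF _ _ _ _ V])
    show "AE z in \<mu>. ennreal ((?T k z)\<^sup>2) * hit z \<le> ennreal ((f z)\<^sup>2) * hit z" for k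
      by (intro AE_I2 mult_right_mono ennreal_leI) (auto simp: truncate_def)
    show "AE z in \<mu>. (\<lambda>k. ennreal ((?T k z)\<^sup>2) * hit z) \<longlonglongrightarrow> ennreal ((f z)\<^sup>2) * hit z"
    proof (intro AE_I2 tendsto_eventually)
      fix z assume "z \<in> space \<mu>"
      from truncate_eventually[OF this, of f]
      show "\<forall>\<^sub>F k in sequentially. ennreal ((?T k z)\<^sup>2) * hit z = ennreal ((f z)\<^sup>2) * hit z"
        by eventually_elim simp
    qed
  qed (intro borel_measurable_times_ennreal measurable_compose[OF _ measurable_ennreal] borel_measurable_power Tm f measurable_hit)+
  have lower: "?V \<le> (\<integral>\<^sup>+\<omega>. ennreal ((?D \<omega>)\<^sup>2) \<partial>P)"
  proof -
    have "2 * v k \<le> (\<integral>\<^sup>+\<omega>. ennreal ((?D \<omega>)\<^sup>2) \<partial>P) + ?V" for k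
    proof -
      have "2 * v k = (\<integral>\<^sup>+\<omega>. ennreal (2 * (compensated (?T k) \<omega>)\<^sup>2) \<partial>P)"
        unfolding v_def using Dkm
        by (subst nn_integral_cmult[symmetric]) (auto simp: ennreal_mult intro!: nn_integral_cong)
      also have "\<dots> \<le> (\<integral>\<^sup>+\<omega>. ennreal ((?D \<omega>)\<^sup>2) + ennreal ((?D \<omega> - 2 * compensated (?T k) \<omega>)\<^sup>2) \<partial>P)"
      proof (rule nn_integral_mono)
        fix \<omega>
        \<comment> \<open>Parallelogram law for
          \<open>?D \<omega> - compensated (?T k) \<omega>\<close> and
          \<open>compensated (?T k) \<omega>\<close>, whose sum is \<open>?D \<omega>\<close>; twice
          the square of the first is dropped.\<close>
        have "0 \<le> 2 * (?D \<omega> - compensated (?T k) \<omega>)\<^sup>2" by simp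
        then have "2 * (compensated (?T k) \<omega>)\<^sup>2 \<le> (?D \<omega>)\<^sup>2 + (?D \<omega> - 2 * compensated (?T k) \<omega>)\<^sup>2"
          by (simp add: power2_eq_square algebra_simps)
        then show "ennreal (2 * (compensated (?T k) \<omega>)\<^sup>2) \<le> ennreal ((?D \<omega>)\<^sup>2) + ennreal ((?D \<omega> - 2 * compensated (?T k) \<omega>)\<^sup>2)"
          by (simp add: ennreal_plus[symmetric] del: ennreal_plus)
      qed
      also have "\<dots> = (\<integral>\<^sup>+\<omega>. ennreal ((?D \<omega>)\<^sup>2) \<partial>P) + (\<integral>\<^sup>+\<omega>. ennreal ((?D \<omega> - 2 * compensated (?T k) \<omega>)\<^sup>2) \<partial>P)"
        using Dm Dkm by (intro nn_integral_add) auto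
      also have "\<dots> \<le> (\<integral>\<^sup>+\<omega>. ennreal ((?D \<omega>)\<^sup>2) \<partial>P) + ?V"
      proof (rule add_left_mono)
        have "(f z - 2 * ?T k z)\<^sup>2 = (f z)\<^sup>2" for z by (auto simp: truncate_def power2_eq_square)
        then show "(\<integral>\<^sup>+\<omega>. ennreal ((?D \<omega> - 2 * compensated (?T k) \<omega>)\<^sup>2) \<partial>P) \<le> ?V"
          using fatou[of 2 k] by simp
      qed
      finally show ?thesis .
    qed
    moreover have "(\<lambda>k. 2 * v k) \<longlonglongrightarrow> 2 * ?V"
      by (intro ennreal_tendsto_cmult vlim) simp
    ultimately have "2 * ?V \<le> (\<integral>\<^sup>+\<omega>. ennreal ((?D \<omega>)\<^sup>2) \<partial>P) + ?V"
      by (intro LIMSEQ_le_const2) auto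
    then have "?V + ?V \<le> ?V + (\<integral>\<^sup>+\<omega>. ennreal ((?D \<omega>)\<^sup>2) \<partial>P)" by (simp only: mult_2 add.commute)
    then show ?thesis using V by (simp only: ennreal_add_left_cancel_le) (auto simp: less_top)
  qed
  from upper lower show eq: "(\<integral>\<^sup>+\<omega>. ennreal ((?D \<omega>)\<^sup>2) \<partial>P) = ?V" by (rule antisym)
  have sq: "integrable P (\<lambda>\<omega>. (?D \<omega>)\<^sup>2)"
    using V Dm by (auto simp: integrable_iff_bounded eq)
  show D: "integrable P ?D"
    by (rule square_integrable_imp_integrable[OF Dm sq])
  \<comment> \<open>The truncated sums are centred, so the mean of \<open>?D\<close> is that of the
    difference \<open>?X\<close>. Its square is at most the second moment of \<open>?X\<close>, and
    hence at most the variance carried by the part of \<open>f\<close> that the truncation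
    removes.\<close>
  have bound: "(LINT \<omega>|P. ?D \<omega>)\<^sup>2 \<le> enn2real ?V - enn2real (v k)" for k
  proof -
    let ?X = "\<lambda>\<omega>. ?D \<omega> - compensated (?T k) \<omega>"
    have "(f z)\<^sup>2 = (?T k z)\<^sup>2 + (f z - ?T k z)\<^sup>2" for z by (auto simp: truncate_def)
    then have "?V = (\<integral>\<^sup>+z. ennreal ((?T k z)\<^sup>2) * hit z + ennreal ((f z - ?T k z)\<^sup>2) * hit z \<partial>\<mu>)"
      by (simp add: distrib_right[symmetric])
    also have "\<dots> = v k + (\<integral>\<^sup>+z. ennreal ((f z - ?T k z)\<^sup>2) * hit z \<partial>\<mu>)"
      unfolding vk using Tm f measurable_hit by (intro nn_integral_add) auto
    finally have Vq: "?V = v k + (\<integral>\<^sup>+z. ennreal ((f z - ?T k z)\<^sup>2) * hit z \<partial>\<mu>)" (is "_ = _ + ?q") .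
    then have fin: "v k < \<infinity>" "?q < \<infinity>" using V by (auto simp: less_top)
    have q: "(\<integral>\<^sup>+\<omega>. ennreal ((?X \<omega>)\<^sup>2) \<partial>P) \<le> ?q" using fatou[of 1 k] by simp
    have Xm: "?X \<in> borel_measurable P" by (intro borel_measurable_diff Dm Dkm)
    have iX: "integrable P (\<lambda>\<omega>. (?X \<omega>)\<^sup>2)"
      using le_less_trans[OF q fin(2)] by (intro integrableI_bounded borel_measurable_power Xm) simp
    have iX': "integrable P ?X" by (rule square_integrable_imp_integrable[OF Xm iX])
    have "(LINT \<omega>|P. ?D \<omega>) = (LINT \<omega>|P. ?X \<omega>)"
      using Bochner_Integration.integral_diff[OF D compensated_integrable(1)[OF adm[of k]]] expectation_compensated[OF adm[of k]]
      by simp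
    then have "(LINT \<omega>|P. ?D \<omega>)\<^sup>2 \<le> (LINT \<omega>|P. (?X \<omega>)\<^sup>2)"
      using variance_eq[OF iX' iX] variance_positive[of ?X] by simp
    also have "\<dots> = enn2real (\<integral>\<^sup>+\<omega>. ennreal ((?X \<omega>)\<^sup>2) \<partial>P)"
      by (intro integral_eq_nn_integral borel_measurable_power Xm) simp
    also have "\<dots> \<le> enn2real ?q" using q fin(2) by (intro enn2real_mono) auto
    also have "\<dots> = enn2real ?V - enn2real (v k)"
      unfolding Vq using fin by (simp add: enn2real_plus)
    finally show ?thesis .
  qed
  have "(\<lambda>k. enn2real ?V - enn2real (v k)) \<longlonglongrightarrow> enn2real ?V - enn2real ?V"
    by (intro tendsto_diff tendsto_const tendsto_enn2real) (use V vlim in \<open>auto simp: less_top\<close>)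
  with bound have "(LINT \<omega>|P. ?D \<omega>)\<^sup>2 \<le> enn2real ?V - enn2real ?V"
    by (intro LIMSEQ_le_const) auto
  then show "(LINT \<omega>|P. ?D \<omega>) = 0" by simp
qed

end

section \<open>The geometry of the maximum likelihood estimator\<close>

text \<open>A ratio between 0 and 1 does not decrease when raised to a power
  \<open>p \<le> 1\<close>. This is applied to the shares of \<open>a\<close> and \<open>b\<close>
  in \<open>a + b\<close>, which add up to 1.\<close>

lemma powr_subadditive:
  fixes a b p :: real
  assumes "0 \<le> a" "0 \<le> b" "0 < p" "p \<le> 1"
  shows "(a + b) powr p \<le> a powr p + b powr p"
proof (cases "a + b = 0")
  case True
  then show ?thesis using assms by (simp add: add_nonneg_eq_0_iff)
next
  case False
  then have s: "a + b > 0" using assms by simp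
  have *: "c / (a + b) * (a + b) powr p \<le> c powr p" if "0 \<le> c" "c \<le> a + b" for c
  proof -
    have "c / (a + b) \<le> (c / (a + b)) powr p"
      using powr_mono'[of p 1 "c / (a + b)"] that s assms by (simp add: powr_one_gt_zero_iff)
    then have "c / (a + b) * (a + b) powr p \<le> (c / (a + b)) powr p * (a + b) powr p"
      by (intro mult_right_mono) auto
    also have "\<dots> = c powr p" using that s by (simp add: powr_mult[symmetric])
    finally show ?thesis .
  qed
  have "(a + b) powr p = a / (a + b) * (a + b) powr p + b / (a + b) * (a + b) powr p"
    using s by (simp add: distrib_right[symmetric] add_divide_distrib[symmetric])
  also have "\<dots> \<le> a powr p + b powr p"
    using * [of a] * [of b] assms by (intro add_mono) auto
  finally show ?thesis .
qed

lemma space_strip: "space strip = {0..1} \<times> UNIV"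
  by (simp add: strip_def space_restrict_space)

lemma sets_strip: "sets strip = sets (restrict_space borel ({0..1} \<times> UNIV))"
  unfolding strip_def by (intro sets_restrict_space_cong) simp

lemma strip_closed: "({0..1} \<times> UNIV :: (real \<times> real) set) \<in> sets borel"
  by (intro borel_closed closed_Times) auto

lemma sets_strip_iff: "A \<in> sets strip \<longleftrightarrow> A \<in> sets borel \<and> A \<subseteq> {0..1} \<times> UNIV"
  unfolding sets_strip using strip_closed by (subst sets_restrict_space_iff) auto

lemma measurable_strip_borel: "f \<in> borel_measurable borel \<Longrightarrow> f \<in> borel_measurable strip"
  unfolding strip_def by (intro measurable_restrict_space1) simp

section \<open>The Hoelder modulus, cusps and shadows\<close>

locale holder =
  fixes \<beta> R :: real
  assumes \<beta>: "0 < \<beta>" "\<beta> \<le> 1" and R: "0 < R"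
begin

text \<open>As a function of \<open>x\<close> and \<open>y\<close>, \<open>\<kappa> (x - y)\<close>
  is a metric on the line, and the curves of the ball are those that are Lipschitz with constant 1
  for it on the unit interval.\<close>

definition \<kappa> :: "real \<Rightarrow> real" where
  "\<kappa> a = R * \<bar>a\<bar> powr \<beta>"

lemma \<kappa>_0 [simp]: "\<kappa> 0 = 0" by (simp add: \<kappa>_def)
lemma \<kappa>_nonneg [simp]: "0 \<le> \<kappa> a" using R by (simp add: \<kappa>_def)
lemma \<kappa>_pos: "a \<noteq> 0 \<Longrightarrow> 0 < \<kappa> a" using R by (simp add: \<kappa>_def)
lemma \<kappa>_minus: "\<kappa> (a - b) = \<kappa> (b - a)" by (simp add: \<kappa>_def abs_minus_commute)

lemma \<kappa>_mono: "\<bar>a\<bar> \<le> \<bar>b\<bar> \<Longrightarrow> \<kappa> a \<le> \<kappa> b"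
  using R \<beta> unfolding \<kappa>_def by (intro mult_left_mono powr_mono2) auto

lemma \<kappa>_strict_mono: "\<bar>a\<bar> < \<bar>b\<bar> \<Longrightarrow> \<kappa> a < \<kappa> b"
  using R \<beta> unfolding \<kappa>_def by (intro mult_strict_left_mono powr_less_mono2) auto

lemma \<kappa>_triangle: "\<kappa> (a - c) \<le> \<kappa> (a - b) + \<kappa> (b - c)"
proof -
  have "\<kappa> (a - c) \<le> R * (\<bar>a - b\<bar> + \<bar>b - c\<bar>) powr \<beta>"
    using R \<beta> unfolding \<kappa>_def by (intro mult_left_mono powr_mono2) auto
  also have "\<dots> \<le> R * (\<bar>a - b\<bar> powr \<beta> + \<bar>b - c\<bar> powr \<beta>)"
    using R \<beta> by (intro mult_left_mono powr_subadditive) auto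
  finally show ?thesis by (simp add: \<kappa>_def distrib_left)
qed

lemma \<kappa>_continuous: "continuous_on UNIV \<kappa>"
  unfolding \<kappa>_def using \<beta> by (intro continuous_intros continuous_on_powr') auto

lemma \<kappa>_measurable [measurable]: "\<kappa> \<in> borel_measurable borel"
  by (intro borel_measurable_continuous_onI \<kappa>_continuous)

lemma \<kappa>_bound: "\<bar>a\<bar> \<le> 1 \<Longrightarrow> \<kappa> a \<le> R"
  using \<kappa>_mono[of a 1] by (simp add: \<kappa>_def)

lemma \<kappa>_small:
  assumes "0 < e"
  obtains d where "0 < d" "\<And>a. \<bar>a\<bar> < d \<Longrightarrow> \<kappa> a < e"
proof -
  have "isCont \<kappa> 0" using \<kappa>_continuous by (simp add: continuous_on_eq_continuous_at)
  then obtain d where "d > 0" "\<And>a. dist a 0 < d \<Longrightarrow> dist (\<kappa> a) (\<kappa> 0) < e"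
    using assms unfolding continuous_at_eps_delta by blast
  then show ?thesis using that[of d] by (force simp: dist_real_def)
qed

text \<open>A curve of the ball that passes below the point \<open>z\<close> of the strip stays
  below \<open>cusp z\<close> on the whole unit interval. The estimator is the least of these upper
  bounds.\<close>

definition cusp :: "real \<times> real \<Rightarrow> real \<Rightarrow> real" where
  "cusp z x = snd z + \<kappa> (x - fst z)"

lemma cusp_lipschitz: "cusp z x \<le> cusp z y + \<kappa> (x - y)"
  using \<kappa>_triangle[of x "fst z" y] by (simp add: cusp_def)

text \<open>In \<open>ereal\<close> the infimum keeps its meaning for empty and for unbounded sets,
  so order and measurability can be treated for all configurations at once; \<open>mle_emle\<close>
  translates back.\<close>

definition emle :: "(real \<times> real) set \<Rightarrow> real \<Rightarrow> ereal" where
  "emle \<omega> x = (INF z\<in>\<omega>. ereal (cusp z x))"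

text \<open>Strict inequality makes emptiness of the shadow of \<open>(x, y)\<close> exactly the
  event that the infimum at \<open>x\<close> is at least \<open>y\<close>, and it keeps a point out
  of its own shadow.\<close>

definition shadow :: "real \<times> real \<Rightarrow> (real \<times> real) set" where
  "shadow z = {z'. cusp z' (fst z) < snd z}"

lemma shadow_asym: "z' \<in> shadow z \<Longrightarrow> z \<notin> shadow z'"
  using \<kappa>_nonneg[of "fst z - fst z'"] \<kappa>_nonneg[of "fst z' - fst z"]
  unfolding shadow_def cusp_def mem_Collect_eq by linarith

lemma emle_ge_iff: "ereal y \<le> emle \<omega> x \<longleftrightarrow> \<omega> \<inter> shadow (x, y) = {}"
  unfolding emle_def le_INF_iff by (auto simp: shadow_def not_less disjoint_iff)

lemma mle_eq: "mle \<beta> R \<omega> x = (INF z\<in>\<omega>. cusp z x)"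
  by (simp add: mle_def cusp_def \<kappa>_def split_beta')

text \<open>A lower bound on the ordinates together with local finiteness leaves finitely many
  points below any level, so that the infimum in \<open>mle\<close> is attained.\<close>

definition good :: "(real \<times> real) set \<Rightarrow> bool" where
  "good \<omega> \<longleftrightarrow> \<omega> \<in> configurations (space strip) \<and> \<omega> \<noteq> {} \<and> (\<exists>b. \<forall>z\<in>\<omega>. b \<le> snd z)"

lemma good_finite:
  assumes "good \<omega>"
  shows "finite {z \<in> \<omega>. snd z \<le> c}"
proof -
  obtain b where b: "\<And>z. z \<in> \<omega> \<Longrightarrow> b \<le> snd z" using assms by (auto simp: good_def)
  have "bounded ({0..1::real} \<times> {b..c})" by (intro bounded_Times bounded_closed_interval)
  then have "finite (\<omega> \<inter> ({0..1} \<times> {b..c}))"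
    using assms by (auto simp: good_def configurations_finite)
  moreover have "{z \<in> \<omega>. snd z \<le> c} \<subseteq> \<omega> \<inter> ({0..1} \<times> {b..c})"
    using assms b configurations_subset[of \<omega> "space strip"] by (fastforce simp: good_def space_strip)
  ultimately show ?thesis by (rule rev_finite_subset)
qed

lemma good_attained:
  assumes "good \<omega>" and "\<omega>' \<subseteq> \<omega>" "\<omega>' \<noteq> {}"
  obtains z where "z \<in> \<omega>'" "\<And>z'. z' \<in> \<omega>' \<Longrightarrow> cusp z x \<le> cusp z' x"
proof -
  obtain z0 where z0: "z0 \<in> \<omega>'" using assms by auto
  let ?S = "{z \<in> \<omega>'. cusp z x \<le> cusp z0 x}"
  have "?S \<subseteq> {z \<in> \<omega>. snd z \<le> cusp z0 x}"
  proof
    fix z assume z: "z \<in> ?S"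
    then have "snd z + \<kappa> (x - fst z) \<le> cusp z0 x" by (simp add: cusp_def[of z])
    then have "snd z \<le> cusp z0 x" using \<kappa>_nonneg[of "x - fst z"] by linarith
    then show "z \<in> {z \<in> \<omega>. snd z \<le> cusp z0 x}" using z assms(2) by auto
  qed
  then have fin: "finite ?S" using good_finite[OF assms(1)] by (rule finite_subset)
  have "z0 \<in> ?S" using z0 by simp
  then have "?S \<noteq> {}" by blast
  from ex_min_if_finite[of "(\<lambda>z. cusp z x) ` ?S"] fin this
  obtain m where m: "m \<in> (\<lambda>z. cusp z x) ` ?S" "\<not> (\<exists>y\<in>(\<lambda>z. cusp z x) ` ?S. y < m)" by auto
  then obtain z where z: "z \<in> ?S" "m = cusp z x" by auto
  show ?thesis
  proof (rule that[of z])
    show "z \<in> \<omega>'" using z by simp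
    fix z' assume "z' \<in> \<omega>'"
    show "cusp z x \<le> cusp z' x"
    proof (cases "z' \<in> ?S")
      case True
      then have "\<not> cusp z' x < m" using m(2) by blast
      then show ?thesis using z(2) by simp
    next
      case False then show ?thesis using z \<open>z' \<in> \<omega>'\<close> by auto
    qed
  qed
qed

lemma good_mle:
  assumes "good \<omega>"
  shows "z \<in> \<omega> \<Longrightarrow> mle \<beta> R \<omega> x \<le> cusp z x"
    and "\<exists>z\<in>\<omega>. mle \<beta> R \<omega> x = cusp z x"
    and "emle \<omega> x = ereal (mle \<beta> R \<omega> x)"
proof -
  from assms have "\<omega> \<noteq> {}" by (simp add: good_def)
  with assms obtain z0 where z0: "z0 \<in> \<omega>" "\<And>z'. z' \<in> \<omega> \<Longrightarrow> cusp z0 x \<le> cusp z' x"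
    using good_attained[of \<omega> \<omega>] by blast
  have m: "mle \<beta> R \<omega> x = cusp z0 x"
    unfolding mle_eq using z0 by (intro cInf_eq_minimum) auto
  show "z \<in> \<omega> \<Longrightarrow> mle \<beta> R \<omega> x \<le> cusp z x" using m z0 by simp
  show "\<exists>z\<in>\<omega>. mle \<beta> R \<omega> x = cusp z x" using m z0 by auto
  show "emle \<omega> x = ereal (mle \<beta> R \<omega> x)"
    unfolding m emle_def using z0 by (intro antisym INF_lower INF_greatest) auto
qed

lemma good_shadow: "good \<omega> \<Longrightarrow> \<omega> \<inter> shadow (x, y) = {} \<longleftrightarrow> y \<le> mle \<beta> R \<omega> x"
  using emle_ge_iff[of y \<omega> x] by (simp add: good_mle(3))

lemma mle_lipschitz: "good \<omega> \<Longrightarrow> mle \<beta> R \<omega> x \<le> mle \<beta> R \<omega> y + \<kappa> (x - y)"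
proof -
  assume g: "good \<omega>"
  obtain z where z: "z \<in> \<omega>" "mle \<beta> R \<omega> y = cusp z y" using good_mle(2)[OF g] by blast
  show ?thesis using good_mle(1)[OF g z(1), of x] cusp_lipschitz[of z x y] z(2) by linarith
qed

lemma mle_continuous: "good \<omega> \<Longrightarrow> continuous_on UNIV (mle \<beta> R \<omega>)"
proof -
  assume g: "good \<omega>"
  show ?thesis unfolding continuous_on_iff
  proof (intro ballI allI impI)
    fix x e :: real assume "0 < e"
    then obtain d where d: "0 < d" "\<And>a. \<bar>a\<bar> < d \<Longrightarrow> \<kappa> a < e" by (rule \<kappa>_small) blast
    show "\<exists>d>0. \<forall>x'\<in>UNIV. dist x' x < d \<longrightarrow> dist (mle \<beta> R \<omega> x') (mle \<beta> R \<omega> x) < e"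
    proof (intro exI conjI ballI impI)
      fix x' assume "dist x' x < d"
      then have "\<kappa> (x' - x) < e" using d by (simp add: dist_real_def)
      then show "dist (mle \<beta> R \<omega> x') (mle \<beta> R \<omega> x) < e"
        using mle_lipschitz[OF g, of x x'] mle_lipschitz[OF g, of x' x] \<kappa>_minus[of x x']
        by (simp add: dist_real_def abs_less_iff)
    qed (rule d(1))
  qed
qed

text \<open>\<open>emle \<omega>\<close> is Lipschitz for \<kappa>, so its value at \<open>x\<close>
  can be recovered from rational arguments. In the resulting countable infimum \<omega> and
  \<open>x\<close> are separated, which yields joint measurability.\<close>

lemma emle_rat: "emle \<omega> x = (INF q\<in>\<rat>. emle \<omega> q + ereal (\<kappa> (x - q)))"
proof (rule antisym)
  have "emle \<omega> x \<le> emle \<omega> q + ereal (\<kappa> (x - q))" for q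
  proof -
    have "emle \<omega> x - ereal (\<kappa> (x - q)) \<le> emle \<omega> q"
      unfolding emle_def[of \<omega> q]
    proof (rule INF_greatest)
      fix z assume "z \<in> \<omega>"
      then have "emle \<omega> x \<le> ereal (cusp z x)" unfolding emle_def by (rule INF_lower)
      also have "\<dots> \<le> ereal (cusp z q) + ereal (\<kappa> (x - q))" using cusp_lipschitz[of z x q] by simp
      finally show "emle \<omega> x - ereal (\<kappa> (x - q)) \<le> ereal (cusp z q)"
        by (simp add: ereal_minus_le)
    qed
    then show ?thesis by (simp add: ereal_minus_le)
  qed
  then show "emle \<omega> x \<le> (INF q\<in>\<rat>. emle \<omega> q + ereal (\<kappa> (x - q)))" by (intro INF_greatest)
  show "(INF q\<in>\<rat>. emle \<omega> q + ereal (\<kappa> (x - q))) \<le> emle \<omega> x"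
    unfolding emle_def[of \<omega> x]
  proof (rule INF_greatest)
    fix z assume z: "z \<in> \<omega>"
    show "(INF q\<in>\<rat>. emle \<omega> q + ereal (\<kappa> (x - q))) \<le> ereal (cusp z x)"
    proof (rule ereal_le_epsilon2)
      fix e :: real assume "0 < e"
      then obtain d where d: "0 < d" "\<And>a. \<bar>a\<bar> < d \<Longrightarrow> \<kappa> a < e / 2" using \<kappa>_small[of "e / 2"] by auto
      obtain q where q: "q \<in> \<rat>" "x < q" "q < x + d" using Rats_dense_in_real[of x "x + d"] d by auto
      then have k: "\<kappa> (x - q) < e / 2" using d by simp
      have "(INF q\<in>\<rat>. emle \<omega> q + ereal (\<kappa> (x - q))) \<le> emle \<omega> q + ereal (\<kappa> (x - q))"
        using q(1) by (rule INF_lower)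
      also have "\<dots> \<le> ereal (cusp z q) + ereal (\<kappa> (x - q))"
        unfolding emle_def using z by (intro add_right_mono INF_lower)
      also have "\<dots> \<le> ereal (cusp z x) + ereal e"
        using cusp_lipschitz[of z q x] k \<kappa>_minus[of x q] by simp
      finally show "(INF q\<in>\<rat>. emle \<omega> q + ereal (\<kappa> (x - q))) \<le> ereal (cusp z x) + ereal e" .
    qed
  qed
qed

text \<open>\<open>N\<close> is left open because the argument serves, by way of
  \<open>mle_measurable\<close>, both the full configuration space and the smaller sigma-algebra
  generated by the estimator.\<close>

lemma emle_measurable:
  assumes m: "\<And>q t. {\<omega> \<in> space N. \<omega> \<inter> shadow (q, t) = {}} \<in> sets N"
  shows "(\<lambda>\<omega>. emle \<omega> q) \<in> borel_measurable N"
    and "(\<lambda>(\<omega>, x). emle \<omega> x) \<in> borel_measurable (N \<Otimes>\<^sub>M borel)"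
proof -
  have lt: "(\<lambda>\<omega>. emle \<omega> q) -` {..<ereal t} \<inter> space N \<in> sets N" for q t
  proof -
    have "(\<lambda>\<omega>. emle \<omega> q) -` {..<ereal t} \<inter> space N = space N - {\<omega> \<in> space N. \<omega> \<inter> shadow (q, t) = {}}"
      by (auto simp: emle_ge_iff[symmetric] not_le)
    then show ?thesis using m by auto
  qed
  show 1: "(\<lambda>\<omega>. emle \<omega> q) \<in> borel_measurable N" for q
    unfolding borel_measurable_ereal_iff_Iio
  proof
    fix a :: ereal
    show "(\<lambda>\<omega>. emle \<omega> q) -` {..<a} \<inter> space N \<in> sets N"
    proof (cases a)
      case (real t) then show ?thesis using lt by simp
    next
      case PInf
      have "(\<exists>n. y < ereal (real n)) = (y < \<infinity>)" for y :: ereal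
        by (cases y) (auto simp: reals_Archimedean2)
      then have "(\<lambda>\<omega>. emle \<omega> q) -` {..<a} \<inter> space N = (\<Union>n. (\<lambda>\<omega>. emle \<omega> q) -` {..<ereal (real n)} \<inter> space N)"
        using PInf by auto
      also have "\<dots> \<in> sets N" using lt by blast
      finally show ?thesis .
    next
      case MInf
      then have "{..<a} = {}" by auto
      then show ?thesis by simp
    qed
  qed
  have "(\<lambda>p. INF q\<in>\<rat>. emle (fst p) q + ereal (\<kappa> (snd p - q))) \<in> borel_measurable (N \<Otimes>\<^sub>M borel)"
  proof (rule borel_measurable_INF)
    show "countable \<rat>" by (rule countable_rat)
    fix q :: real
    have [measurable]: "(\<lambda>p. emle (fst p) q) \<in> borel_measurable (N \<Otimes>\<^sub>M borel)"
      using measurable_compose[OF measurable_fst 1] .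
    show "(\<lambda>p. emle (fst p) q + ereal (\<kappa> (snd p - q))) \<in> borel_measurable (N \<Otimes>\<^sub>M borel)"
      by measurable
  qed
  then show "(\<lambda>(\<omega>, x). emle \<omega> x) \<in> borel_measurable (N \<Otimes>\<^sub>M borel)"
    by (simp add: split_beta' emle_rat[symmetric])
qed

text \<open>On configurations that are empty or unbounded below, \<open>mle\<close> is a constant function
  with an unspecified value.\<close>

lemma mle_emle:
  assumes w: "\<omega> \<in> configurations (space strip)" and x: "x \<in> {0..1}"
  shows "mle \<beta> R \<omega> x = (if emle \<omega> 0 = \<infinity> then Inf {} else if emle \<omega> 0 = -\<infinity> then - (LEAST z. False)
    else real_of_ereal (emle \<omega> x))"
proof (cases "good \<omega>")
  case True
  then show ?thesis by (simp add: good_mle(3))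
next
  case False
  then consider "\<omega> = {}" | "\<omega> \<noteq> {}" "\<And>b. \<exists>z\<in>\<omega>. snd z < b"
    using w by (auto simp: good_def not_le)
  then show ?thesis
  proof cases
    case 1
    then show ?thesis by (simp add: mle_eq emle_def top_ereal_def)
  next
    case 2
    have c: "cusp z y \<le> snd z + R" if "z \<in> \<omega>" "y \<in> {0..1}" for z y
    proof -
      have "fst z \<in> {0..1}" using that(1) configurations_subset[OF w] by (auto simp: space_strip)
      then have "\<bar>y - fst z\<bar> \<le> 1" using that(2) by auto
      then show ?thesis using \<kappa>_bound by (simp add: cusp_def)
    qed
    have ex: "\<exists>z\<in>\<omega>. cusp z y < b" if "y \<in> {0..1}" for y b
      using 2(2)[of "b - R"] c[OF _ that] by force
    have "emle \<omega> 0 = -\<infinity>"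
    proof (rule ereal_bot)
      fix b
      obtain z where "z \<in> \<omega>" "cusp z 0 < b" using ex[of 0 b] by auto
      then show "emle \<omega> 0 \<le> ereal b" unfolding emle_def by (intro INF_lower2) auto
    qed
    \<comment> \<open>The real \<open>Inf\<close> unfolds to minus a least upper bound of the
      negated values. There is no upper bound, so the defining predicate is constantly false and the
      value does not depend on \<open>x\<close>.\<close>
    moreover have "(\<forall>y\<in>uminus ` (\<lambda>z. cusp z x) ` \<omega>. y \<le> b) = False" for b
      using ex[OF x, of "- b"] by force
    then have "mle \<beta> R \<omega> x = - (LEAST z. False)"
      unfolding mle_eq Inf_real_def Sup_real_def by (simp only:)
    ultimately show ?thesis by simp
  qed
qed

lemma mle_measurable:
  assumes sp: "space N \<subseteq> configurations (space strip)"
    and m: "\<And>q t. {\<omega> \<in> space N. \<omega> \<inter> shadow (q, t) = {}} \<in> sets N"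
  shows "(\<lambda>(\<omega>, x). mle \<beta> R \<omega> x) \<in> borel_measurable (N \<Otimes>\<^sub>M restrict_space borel {0..1})"
    and "x \<in> {0..1} \<Longrightarrow> (\<lambda>\<omega>. mle \<beta> R \<omega> x) \<in> borel_measurable N"
proof -
  have [measurable]: "(\<lambda>\<omega>. emle \<omega> q) \<in> borel_measurable N" for q
    by (rule emle_measurable(1)[OF m])
  have id: "(\<lambda>x. x) \<in> restrict_space borel {0..1::real} \<rightarrow>\<^sub>M borel"
    by (rule measurable_restrict_space1) simp
  have "(\<lambda>p. snd p) \<in> N \<Otimes>\<^sub>M restrict_space borel {0..1::real} \<rightarrow>\<^sub>M borel"
    using measurable_compose[OF measurable_snd[of N] id] by simp
  then have "(\<lambda>p. (fst p, snd p)) \<in> N \<Otimes>\<^sub>M restrict_space borel {0..1::real} \<rightarrow>\<^sub>M N \<Otimes>\<^sub>M borel"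
    by (rule measurable_Pair[OF measurable_fst])
  from measurable_compose[OF this emle_measurable(2)[OF m]]
  have [measurable]: "(\<lambda>p. emle (fst p) (snd p)) \<in> borel_measurable (N \<Otimes>\<^sub>M restrict_space borel {0..1})"
    by simp
  have [measurable]: "(\<lambda>p. emle (fst p) 0) \<in> borel_measurable (N \<Otimes>\<^sub>M restrict_space borel {0..1})"
    by (rule measurable_compose[OF measurable_fst]) measurable
  have "(\<lambda>p. if emle (fst p) 0 = \<infinity> then Inf {} else if emle (fst p) 0 = -\<infinity> then - (LEAST z. False)
    else real_of_ereal (emle (fst p) (snd p))) \<in> borel_measurable (N \<Otimes>\<^sub>M restrict_space borel {0..1})"
    by measurable
  then show 2: "(\<lambda>(\<omega>, x). mle \<beta> R \<omega> x) \<in> borel_measurable (N \<Otimes>\<^sub>M restrict_space borel {0..1})"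
  proof (rule measurable_cong[THEN iffD1, rotated])
    fix p assume "p \<in> space (N \<Otimes>\<^sub>M restrict_space borel {0..1::real})"
    then have "fst p \<in> configurations (space strip)" "snd p \<in> {0..1}"
      using sp by (auto simp: space_pair_measure space_restrict_space)
    then show "(if emle (fst p) 0 = \<infinity> then Inf {} else if emle (fst p) 0 = -\<infinity> then - (LEAST z. False)
      else real_of_ereal (emle (fst p) (snd p))) = (case p of (\<omega>, x) \<Rightarrow> mle \<beta> R \<omega> x)"
      by (simp add: mle_emle split_beta')
  qed
  show "(\<lambda>\<omega>. mle \<beta> R \<omega> x) \<in> borel_measurable N" if "x \<in> {0..1}"
    using measurable_compose[OF measurable_Pair2'[of x "restrict_space borel {0..1}" N] 2] that
    unfolding prod.case by (simp add: space_restrict_space)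
qed

section \<open>Recovering the touching points from the local minima of the estimator\<close>

definition touching :: "(real \<times> real) set \<Rightarrow> (real \<times> real) set" where
  "touching \<omega> = {z \<in> \<omega>. snd z \<le> mle \<beta> R \<omega> (fst z)}"

definition dyadics :: "real set" where
  "dyadics = (\<lambda>(m, i). real i / 2 ^ m) ` (UNIV :: (nat \<times> nat) set)"

text \<open>Without dyadic abscissas every apex lies in the interior of its dyadic cell. Without
  points on the cusps of other points, touching points become strict local minima.\<close>

definition simple :: "(real \<times> real) set \<Rightarrow> bool" where
  "simple \<omega> \<longleftrightarrow> good \<omega> \<and> (\<forall>z\<in>\<omega>. fst z \<notin> dyadics) \<and> (\<forall>z\<in>\<omega>. \<forall>z'\<in>\<omega>. z' \<noteq> z \<longrightarrow> cusp z' (fst z) \<noteq> snd z)"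

definition cell :: "nat \<Rightarrow> nat \<Rightarrow> real set" where
  "cell m i = {real i / 2 ^ m .. real (Suc i) / 2 ^ m}"

text \<open>Rational arguments keep the infimum countable and hence measurable in the configuration.
  For good configurations continuity makes it the minimum over the whole cell.\<close>

definition cell_min :: "nat \<Rightarrow> nat \<Rightarrow> (real \<times> real) set \<Rightarrow> real" where
  "cell_min m i \<omega> = real_of_ereal (INF q\<in>\<rat> \<inter> cell m i. ereal (mle \<beta> R \<omega> q))"

text \<open>For good configurations the minimum over such a cell is attained in the interior and not
  at the ends, so by \<open>local_min_touching\<close> it is the height of a touching point.\<close>

definition valley :: "nat \<Rightarrow> nat \<Rightarrow> (real \<times> real) set \<Rightarrow> bool" where
  "valley m i \<omega> \<longleftrightarrow> cell_min m i \<omega> < mle \<beta> R \<omega> (real i / 2 ^ m) \<and> cell_min m i \<omega> < mle \<beta> R \<omega> (real (Suc i) / 2 ^ m)"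

text \<open>The sum sees the configuration only through values of \<open>mle\<close>; this is what
  makes its limit a function of the estimator.\<close>

definition valley_sum :: "(real \<Rightarrow> real) \<Rightarrow> nat \<Rightarrow> (real \<times> real) set \<Rightarrow> real" where
  "valley_sum f m \<omega> = (\<Sum>i<2 ^ m. if valley m i \<omega> then f (cell_min m i \<omega>) else 0)"

lemma touching_mle: "good \<omega> \<Longrightarrow> z \<in> touching \<omega> \<Longrightarrow> mle \<beta> R \<omega> (fst z) = snd z"
  using good_mle(1)[of \<omega> z "fst z"] by (force simp: touching_def cusp_def)

lemma good_fst: "good \<omega> \<Longrightarrow> z \<in> \<omega> \<Longrightarrow> fst z \<in> {0..1}"
  using configurations_subset[of \<omega> "space strip"] by (auto simp: good_def space_strip)

text \<open>A single point \<open>z0\<close> of the configuration caps the estimator at height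
  \<open>snd z0 + R\<close> on the unit interval, and touching points are no higher than the
  estimator.\<close>

lemma finite_touching:
  assumes g: "good \<omega>"
  shows "finite (touching \<omega>)"
proof -
  obtain z0 where z0: "z0 \<in> \<omega>" using g by (auto simp: good_def)
  have "touching \<omega> \<subseteq> {z \<in> \<omega>. snd z \<le> snd z0 + R}"
  proof
    fix z assume z: "z \<in> touching \<omega>"
    then have "z \<in> \<omega>" by (simp add: touching_def)
    then have "\<bar>fst z - fst z0\<bar> \<le> 1" using good_fst[OF g z0] good_fst[OF g \<open>z \<in> \<omega>\<close>] by auto
    then have "cusp z0 (fst z) \<le> snd z0 + R" using \<kappa>_bound by (simp add: cusp_def)
    then have "snd z \<le> snd z0 + R" using z good_mle(1)[OF g z0, of "fst z"] by (simp add: touching_def)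
    then show "z \<in> {z \<in> \<omega>. snd z \<le> snd z0 + R}" using \<open>z \<in> \<omega>\<close> by simp
  qed
  then show ?thesis using good_finite[OF g] by (rule finite_subset)
qed

lemma cell_min:
  assumes g: "good \<omega>"
  obtains x where "x \<in> cell m i" "mle \<beta> R \<omega> x = cell_min m i \<omega>" "\<And>y. y \<in> cell m i \<Longrightarrow> cell_min m i \<omega> \<le> mle \<beta> R \<omega> y"
proof -
  define l r where lr: "l = real i / 2 ^ m" "r = real (Suc i) / 2 ^ m"
  have cell: "cell m i = {l..r}" by (simp add: cell_def lr)
  have "l < r" by (simp add: lr divide_strict_right_mono)
  have "continuous_on {l..r} (mle \<beta> R \<omega>)" using mle_continuous[OF g] by (rule continuous_on_subset) simp
  from continuous_attains_inf[OF compact_Icc _ this] \<open>l < r\<close>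
  obtain x where x: "x \<in> {l..r}" "\<And>y. y \<in> {l..r} \<Longrightarrow> mle \<beta> R \<omega> x \<le> mle \<beta> R \<omega> y" by fastforce
  have "(INF q\<in>\<rat> \<inter> {l..r}. ereal (mle \<beta> R \<omega> q)) = ereal (mle \<beta> R \<omega> x)"
  proof (rule antisym)
    show "ereal (mle \<beta> R \<omega> x) \<le> (INF q\<in>\<rat> \<inter> {l..r}. ereal (mle \<beta> R \<omega> q))"
      using x by (intro INF_greatest) auto
    show "(INF q\<in>\<rat> \<inter> {l..r}. ereal (mle \<beta> R \<omega> q)) \<le> ereal (mle \<beta> R \<omega> x)"
    proof (rule ereal_le_epsilon2)
      fix e :: real assume "0 < e"
      then obtain d where d: "0 < d" "\<And>a. \<bar>a\<bar> < d \<Longrightarrow> \<kappa> a < e" by (rule \<kappa>_small) blast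
      have "max l (x - d) < min r (x + d)" using \<open>l < r\<close> x(1) d(1) by auto
      then obtain q where q: "q \<in> \<rat>" "max l (x - d) < q" "q < min r (x + d)" using Rats_dense_in_real by blast
      then have "\<kappa> (q - x) < e" using d(2)[of "q - x"] by (auto simp: abs_less_iff)
      then have "mle \<beta> R \<omega> q \<le> mle \<beta> R \<omega> x + e" using mle_lipschitz[OF g, of q x] by linarith
      moreover have "(INF q\<in>\<rat> \<inter> {l..r}. ereal (mle \<beta> R \<omega> q)) \<le> ereal (mle \<beta> R \<omega> q)"
        using q by (intro INF_lower) auto
      ultimately show "(INF q\<in>\<rat> \<inter> {l..r}. ereal (mle \<beta> R \<omega> q)) \<le> ereal (mle \<beta> R \<omega> x) + ereal e"
        by (auto intro: order_trans)
    qed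
  qed
  then have "cell_min m i \<omega> = mle \<beta> R \<omega> x" by (simp add: cell_min_def cell)
  then show ?thesis using that[of x] x by (simp add: cell)
qed

text \<open>The value is attained by the cusp of some point. If the apex had another abscissa, a
  step towards it would lower this cusp and with it the estimator.\<close>

lemma local_min_touching:
  assumes g: "good \<omega>" and x: "l < x" "x < r" and min: "\<And>y. y \<in> {l..r} \<Longrightarrow> mle \<beta> R \<omega> x \<le> mle \<beta> R \<omega> y"
  shows "\<exists>z\<in>touching \<omega>. fst z = x \<and> snd z = mle \<beta> R \<omega> x"
proof -
  obtain z where z: "z \<in> \<omega>" "mle \<beta> R \<omega> x = cusp z x" using good_mle(2)[OF g] by blast
  have "fst z = x"
  proof (rule ccontr)
    assume "fst z \<noteq> x"
    obtain y where y: "y \<in> {l..r}" "\<bar>y - fst z\<bar> < \<bar>x - fst z\<bar>"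
    proof (cases "x < fst z")
      case True
      show ?thesis by (rule that[of "min r (fst z)"]) (use x True in auto)
    next
      case False
      show ?thesis by (rule that[of "max l (fst z)"]) (use x False \<open>fst z \<noteq> x\<close> in auto)
    qed
    have "mle \<beta> R \<omega> y \<le> cusp z y" by (rule good_mle(1)[OF g z(1)])
    also have "\<dots> < cusp z x" using \<kappa>_strict_mono[OF y(2)] by (simp add: cusp_def)
    finally show False using min[OF y(1)] z(2) by simp
  qed
  then show ?thesis using z by (intro bexI[of _ z]) (auto simp: touching_def cusp_def)
qed

text \<open>Ties between cusps would spoil the strictness of the minimum: at a tie \<open>mle\<close> decreases towards
  the apex of the other cusp.\<close>

lemma touching_strict_min:
  assumes s: "simple \<omega>" and z: "z \<in> touching \<omega>"
  shows "\<exists>d>0. \<forall>x. 0 < \<bar>x - fst z\<bar> \<and> \<bar>x - fst z\<bar> < d \<longrightarrow> snd z < mle \<beta> R \<omega> x"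
proof (cases "\<omega> - {z} = {}")
  have g: "good \<omega>" using s by (simp add: simple_def)
  have pos: "snd z < cusp z x" if "0 < \<bar>x - fst z\<bar>" for x
    using that \<kappa>_pos[of "x - fst z"] by (simp add: cusp_def)
  {
    case True
    have "snd z < mle \<beta> R \<omega> x" if "0 < \<bar>x - fst z\<bar>" for x
      using good_mle(2)[OF g, of x] True pos[OF that] by fastforce
    then show ?thesis by (intro exI[of _ 1]) auto
  next
    case False
    then obtain z1 where z1: "z1 \<in> \<omega> - {z}" "\<And>z'. z' \<in> \<omega> - {z} \<Longrightarrow> cusp z1 (fst z) \<le> cusp z' (fst z)"
      using good_attained[OF g, of "\<omega> - {z}" "fst z"] by blast
    have "snd z \<le> cusp z1 (fst z)"
      using good_mle(1)[OF g, of z1 "fst z"] z1(1) touching_mle[OF g z] by auto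
    moreover have "cusp z1 (fst z) \<noteq> snd z"
      using s z z1(1) by (auto simp: simple_def touching_def)
    ultimately have "0 < cusp z1 (fst z) - snd z" by simp
    then obtain d where d: "0 < d" "\<And>a. \<bar>a\<bar> < d \<Longrightarrow> \<kappa> a < cusp z1 (fst z) - snd z"
      by (rule \<kappa>_small) blast
    have "snd z < mle \<beta> R \<omega> x" if x: "0 < \<bar>x - fst z\<bar>" "\<bar>x - fst z\<bar> < d" for x
    proof -
      obtain z2 where z2: "z2 \<in> \<omega>" "mle \<beta> R \<omega> x = cusp z2 x" using good_mle(2)[OF g] by blast
      show ?thesis
      proof (cases "z2 = z")
        case True then show ?thesis using z2 pos[OF x(1)] by simp
      next
        case False
        then have "cusp z1 (fst z) \<le> cusp z2 (fst z)" using z1 z2 by simp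
        also have "\<dots> \<le> cusp z2 x + \<kappa> (x - fst z)" using cusp_lipschitz[of z2 "fst z" x] \<kappa>_minus[of x "fst z"] by simp
        finally show ?thesis using d(2)[OF x(2)] z2(2) by simp
      qed
    qed
    then show ?thesis using d(1) by blast
  }
qed

text \<open>Once the mesh is below the smallest radius of strict minimality, no other argument in
  the cell of an apex reaches down to its height. Valleys then correspond one to one to touching
  points, with the cell minimum as ordinate.\<close>

theorem valley_sum_eventually:
  assumes s: "simple \<omega>"
  shows "\<forall>\<^sub>F m in sequentially. valley_sum f m \<omega> = (\<Sum>z\<in>touching \<omega>. f (snd z))"
proof -
  have g: "good \<omega>" using s by (simp add: simple_def)
  have "\<forall>z\<in>touching \<omega>. \<exists>d>0. \<forall>x. 0 < \<bar>x - fst z\<bar> \<and> \<bar>x - fst z\<bar> < d \<longrightarrow> snd z < mle \<beta> R \<omega> x"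
    using touching_strict_min[OF s] by blast
  from bchoice[OF this] obtain D where D: "\<And>z. z \<in> touching \<omega> \<Longrightarrow> D z > 0"
    "\<And>z x. z \<in> touching \<omega> \<Longrightarrow> 0 < \<bar>x - fst z\<bar> \<Longrightarrow> \<bar>x - fst z\<bar> < D z \<Longrightarrow> snd z < mle \<beta> R \<omega> x" by metis
  define d where "d = Min (insert 1 (D ` touching \<omega>))"
  have fin: "finite (insert 1 (D ` touching \<omega>))" using finite_touching[OF g] by simp
  have d0: "0 < d" using D(1) fin by (simp add: d_def)
  have d: "snd z < mle \<beta> R \<omega> x" if "z \<in> touching \<omega>" "x \<noteq> fst z" "\<bar>x - fst z\<bar> < d" for z x
  proof -
    have "d \<le> D z" unfolding d_def using fin that(1) by (intro Min_le) auto
    then show ?thesis using D(2)[OF that(1), of x] that by simp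
  qed
  have "(\<lambda>m. (1 / 2) ^ m :: real) \<longlonglongrightarrow> 0" by (rule LIMSEQ_power_zero) simp
  then have "\<forall>\<^sub>F m in sequentially. (1 / 2) ^ m < d" using d0 by (rule order_tendstoD)
  then show ?thesis
  proof eventually_elim
    case (elim m)
    define idx where "idx z = nat \<lfloor>2 ^ m * fst z\<rfloor>" for z :: "real \<times> real"
    have len: "real (Suc i) / 2 ^ m - real i / 2 ^ m < d" for i
      using elim by (simp add: field_simps power_divide)
    have A: "idx z < 2 ^ m \<and> real (idx z) / 2 ^ m < fst z \<and> fst z < real (Suc (idx z)) / 2 ^ m" if z: "z \<in> touching \<omega>" for z
    proof -
      have "z \<in> \<omega>" using z by (simp add: touching_def)
      then have x: "fst z \<in> {0..1}" and nd: "fst z \<notin> dyadics"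
        using good_fst[OF g] s by (auto simp: simple_def)
      have ne: "fst z \<noteq> real i / 2 ^ k" for i k using nd by (force simp: dyadics_def)
      have "fst z \<noteq> 1" using ne[of 1 0] by simp
      then have "fst z < 1" using x by simp
      have "real (idx z) = of_int \<lfloor>2 ^ m * fst z\<rfloor>" using x by (simp add: idx_def)
      then have 1: "real (idx z) \<le> 2 ^ m * fst z" "2 ^ m * fst z < real (idx z) + 1" by linarith+
      have "2 ^ m * fst z < 2 ^ m * 1" using \<open>fst z < 1\<close> by (intro mult_strict_left_mono) auto
      then have "real (idx z) < 2 ^ m" using 1 by linarith
      then have "idx z < 2 ^ m" by (metis of_nat_less_iff of_nat_numeral of_nat_power)
      moreover have "real (idx z) / 2 ^ m \<le> fst z" "fst z < real (Suc (idx z)) / 2 ^ m"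
        using 1 by (auto simp: field_simps)
      ultimately show ?thesis using ne[of "idx z" m] by (simp add: less_le)
    qed
    have B: "x = fst z" if z: "z \<in> touching \<omega>" and x: "x \<in> cell m (idx z)" "mle \<beta> R \<omega> x \<le> snd z" for z x
    proof (rule ccontr)
      assume "x \<noteq> fst z"
      moreover have "\<bar>x - fst z\<bar> < d" using A[OF z] x(1) len[of "idx z"] by (auto simp: cell_def abs_less_iff)
      ultimately show False using d[OF z, of x] x(2) by simp
    qed
    have C: "cell_min m (idx z) \<omega> = snd z" "valley m (idx z) \<omega>" if z: "z \<in> touching \<omega>" for z
    proof -
      obtain x where x: "x \<in> cell m (idx z)" "mle \<beta> R \<omega> x = cell_min m (idx z) \<omega>"
        "\<And>y. y \<in> cell m (idx z) \<Longrightarrow> cell_min m (idx z) \<omega> \<le> mle \<beta> R \<omega> y"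
        using cell_min[OF g] by blast
      have zc: "fst z \<in> cell m (idx z)" using A[OF z] by (auto simp: cell_def)
      have "mle \<beta> R \<omega> x \<le> snd z" using x(3)[OF zc] x(2) touching_mle[OF g z] by simp
      then have "x = fst z" by (rule B[OF z x(1)])
      then show c: "cell_min m (idx z) \<omega> = snd z" using x(2) touching_mle[OF g z] by simp
      have "snd z < mle \<beta> R \<omega> y" if "y \<in> cell m (idx z)" "y \<noteq> fst z" for y
        using B[OF z that(1)] that(2) by force
      then show "valley m (idx z) \<omega>"
        unfolding valley_def c using A[OF z] by (auto simp: cell_def)
    qed
    have "bij_betw idx (touching \<omega>) {i. i < 2 ^ m \<and> valley m i \<omega>}"
    proof (rule bij_betw_imageI)
      show "inj_on idx (touching \<omega>)"
      proof (rule inj_onI)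
        fix z z' assume z: "z \<in> touching \<omega>" "z' \<in> touching \<omega>" "idx z = idx z'"
        have "snd z' = snd z" using C(1)[OF z(1)] C(1)[OF z(2)] z(3) by simp
        moreover have "fst z' = fst z"
          using B[OF z(1), of "fst z'"] A[OF z(2)] z(3) touching_mle[OF g z(2)] calculation by (simp add: cell_def)
        ultimately show "z = z'" by (simp add: prod_eq_iff)
      qed
      show "idx ` touching \<omega> = {i. i < 2 ^ m \<and> valley m i \<omega>}"
      proof (intro equalityI subsetI)
        fix i assume "i \<in> idx ` touching \<omega>"
        then show "i \<in> {i. i < 2 ^ m \<and> valley m i \<omega>}" using A C(2) by auto
      next
        fix i assume i: "i \<in> {i. i < 2 ^ m \<and> valley m i \<omega>}"
        obtain x where x: "x \<in> cell m i" "mle \<beta> R \<omega> x = cell_min m i \<omega>"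
          "\<And>y. y \<in> cell m i \<Longrightarrow> cell_min m i \<omega> \<le> mle \<beta> R \<omega> y"
          using cell_min[OF g] by blast
        have "x \<noteq> real i / 2 ^ m" "x \<noteq> real (Suc i) / 2 ^ m" using i x(2) by (auto simp: valley_def)
        then have xi: "real i / 2 ^ m < x" "x < real (Suc i) / 2 ^ m" using x(1) by (auto simp: cell_def)
        obtain z where z: "z \<in> touching \<omega>" "fst z = x"
          using local_min_touching[OF g xi] x(2,3) by (auto simp: cell_def)
        have "real i < 2 ^ m * x" "2 ^ m * x < real i + 1" using xi by (auto simp: field_simps)
        then have "\<lfloor>2 ^ m * x\<rfloor> = int i" by (simp add: floor_eq_iff)
        then have "idx z = i" by (simp add: idx_def z)
        then show "i \<in> idx ` touching \<omega>" using z by auto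
      qed
    qed
    then have "(\<Sum>z\<in>touching \<omega>. f (cell_min m (idx z) \<omega>)) = (\<Sum>i\<in>{i. i < 2 ^ m \<and> valley m i \<omega>}. f (cell_min m i \<omega>))"
      by (rule sum.reindex_bij_betw)
    moreover have "(\<Sum>z\<in>touching \<omega>. f (cell_min m (idx z) \<omega>)) = (\<Sum>z\<in>touching \<omega>. f (snd z))"
      using C(1) by (intro sum.cong) auto
    moreover have "valley_sum f m \<omega> = (\<Sum>i\<in>{i. i < 2 ^ m \<and> valley m i \<omega>}. f (cell_min m i \<omega>))"
    proof -
      have "{i. i < 2 ^ m \<and> valley m i \<omega>} = {i \<in> {..<2 ^ m}. valley m i \<omega>}" by auto
      then show ?thesis unfolding valley_sum_def by (simp only: sum.inter_filter[OF finite_lessThan])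
    qed
    ultimately show ?case by simp
  qed
qed

lemma valley_sum_measurable:
  assumes sp: "space N \<subseteq> configurations (space strip)"
    and m: "\<And>q t. {\<omega> \<in> space N. \<omega> \<inter> shadow (q, t) = {}} \<in> sets N"
    and f: "f \<in> borel_measurable borel"
  shows "valley_sum f k \<in> borel_measurable N"
proof -
  have mle: "(\<lambda>\<omega>. mle \<beta> R \<omega> x) \<in> borel_measurable N" if "0 \<le> x" "x \<le> 1" for x
    by (rule mle_measurable(2)[OF sp m]) (use that in auto)
  have bd: "0 \<le> real i / 2 ^ k" "real i / 2 ^ k \<le> 1" "0 \<le> real (Suc i) / 2 ^ k" "real (Suc i) / 2 ^ k \<le> 1" if "i < 2 ^ k" for i
  proof -
    have "Suc i \<le> 2 ^ k" using that by simp
    then have "real (Suc i) \<le> 2 ^ k" by (metis of_nat_le_iff of_nat_numeral of_nat_power)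
    then show "0 \<le> real i / 2 ^ k" "real i / 2 ^ k \<le> 1" "0 \<le> real (Suc i) / 2 ^ k" "real (Suc i) / 2 ^ k \<le> 1"
      using of_nat_Suc[of i] by (simp_all add: divide_le_eq del: of_nat_Suc)
  qed
  have c: "cell_min k i \<in> borel_measurable N" if "i < 2 ^ k" for i
    unfolding cell_min_def [abs_def]
  proof (intro borel_measurable_real_of_ereal borel_measurable_INF)
    show "countable (\<rat> \<inter> cell k i)" by (rule countable_subset[OF _ countable_rat]) auto
    fix q assume "q \<in> \<rat> \<inter> cell k i"
    then have "real i / 2 ^ k \<le> q" "q \<le> real (Suc i) / 2 ^ k" by (auto simp: cell_def)
    then have "0 \<le> q" "q \<le> 1" using bd[OF that] by linarith+
    then show "(\<lambda>\<omega>. ereal (mle \<beta> R \<omega> q)) \<in> borel_measurable N"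
      by (intro borel_measurable_ereal mle)
  qed
  have v: "Measurable.pred N (valley k i)" if "i < 2 ^ k" for i
    unfolding valley_def [abs_def] pred_def
    using c[OF that] mle[OF bd(1,2)[OF that]] mle[OF bd(3,4)[OF that]]
    by (intro sets.sets_Collect_conj borel_measurable_less)
  show ?thesis
    unfolding valley_sum_def [abs_def]
  proof (intro borel_measurable_sum measurable_If)
    fix i assume "i \<in> {..<2 ^ k :: nat}"
    then have i: "i < 2 ^ k" by simp
    show "(\<lambda>\<omega>. f (cell_min k i \<omega>)) \<in> borel_measurable N" by (rule measurable_compose[OF c[OF i] f])
    show "{\<omega> \<in> space N. valley k i \<omega>} \<in> sets N" using v[OF i] by (simp add: pred_def)
  qed simp
qed

lemma infsum_touching:
  fixes f :: "real \<Rightarrow> real"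
  assumes "good \<omega>"
  shows "(\<Sum>\<^sub>\<infinity>(X, Y)\<in>\<omega>. f Y * of_bool (mle \<beta> R \<omega> X \<ge> Y)) = (\<Sum>z\<in>touching \<omega>. f (snd z))"
proof -
  have "(\<Sum>\<^sub>\<infinity>z\<in>\<omega>. case z of (X, Y) \<Rightarrow> f Y * of_bool (mle \<beta> R \<omega> X \<ge> Y)) = (\<Sum>\<^sub>\<infinity>z\<in>touching \<omega>. f (snd z))"
    by (rule infsum_cong_neutral) (auto simp: touching_def)
  then show ?thesis using finite_touching[OF assms] by simp
qed

end

section \<open>The support boundary model\<close>

lemma fst_strip: "fst \<in> borel_measurable strip" and snd_strip: "snd \<in> borel_measurable strip"
  by (intro measurable_strip_borel borel_measurable_continuous_onI continuous_intros)+

lemma fst_strip_unit: "fst \<in> strip \<rightarrow>\<^sub>M restrict_space borel {0..1}"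
  by (rule measurable_restrict_space2[OF _ fst_strip]) (auto simp: space_strip)

lemma open_strip: "open U \<Longrightarrow> U \<inter> space strip \<in> sets strip"
  using strip_closed by (auto simp: sets_strip_iff space_strip intro!: sets.Int)

lemma nn_integral_strip:
  assumes h: "h \<in> borel_measurable strip"
  shows "(\<integral>\<^sup>+z. h z \<partial>strip) = (\<integral>\<^sup>+x\<in>{0..1}. (\<integral>\<^sup>+y. h (x, y) \<partial>lborel) \<partial>lborel)"
    and "(\<lambda>x. (\<integral>\<^sup>+y. h (x, y) \<partial>lborel) * indicator {0..1} x) \<in> borel_measurable lborel"
proof -
  let ?S = "{0..1} \<times> UNIV :: (real \<times> real) set"
  have S: "?S \<inter> space lborel \<in> sets lborel" using strip_closed by simp
  have m: "(\<lambda>z. h z * indicator ?S z) \<in> borel_measurable (lborel \<Otimes>\<^sub>M lborel)"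
    using h unfolding strip_def borel_measurable_restrict_space_iff_ennreal[OF S] by (simp add: lborel_prod)
  have inner: "(\<integral>\<^sup>+y. h (x, y) * indicator ?S (x, y) \<partial>lborel) = (\<integral>\<^sup>+y. h (x, y) \<partial>lborel) * indicator {0..1} x" for x
    by (auto split: split_indicator)
  have "(\<integral>\<^sup>+z. h z \<partial>strip) = (\<integral>\<^sup>+z. h z * indicator ?S z \<partial>(lborel \<Otimes>\<^sub>M lborel))"
    unfolding strip_def using S by (subst nn_integral_restrict_space) (auto simp: lborel_prod)
  also have "\<dots> = (\<integral>\<^sup>+x. \<integral>\<^sup>+y. h (x, y) * indicator ?S (x, y) \<partial>lborel \<partial>lborel)"
    by (rule lborel.nn_integral_fst[OF m, symmetric])
  finally show "(\<integral>\<^sup>+z. h z \<partial>strip) = (\<integral>\<^sup>+x\<in>{0..1}. (\<integral>\<^sup>+y. h (x, y) \<partial>lborel) \<partial>lborel)"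
    by (simp only: inner)
  show "(\<lambda>x. (\<integral>\<^sup>+y. h (x, y) \<partial>lborel) * indicator {0..1} x) \<in> borel_measurable lborel"
    unfolding inner[symmetric] by (rule lborel.borel_measurable_nn_integral_fst[OF m])
qed

lemma emeasure_lborel_atLeast: "emeasure lborel {a::real..} = \<infinity>"
proof -
  have "of_nat k \<le> emeasure lborel {a..}" for k :: nat
  proof -
    have "of_nat k = emeasure lborel {a..a + real k}" by (simp add: ennreal_of_nat_eq_real_of_nat)
    also have "\<dots> \<le> emeasure lborel {a..}" by (intro emeasure_mono) auto
    finally show ?thesis .
  qed
  then show ?thesis using ennreal_Ex_less_of_nat[of "emeasure lborel {a..}"]
    by (metis infinity_ennreal_def leD top.not_eq_extremum)
qed

context holder
begin

lemma \<kappa>_continuous_on [continuous_intros]: "continuous_on S f \<Longrightarrow> continuous_on S (\<lambda>x. \<kappa> (f x))"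
  using continuous_on_compose2[OF \<kappa>_continuous] by blast

lemma holder_ball_iff: "g \<in> holder_ball \<beta> R \<longleftrightarrow> (\<forall>x\<in>{0..1}. \<forall>y\<in>{0..1}. g x \<le> g y + \<kappa> (x - y))"
proof -
  have "(\<forall>x\<in>{0..1}. \<forall>y\<in>{0..1}. \<bar>g x - g y\<bar> \<le> \<kappa> (x - y)) \<longleftrightarrow> (\<forall>x\<in>{0..1}. \<forall>y\<in>{0..1}. g x \<le> g y + \<kappa> (x - y))"
  proof (intro iffI ballI)
    fix x y :: real assume *: "\<forall>x\<in>{0..1}. \<forall>y\<in>{0..1}. g x \<le> g y + \<kappa> (x - y)" and xy: "x \<in> {0..1}" "y \<in> {0..1}"
    then have "g x \<le> g y + \<kappa> (x - y)" "g y \<le> g x + \<kappa> (y - x)" by blast+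
    then show "\<bar>g x - g y\<bar> \<le> \<kappa> (x - y)" using \<kappa>_minus[of x y] by linarith
  next
    fix x y :: real assume *: "\<forall>x\<in>{0..1}. \<forall>y\<in>{0..1}. \<bar>g x - g y\<bar> \<le> \<kappa> (x - y)" and xy: "x \<in> {0..1}" "y \<in> {0..1}"
    then have "\<bar>g x - g y\<bar> \<le> \<kappa> (x - y)" by blast
    then show "g x \<le> g y + \<kappa> (x - y)" by linarith
  qed
  then show ?thesis by (simp add: holder_ball_def \<kappa>_def)
qed

lemma holder_ball_max:
  assumes "g \<in> holder_ball \<beta> R" "h \<in> holder_ball \<beta> R"
  shows "(\<lambda>x. max (g x) (h x)) \<in> holder_ball \<beta> R"
  using assms unfolding holder_ball_iff by (simp add: max_def) (smt (verit))

text \<open>Within the strip the shadow of \<open>(q, t)\<close> is the region below this curve, see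
  \<open>void_shadow\<close>. Lower bounds on values of the estimator are thus void events of curves
  in the ball.\<close>

lemma holder_ball_reflected_cusp: "(\<lambda>x. t - \<kappa> (q - x)) \<in> holder_ball \<beta> R"
  unfolding holder_ball_iff
proof (intro ballI)
  fix x y
  show "t - \<kappa> (q - x) \<le> t - \<kappa> (q - y) + \<kappa> (x - y)" using \<kappa>_triangle[of q y x] by simp
qed

lemma holder_ball_bounds:
  assumes "g \<in> holder_ball \<beta> R" "x \<in> {0..1}"
  shows "g 0 - R \<le> g x" "g x \<le> g 0 + R"
proof -
  have "\<kappa> x \<le> R" "\<kappa> (0 - x) \<le> R" using assms(2) by (auto intro!: \<kappa>_bound)
  moreover have "g x \<le> g 0 + \<kappa> (x - 0)" "g 0 \<le> g x + \<kappa> (0 - x)"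
    by (rule assms(1)[unfolded holder_ball_iff, rule_format]; use assms(2) in simp)+
  ultimately show "g 0 - R \<le> g x" "g x \<le> g 0 + R" by auto
qed

lemma holder_ball_continuous:
  assumes "g \<in> holder_ball \<beta> R"
  shows "continuous_on {0..1} g"
  unfolding continuous_on_iff
proof (intro ballI allI impI)
  fix x e :: real assume x: "x \<in> {0..1}" and "0 < e"
  obtain d where d: "0 < d" "\<And>a. \<bar>a\<bar> < d \<Longrightarrow> \<kappa> a < e" using \<open>0 < e\<close> by (rule \<kappa>_small) blast
  show "\<exists>d>0. \<forall>x'\<in>{0..1}. dist x' x < d \<longrightarrow> dist (g x') (g x) < e"
  proof (intro exI conjI ballI impI)
    fix x' :: real assume x': "x' \<in> {0..1}" and "dist x' x < d"
    then have "\<kappa> (x' - x) < e" using d by (simp add: dist_real_def)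
    moreover have "g x' \<le> g x + \<kappa> (x' - x)" "g x \<le> g x' + \<kappa> (x - x')"
      using assms x x' unfolding holder_ball_iff by auto
    ultimately show "dist (g x') (g x) < e" using \<kappa>_minus[of x x'] by (simp add: dist_real_def abs_less_iff)
  qed (rule d(1))
qed

lemma holder_ball_measurable:
  assumes "g \<in> holder_ball \<beta> R"
  shows "(\<lambda>z. g (fst z)) \<in> borel_measurable strip"
  by (rule measurable_compose[OF fst_strip_unit])
    (rule borel_measurable_continuous_on_restrict[OF holder_ball_continuous[OF assms]])

definition subgraph :: "(real \<Rightarrow> real) \<Rightarrow> (real \<times> real) set" where
  "subgraph g = {z \<in> space strip. snd z < g (fst z)}"

lemma subgraph_sets: "g \<in> holder_ball \<beta> R \<Longrightarrow> subgraph g \<in> sets strip"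
  unfolding subgraph_def by (intro borel_measurable_less snd_strip holder_ball_measurable)

end

section \<open>The Poisson process above a curve\<close>

locale boundary_model = holder +
  fixes n :: nat and g :: "real \<Rightarrow> real" and P :: "(real \<times> real) set measure"
  assumes n: "0 < n" and g: "g \<in> holder_ball \<beta> R" and process: "poisson_process (boundary_intensity n g) P"
begin

abbreviation "\<mu> \<equiv> boundary_intensity n g"

definition dens :: "real \<times> real \<Rightarrow> real" where
  "dens z = real n * indicator {g (fst z)..} (snd z)"

lemma dens_measurable: "dens \<in> borel_measurable strip"
proof -
  have "{z \<in> space strip. g (fst z) \<le> snd z} \<in> sets strip"
    by (intro borel_measurable_le snd_strip holder_ball_measurable g)
  then have "(\<lambda>z. if g (fst z) \<le> snd z then real n else 0) \<in> borel_measurable strip"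
    by (intro measurable_If) auto
  also have "(\<lambda>z. if g (fst z) \<le> snd z then real n else 0) = dens"
    by (auto simp: dens_def fun_eq_iff)
  finally show ?thesis .
qed

lemma dens_nonneg: "0 \<le> dens z" by (simp add: dens_def)

lemma intensity_eq: "\<mu> = density strip (\<lambda>z. ennreal (dens z))"
  by (simp add: boundary_intensity_def dens_def split_beta')

lemma space_intensity: "space \<mu> = space strip" and sets_intensity [measurable_cong]: "sets \<mu> = sets strip"
  by (simp_all add: boundary_intensity_def)

lemma measurable_intensity: "measurable \<mu> N = measurable strip N"
  by (rule measurable_cong_sets) (simp_all add: sets_intensity)

lemma config_space_intensity: "config_space \<mu> = config_space strip"
  by (rule config_space_cong) (simp_all add: space_intensity sets_intensity)

lemma void_intensity: "void \<mu> A = void strip A"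
  by (simp add: void_def space_intensity)

lemma nn_integral_intensity:
  assumes h: "h \<in> borel_measurable strip"
  shows "(\<integral>\<^sup>+z. h z \<partial>\<mu>) = (\<integral>\<^sup>+z. ennreal (dens z) * h z \<partial>strip)"
  unfolding intensity_eq using dens_measurable h by (intro nn_integral_density) auto

lemma emeasure_intensity:
  assumes "A \<in> sets strip"
  shows "emeasure \<mu> A = (\<integral>\<^sup>+z. ennreal (dens z) * indicator A z \<partial>strip)"
  unfolding intensity_eq using assms dens_measurable by (intro emeasure_density) auto

lemma emeasure_intensity_le:
  assumes A: "A \<in> sets strip"
  shows "emeasure \<mu> A \<le> of_nat n * emeasure lborel A"
proof -
  have "emeasure \<mu> A \<le> (\<integral>\<^sup>+z. of_nat n * indicator A z \<partial>strip)"
    unfolding emeasure_intensity[OF A]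
    by (intro nn_integral_mono mult_right_mono) (auto simp: dens_def ennreal_of_nat_eq_real_of_nat split: split_indicator)
  also have "\<dots> = of_nat n * emeasure strip A" using A by (rule nn_integral_cmult_indicator)
  also have "emeasure strip A = emeasure lborel A"
    using A strip_closed unfolding strip_def by (intro emeasure_restrict_space) (auto simp: sets_strip_iff[unfolded strip_def])
  finally show ?thesis .
qed

lemma null_intensity: "A \<in> sets strip \<Longrightarrow> emeasure lborel A = 0 \<Longrightarrow> emeasure \<mu> A = 0"
  using emeasure_intensity_le[of A] by simp

sublocale poisson_model \<mu> P
proof
  show "poisson_process \<mu> P" by (rule process)
  show "U \<inter> space \<mu> \<in> sets \<mu>" if "open U" for U
    using open_strip[OF that] by (simp add: space_intensity sets_intensity)
  show "emeasure \<mu> B < \<infinity>" if "bounded B" "B \<in> sets \<mu>" for B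
  proof -
    have "emeasure lborel B < \<infinity>" using that(1) by (rule emeasure_bounded_finite)
    then have "of_nat n * emeasure lborel B < \<infinity>" by (simp add: ennreal_mult_less_top of_nat_less_top)
    then show ?thesis using emeasure_intensity_le[of B] that(2) by (simp add: sets_intensity le_less_trans)
  qed
  show "emeasure \<mu> {z} = 0" if "z \<in> space \<mu>" for z
    using that by (intro null_intensity) (auto simp: sets_strip_iff space_intensity space_strip)
qed

sublocale poisson_shadow \<mu> P shadow
proof
  have c: "continuous_on UNIV (\<lambda>q :: (real \<times> real) \<times> (real \<times> real). cusp (snd q) (fst (fst q)) - snd (fst q))"
    unfolding cusp_def
    by (intro continuous_intros)
  have "(\<lambda>q. q) \<in> \<mu> \<Otimes>\<^sub>M \<mu> \<rightarrow>\<^sub>M (borel \<Otimes>\<^sub>M borel :: ((real \<times> real) \<times> (real \<times> real)) measure)"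
  proof -
    have id: "(\<lambda>z. z) \<in> \<mu> \<rightarrow>\<^sub>M (borel :: (real \<times> real) measure)"
      unfolding measurable_intensity strip_def by (rule measurable_restrict_space1) simp
    have "(\<lambda>q. (fst q, snd q)) \<in> \<mu> \<Otimes>\<^sub>M \<mu> \<rightarrow>\<^sub>M (borel \<Otimes>\<^sub>M borel :: ((real \<times> real) \<times> (real \<times> real)) measure)"
      by (intro measurable_Pair measurable_compose[OF measurable_fst id] measurable_compose[OF measurable_snd id])
    then show ?thesis by simp
  qed
  then have "(\<lambda>q. q) \<in> \<mu> \<Otimes>\<^sub>M \<mu> \<rightarrow>\<^sub>M borel" by (simp only: borel_prod)
  from measurable_compose[OF this borel_measurable_continuous_onI[OF c]]
  have "{q \<in> space (\<mu> \<Otimes>\<^sub>M \<mu>). cusp (snd q) (fst (fst q)) - snd (fst q) < 0} \<in> sets (\<mu> \<Otimes>\<^sub>M \<mu>)"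
    by (intro borel_measurable_less borel_measurable_const)
  then show "Measurable.pred (\<mu> \<Otimes>\<^sub>M \<mu>) (\<lambda>(z, z'). z' \<in> shadow z)"
    by (simp add: pred_def shadow_def split_beta')
  show "z \<notin> shadow z'" if "z' \<in> shadow z" for z z' using that by (rule shadow_asym)
qed

lemma space_P_strip: "space P = configurations (space strip)"
  by (simp add: space_P space_intensity)

lemma sets_P_strip: "sets P = sets (config_space strip)"
  by (simp add: sets_P config_space_intensity)

section \<open>Almost sure properties of the observed points\<close>

lemma subgraph_null: "emeasure \<mu> (subgraph g) = 0"
proof -
  have "emeasure \<mu> (subgraph g) = (\<integral>\<^sup>+z. 0 \<partial>strip)"
    unfolding emeasure_intensity[OF subgraph_sets[OF g]]
    by (intro nn_integral_cong) (auto simp: dens_def subgraph_def split: split_indicator)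
  then show ?thesis by simp
qed

lemma AE_above: "AE \<omega> in P. \<omega> \<inter> subgraph g = {}"
  using subgraph_sets[OF g] subgraph_null by (intro AE_void_null) (simp_all add: sets_intensity)

lemma intensity_infinite: "emeasure \<mu> (space strip) = \<infinity>"
proof -
  have "emeasure \<mu> (space strip) = (\<integral>\<^sup>+z. ennreal (dens z) * indicator (space strip) z \<partial>strip)"
    by (rule emeasure_intensity) simp
  also have "\<dots> = (\<integral>\<^sup>+z. ennreal (dens z) \<partial>strip)"
    by (intro nn_integral_cong) auto
  also have "\<dots> = (\<integral>\<^sup>+x\<in>{0..1}. (\<integral>\<^sup>+y. ennreal (dens (x, y)) \<partial>lborel) \<partial>lborel)"
    using dens_measurable by (intro nn_integral_strip) auto
  also have "\<dots> = (\<integral>\<^sup>+x. \<infinity> * indicator {0..1::real} x \<partial>lborel)"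
  proof (rule nn_integral_cong, goal_cases)
    case (1 x)
    have "(\<integral>\<^sup>+y. ennreal (dens (x, y)) \<partial>lborel) = (\<integral>\<^sup>+y. of_nat n * indicator {g x..} y \<partial>lborel)"
      by (intro nn_integral_cong) (auto simp: dens_def ennreal_of_nat_eq_real_of_nat split: split_indicator)
    also have "\<dots> = of_nat n * emeasure lborel {g x..}" by (rule nn_integral_cmult_indicator) simp
    also have "\<dots> = \<infinity>" using n by (simp add: emeasure_lborel_atLeast ennreal_mult_top)
    finally show ?case by simp
  qed
  also have "\<dots> = \<infinity> * emeasure lborel {0..1::real}" by (rule nn_integral_cmult_indicator) simp
  finally show ?thesis by simp
qed

text \<open>The total intensity is infinite, so the configuration is almost surely nonempty. Its
  points lie above the curve, which is bounded below on the unit interval.\<close>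

lemma AE_good: "AE \<omega> in P. good \<omega> \<and> \<omega> \<inter> subgraph g = {}"
proof -
  have "prob (void \<mu> (space strip)) = 0"
    using prob_void[of "space strip"] intensity_infinite by (simp add: sets_intensity)
  then have "AE \<omega> in P. \<omega> \<notin> void \<mu> (space strip)"
    by (subst (asm) prob_eq_0) (simp_all add: sets_P sets_intensity void_in_sets)
  then show ?thesis using AE_above AE_space
  proof eventually_elim
    case (elim \<omega>)
    have sub: "\<omega> \<subseteq> space strip" using elim(3) by (simp add: space_P_strip configurations_subset)
    have "\<omega> \<noteq> {}" using elim(1,3) by (auto simp: void_def space_P)
    moreover have "g 0 - R \<le> snd z" if z: "z \<in> \<omega>" for z
    proof -
      have "z \<in> space strip" using z sub by auto
      moreover from this have "fst z \<in> {0..1}" by (auto simp: space_strip)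
      ultimately show ?thesis using elim(2) z holder_ball_bounds(1)[OF g, of "fst z"] by (force simp: subgraph_def)
    qed
    ultimately show ?case using elim(2,3) unfolding good_def space_P_strip by blast
  qed
qed

text \<open>A cusp whose apex is not below \<open>g\<close> stays above \<open>g\<close> on the unit
  interval, because \<open>g\<close> is in the ball.\<close>

lemma mle_above:
  assumes "good \<omega>" "\<omega> \<inter> subgraph g = {}" "x \<in> {0..1}"
  shows "g x \<le> mle \<beta> R \<omega> x"
proof -
  obtain z where z: "z \<in> \<omega>" "mle \<beta> R \<omega> x = cusp z x" using good_mle(2)[OF assms(1)] by blast
  have "fst z \<in> {0..1}" by (rule good_fst[OF assms(1) z(1)])
  moreover have "z \<in> space strip" using assms(1) z(1) configurations_subset by (auto simp: good_def)
  then have "g (fst z) \<le> snd z" using assms(2) z(1) by (force simp: subgraph_def)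
  ultimately show ?thesis using g assms(3) z(2) unfolding holder_ball_iff cusp_def by force
qed

lemma null_vertical: "emeasure lborel ({x} \<times> (UNIV :: real set)) = 0" for x :: real
proof -
  have "emeasure lborel ({x} \<times> (UNIV :: real set)) = emeasure (lborel \<Otimes>\<^sub>M lborel) ({x} \<times> (UNIV :: real set))"
    by (simp add: lborel_prod)
  also have "\<dots> = emeasure lborel {x} * emeasure lborel (UNIV :: real set)"
    by (rule lborel.emeasure_pair_measure_Times) auto
  finally show ?thesis by simp
qed

lemma AE_not_dyadic: "AE \<omega> in P. \<forall>z\<in>\<omega>. fst z \<notin> dyadics"
proof -
  have "countable dyadics" unfolding dyadics_def by simp
  moreover have "AE \<omega> in P. \<forall>z\<in>\<omega>. fst z \<noteq> x" for x
  proof (cases "x \<in> {0..1}")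
    case True
    have "{x} \<times> UNIV \<in> sets strip"
      using True by (auto simp: sets_strip_iff intro!: borel_closed closed_Times)
    then have "AE \<omega> in P. \<omega> \<inter> ({x} \<times> UNIV) = {}"
      by (intro AE_void_null null_intensity null_vertical) (simp_all add: sets_intensity)
    then show ?thesis by eventually_elim auto
  next
    case False
    have "\<omega> \<in> space P \<Longrightarrow> \<forall>z\<in>\<omega>. fst z \<noteq> x" for \<omega>
      using False by (auto simp: space_P_strip configurations_def space_strip)
    then show ?thesis by (intro AE_I2)
  qed
  ultimately have "AE \<omega> in P. \<forall>x\<in>dyadics. \<forall>z\<in>\<omega>. fst z \<noteq> x" by (simp add: AE_ball_countable)
  then show ?thesis by eventually_elim blast
qed

text \<open>By Mecke's formula the expected number of ties is the integral over \<open>z\<close> of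
  the expected number of points tied with \<open>z\<close>. For fixed \<open>z\<close> these points
  lie on a reflected cusp, a graph that meets each vertical line once and is therefore null.\<close>

lemma AE_no_ties: "AE \<omega> in P. \<forall>z\<in>\<omega>. \<forall>z'\<in>\<omega>. z' \<noteq> z \<longrightarrow> cusp z' (fst z) \<noteq> snd z"
proof -
  define tie where "tie z = {z' \<in> space strip. z' \<noteq> z \<and> cusp z' (fst z) = snd z}" for z
  have closed: "closed {q :: (real \<times> real) \<times> (real \<times> real). cusp (snd q) (fst (fst q)) = snd (fst q)}"
    unfolding cusp_def
    by (intro closed_Collect_eq continuous_intros)
  have idm: "(\<lambda>z. z) \<in> \<mu> \<rightarrow>\<^sub>M (borel :: (real \<times> real) measure)"
    unfolding measurable_intensity strip_def by (rule measurable_restrict_space1) simp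
  have tie_m: "{q \<in> space ((P \<Otimes>\<^sub>M \<mu>) \<Otimes>\<^sub>M \<mu>). snd q \<in> tie (snd (fst q))} \<in> sets ((P \<Otimes>\<^sub>M \<mu>) \<Otimes>\<^sub>M \<mu>)"
  proof -
    have "(\<lambda>q. (snd (fst q), snd q)) \<in> (P \<Otimes>\<^sub>M \<mu>) \<Otimes>\<^sub>M \<mu> \<rightarrow>\<^sub>M (borel \<Otimes>\<^sub>M borel :: ((real \<times> real) \<times> (real \<times> real)) measure)"
      by (intro measurable_Pair measurable_compose[OF measurable_compose[OF measurable_fst measurable_snd] idm]
        measurable_compose[OF measurable_snd idm])
    then have m: "(\<lambda>q. (snd (fst q), snd q)) \<in> (P \<Otimes>\<^sub>M \<mu>) \<Otimes>\<^sub>M \<mu> \<rightarrow>\<^sub>M borel" by (simp only: borel_prod)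
    have "{q. cusp (snd q) (fst (fst q)) = snd (fst q)} - {q :: (real \<times> real) \<times> (real \<times> real). snd q = fst q} \<in> sets borel"
      by (intro sets.Diff borel_closed closed closed_Collect_eq continuous_intros)
    from measurable_sets[OF m this]
    have "(\<lambda>q. (snd (fst q), snd q)) -` ({q. cusp (snd q) (fst (fst q)) = snd (fst q)} - {q. snd q = fst q})
      \<inter> space ((P \<Otimes>\<^sub>M \<mu>) \<Otimes>\<^sub>M \<mu>) \<in> sets ((P \<Otimes>\<^sub>M \<mu>) \<Otimes>\<^sub>M \<mu>)" .
    also have "(\<lambda>q. (snd (fst q), snd q)) -` ({q. cusp (snd q) (fst (fst q)) = snd (fst q)} - {q. snd q = fst q})
      \<inter> space ((P \<Otimes>\<^sub>M \<mu>) \<Otimes>\<^sub>M \<mu>) = {q \<in> space ((P \<Otimes>\<^sub>M \<mu>) \<Otimes>\<^sub>M \<mu>). snd q \<in> tie (snd (fst q))}"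
      by (auto simp: tie_def space_pair_measure space_intensity)
    finally show ?thesis .
  qed
  define h where "h \<omega> z = (\<integral>\<^sup>+z'. (if z' \<in> tie z then 1 else 0) \<partial>count_space \<omega>)" for \<omega> z
  have h0: "h \<omega> z = 0 \<longleftrightarrow> \<omega> \<inter> tie z = {}" for \<omega> z
    unfolding h_def by (subst nn_integral_0_iff_AE) (auto simp: AE_count_space)
  have hm: "(\<lambda>(\<omega>, z). h \<omega> z) \<in> borel_measurable (P \<Otimes>\<^sub>M \<mu>)"
  proof -
    have "(\<lambda>q. if snd q \<in> tie (snd (fst q)) then 1 else 0 :: ennreal) \<in> borel_measurable ((P \<Otimes>\<^sub>M \<mu>) \<Otimes>\<^sub>M \<mu>)"
      using tie_m by (intro measurable_If borel_measurable_const)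
    then have "(\<lambda>p. \<integral>\<^sup>+z'. (if z' \<in> tie (snd p) then 1 else 0) \<partial>count_space (fst p)) \<in> borel_measurable (P \<Otimes>\<^sub>M \<mu>)"
      by (intro measurable_sum_points measurable_fst) (simp add: split_beta')
    then show ?thesis by (simp add: h_def split_beta')
  qed
  have null: "AE \<omega> in P. h (insert z \<omega>) z = 0" if z: "z \<in> space \<mu>" for z
  proof -
    have t: "tie z \<in> sets strip"
    proof -
      have "{z'. cusp z' (fst z) = snd z} \<in> sets borel"
        unfolding cusp_def
        by (intro borel_closed closed_Collect_eq continuous_intros)
      then have "({0..1} \<times> UNIV) \<inter> ({z'. cusp z' (fst z) = snd z} - {z}) \<in> sets borel"
        using strip_closed by (intro sets.Int sets.Diff) auto
      moreover have "tie z = ({0..1} \<times> UNIV) \<inter> ({z'. cusp z' (fst z) = snd z} - {z})"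
        by (auto simp: tie_def space_strip)
      ultimately show ?thesis by (auto simp: sets_strip_iff)
    qed
    have "emeasure \<mu> (tie z) \<le> (\<integral>\<^sup>+x\<in>{0..1}. (\<integral>\<^sup>+y. of_nat n * indicator {snd z - \<kappa> (fst z - x)} y \<partial>lborel) \<partial>lborel)"
    proof -
      have "emeasure \<mu> (tie z) = (\<integral>\<^sup>+x\<in>{0..1}. (\<integral>\<^sup>+y. ennreal (dens (x, y)) * indicator (tie z) (x, y) \<partial>lborel) \<partial>lborel)"
        unfolding emeasure_intensity[OF t] using dens_measurable t by (intro nn_integral_strip) auto
      also have "\<dots> \<le> (\<integral>\<^sup>+x\<in>{0..1}. (\<integral>\<^sup>+y. of_nat n * indicator {snd z - \<kappa> (fst z - x)} y \<partial>lborel) \<partial>lborel)"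
        by (intro nn_integral_mono mult_right_mono)
          (auto simp: dens_def tie_def cusp_def ennreal_of_nat_eq_real_of_nat split: split_indicator)
      finally show ?thesis .
    qed
    also have "\<dots> = 0" by (simp add: nn_integral_cmult)
    finally have "emeasure \<mu> (tie z) = 0" by simp
    then have "AE \<omega> in P. \<omega> \<inter> tie z = {}" using t by (intro AE_void_null) (simp_all add: sets_intensity)
    then show ?thesis
    proof eventually_elim
      case (elim \<omega>)
      \<comment> \<open>The condition \<open>z' \<noteq> z\<close> in \<open>tie\<close> matters
        here, as the inserted point lies on its own cusp.\<close>
      have "z \<notin> tie z" by (simp add: tie_def)
      then show ?case using elim by (simp add: h0)
    qed
  qed
  have "(\<integral>\<^sup>+\<omega>. \<integral>\<^sup>+z. h \<omega> z \<partial>count_space \<omega> \<partial>P) = (\<integral>\<^sup>+z. \<integral>\<^sup>+\<omega>. h (insert z \<omega>) z \<partial>P \<partial>\<mu>)"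
    by (rule mecke_iterated[OF hm])
  also have "\<dots> = (\<integral>\<^sup>+z. 0 \<partial>\<mu>)"
  proof (rule nn_integral_cong)
    fix z assume "z \<in> space \<mu>"
    from null[OF this] have "(\<integral>\<^sup>+\<omega>. h (insert z \<omega>) z \<partial>P) = (\<integral>\<^sup>+\<omega>. 0 \<partial>P)" by (rule nn_integral_cong_AE)
    then show "(\<integral>\<^sup>+\<omega>. h (insert z \<omega>) z \<partial>P) = 0" by simp
  qed
  finally have "(\<integral>\<^sup>+\<omega>. \<integral>\<^sup>+z. h \<omega> z \<partial>count_space \<omega> \<partial>P) = 0" by simp
  moreover have "(\<lambda>\<omega>. \<integral>\<^sup>+z. h \<omega> z \<partial>count_space \<omega>) \<in> borel_measurable P"
    by (rule measurable_sum_points[OF hm]) simp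
  ultimately have "AE \<omega> in P. (\<integral>\<^sup>+z. h \<omega> z \<partial>count_space \<omega>) = 0"
    by (simp add: nn_integral_0_iff_AE)
  then show ?thesis using AE_space
  proof eventually_elim
    case (elim \<omega>)
    then have "\<forall>z\<in>\<omega>. h \<omega> z = 0" by (subst (asm) nn_integral_0_iff_AE) (auto simp: AE_count_space)
    moreover have "\<omega> \<subseteq> space strip" using elim(2) by (simp add: space_P_strip configurations_subset)
    ultimately show ?case unfolding h0 tie_def by blast
  qed
qed

lemma AE_simple: "AE \<omega> in P. simple \<omega>"
  using AE_good AE_not_dyadic AE_no_ties by eventually_elim (simp add: simple_def)

end

section \<open>Bias and variance of the estimator\<close>

lemma weak_derivative_measurable:
  assumes "weak_derivative \<Phi> \<Phi>'"
  shows "\<Phi>' \<in> borel_measurable borel"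
proof (rule borel_measurable_LIMSEQ_real)
  show "(\<lambda>x. indicator {- real k..real k} x *\<^sub>R \<Phi>' x) \<in> borel_measurable borel" for k
  proof -
    have "integrable lborel (\<lambda>x. indicator {- real k..real k} x *\<^sub>R \<Phi>' x)"
      using assms unfolding weak_derivative_def set_integrable_def by blast
    then have "(\<lambda>x. indicator {- real k..real k} x *\<^sub>R \<Phi>' x) \<in> borel_measurable lborel"
      by (rule borel_measurable_integrable)
    moreover have "borel_measurable lborel = (borel_measurable borel :: (real \<Rightarrow> real) set)"
      by (rule measurable_cong_sets) simp_all
    ultimately show ?thesis by (simp only:)
  qed
  show "(\<lambda>k. indicator {- real k..real k} x *\<^sub>R \<Phi>' x) \<longlonglongrightarrow> \<Phi>' x" for x
  proof (rule tendsto_eventually)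
    obtain m :: nat where m: "\<bar>x\<bar> \<le> real m" using real_arch_simple by blast
    show "\<forall>\<^sub>F k in sequentially. indicator {- real k..real k} x *\<^sub>R \<Phi>' x = \<Phi>' x"
      by (rule eventually_sequentiallyI[of m]) (use m in \<open>auto simp: indicator_def abs_le_iff\<close>)
  qed
qed

lemma weak_derivative_diff:
  assumes w: "weak_derivative \<Phi> \<Phi>'" and ab: "a \<le> b"
  shows "\<Phi> b - \<Phi> a = (LBINT y:{a..b}. \<Phi>' y)"
proof -
  \<comment> \<open>The weak derivative is integrated from 0, so additivity is used on an interval
    that contains 0 as well as \<open>a\<close> and \<open>b\<close>.\<close>
  let ?l = "min 0 (min a b)" and ?r = "max 0 (max a b)"
  have int: "interval_lebesgue_integrable lborel (ereal l) (ereal r) \<Phi>'" if "l \<le> r" for l r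
  proof -
    have "set_integrable lborel {l..r} \<Phi>'" using w by (simp add: weak_derivative_def)
    then have "set_integrable lborel (einterval (ereal l) (ereal r)) \<Phi>'"
      by (rule set_integrable_subset) (auto simp: einterval_def)
    then show ?thesis using that by (simp add: interval_lebesgue_integrable_def)
  qed
  have "interval_lebesgue_integrable lborel (ereal ?l) (ereal ?r) \<Phi>'" by (rule int) auto
  then have "interval_lebesgue_integrable lborel (min (ereal 0) (min (ereal a) (ereal b))) (max (ereal 0) (max (ereal a) (ereal b))) \<Phi>'"
    by (simp only: min_def max_def ereal_less_eq) (auto split: if_splits)
  from interval_integral_sum[OF this]
  have "(LBINT v=ereal 0..ereal a. \<Phi>' v) + (LBINT v=ereal a..ereal b. \<Phi>' v) = (LBINT v=ereal 0..ereal b. \<Phi>' v)" .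
  moreover have "\<Phi> a = \<Phi> 0 + (LBINT v=ereal 0..ereal a. \<Phi>' v)" "\<Phi> b = \<Phi> 0 + (LBINT v=ereal 0..ereal b. \<Phi>' v)"
    using w unfolding weak_derivative_def by blast+
  ultimately have "\<Phi> b - \<Phi> a = (LBINT v=ereal a..ereal b. \<Phi>' v)" by linarith
  also have "\<dots> = (LBINT y:{a..b}. \<Phi>' y)" using ab by (rule interval_integral_Icc)
  finally show ?thesis .
qed

lemma weak_derivative_continuous:
  assumes w: "weak_derivative \<Phi> \<Phi>'"
  shows "continuous_on UNIV \<Phi>"
proof -
  have "isCont \<Phi> x" for x
  proof -
    have si: "set_integrable lborel {a..b} \<Phi>'" for a b using w by (simp add: weak_derivative_def)
    have "continuous_on {x - 1..x + 1} (\<lambda>u. \<Phi> (x - 1) + integral {x - 1..u} \<Phi>')"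
      using set_borel_integral_eq_integral(1)[OF si]
      by (intro continuous_on_add continuous_on_const indefinite_integral_continuous_1)
    then have "continuous_on {x - 1..x + 1} \<Phi>"
    proof (rule continuous_on_cong[THEN iffD1, rotated 2])
      fix u assume "u \<in> {x - 1..x + 1}"
      then show "\<Phi> (x - 1) + integral {x - 1..u} \<Phi>' = \<Phi> u"
        using weak_derivative_diff[OF w, of "x - 1" u] set_borel_integral_eq_integral(2)[OF si, of "x - 1" u] by simp
    qed simp
    then have "continuous_on {x - 1<..<x + 1} \<Phi>" by (rule continuous_on_subset) auto
    then show ?thesis by (auto simp: continuous_on_eq_continuous_at)
  qed
  then show ?thesis by (simp add: continuous_at_imp_continuous_on)
qed

section \<open>Measurability of the estimator of the functional\<close>

context holder
begin

lemma void_shadow: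
  "{\<omega> \<in> configurations (space strip). \<omega> \<inter> shadow (q, t) = {}} = void strip (subgraph (\<lambda>x. t - \<kappa> (q - x)))"
proof -
  have "\<omega> \<inter> shadow (q, t) = \<omega> \<inter> subgraph (\<lambda>x. t - \<kappa> (q - x))" if "\<omega> \<in> configurations (space strip)" for \<omega>
    using configurations_subset[OF that] by (auto simp: shadow_def subgraph_def cusp_def algebra_simps)
  then show ?thesis by (auto simp: void_def)
qed

lemma void_shadow_sets: "{\<omega> \<in> space (config_space strip). \<omega> \<inter> shadow (q, t) = {}} \<in> sets (config_space strip)"
  unfolding space_config_space void_shadow by (intro void_in_sets subgraph_sets holder_ball_reflected_cusp)

lemma functional_mle_measurable:
  assumes \<Phi>: "continuous_on UNIV \<Phi>" and sp: "space N \<subseteq> configurations (space strip)"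
    and m: "\<And>q t. {\<omega> \<in> space N. \<omega> \<inter> shadow (q, t) = {}} \<in> sets N"
  shows "(\<lambda>\<omega>. functional \<Phi> (mle \<beta> R \<omega>)) \<in> borel_measurable N"
proof -
  let ?I = "restrict_space lborel {0..1::real}"
  have fin: "finite_measure ?I"
    by (rule finite_measureI) (simp add: emeasure_restrict_space space_restrict_space)
  have "measurable (N \<Otimes>\<^sub>M ?I) borel = (measurable (N \<Otimes>\<^sub>M restrict_space borel {0..1}) borel :: (_ \<Rightarrow> real) set)"
    by (intro measurable_cong_sets sets_pair_measure_cong sets_restrict_space_cong) auto
  then have "(\<lambda>(\<omega>, x). mle \<beta> R \<omega> x) \<in> borel_measurable (N \<Otimes>\<^sub>M ?I)"
    using mle_measurable(1)[OF sp m] by simp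
  from measurable_compose[OF this borel_measurable_continuous_onI[OF \<Phi>]]
  have "(\<lambda>\<omega>. LINT x|?I. \<Phi> (mle \<beta> R \<omega> x)) \<in> borel_measurable N"
    by (intro sigma_finite_measure.borel_measurable_lebesgue_integral finite_measure.sigma_finite_measure[OF fin])
      (simp add: split_beta')
  then show ?thesis
    by (simp add: functional_def set_lebesgue_integral_def integral_restrict_space)
qed

text \<open>Estimators have to be measurable on all configurations, including those where the sum
  diverges or \<open>mle\<close> is unspecified. The sum is therefore read as an integral over
  \<open>count_space\<close> with its default value.\<close>

lemma functional_estimator_measurable:
  assumes w: "weak_derivative \<Phi> \<Phi>'"
  shows "functional_estimator \<beta> R k \<Phi> \<Phi>' \<in> borel_measurable (config_space strip)"
proof -
  let ?N = "config_space strip"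
  have sp: "space ?N \<subseteq> configurations (space strip)" by (simp add: space_config_space)
  have 1: "(\<lambda>\<omega>. functional \<Phi> (mle \<beta> R \<omega>)) \<in> borel_measurable ?N"
    by (rule functional_mle_measurable[OF weak_derivative_continuous[OF w] sp void_shadow_sets])
  have f: "(\<lambda>p. (fst p, fst (snd p))) \<in> ?N \<Otimes>\<^sub>M strip \<rightarrow>\<^sub>M ?N \<Otimes>\<^sub>M restrict_space borel {0..1}"
    by (intro measurable_Pair measurable_fst measurable_compose[OF measurable_snd fst_strip_unit])
  have ml: "(\<lambda>p. mle \<beta> R (fst p) (fst (snd p))) \<in> borel_measurable (?N \<Otimes>\<^sub>M strip)"
    using measurable_compose[OF f mle_measurable(1)[OF sp void_shadow_sets]] by simp
  have s: "(\<lambda>p. snd (snd p)) \<in> borel_measurable (?N \<Otimes>\<^sub>M strip)"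
    by (rule measurable_compose[OF measurable_snd snd_strip])
  have "(\<lambda>p. if snd (snd p) \<le> mle \<beta> R (fst p) (fst (snd p)) then \<Phi>' (snd (snd p)) else 0) \<in> borel_measurable (?N \<Otimes>\<^sub>M strip)"
    by (intro measurable_If borel_measurable_const borel_measurable_le ml s
        measurable_compose[OF s weak_derivative_measurable[OF w]])
  also have "(\<lambda>p. if snd (snd p) \<le> mle \<beta> R (fst p) (fst (snd p)) then \<Phi>' (snd (snd p)) else 0)
      = (\<lambda>(\<omega>, z). \<Phi>' (snd z) * of_bool (snd z \<le> mle \<beta> R \<omega> (fst z)))"
    by (auto simp: fun_eq_iff)
  finally have "(\<lambda>\<omega>. LINT z|count_space \<omega>. \<Phi>' (snd z) * of_bool (snd z \<le> mle \<beta> R \<omega> (fst z))) \<in> borel_measurable ?N"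
    by (intro measurable_count_integral[OF open_strip measurable_ident_sets[OF refl]]) auto
  then have 2: "(\<lambda>\<omega>. \<Sum>\<^sub>\<infinity>(X, Y)\<in>\<omega>. \<Phi>' Y * of_bool (mle \<beta> R \<omega> X \<ge> Y)) \<in> borel_measurable ?N"
    by (simp add: infsum_eq_integral_count_space split_beta')
  show ?thesis
    unfolding functional_estimator_def [abs_def] functional_def[of \<Phi>, symmetric]
    by (intro borel_measurable_diff borel_measurable_times borel_measurable_const 1 2)
qed

end

section \<open>The error of the estimator as a compensated sum\<close>

context boundary_model
begin

text \<open>Above each \<open>x\<close> the free region within the support of the intensity is the
  segment from \<open>g x\<close> to the estimator, over which \<Phi>' integrates to the increment
  of \<Phi>. For a fixed configuration these segments lie in one bounded interval, so local
  integrability of \<Phi>' suffices.\<close>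

lemma compensator_eq:
  assumes w: "weak_derivative \<Phi> \<Phi>'" and \<omega>: "good \<omega>" "\<omega> \<inter> subgraph g = {}"
  shows "integrable \<mu> (\<lambda>z. \<Phi>' (snd z) * free \<omega> z)"
    and "compensator (\<lambda>z. \<Phi>' (snd z)) \<omega> = real n * (functional \<Phi> (mle \<beta> R \<omega>) - functional \<Phi> g)"
proof -
  let ?S = "{0..1} \<times> UNIV :: (real \<times> real) set" and ?m = "mle \<beta> R \<omega>"
  let ?h = "\<lambda>z. \<Phi>' (snd z) * free \<omega> z"
  have S: "?S \<inter> space lborel \<in> sets lborel" using strip_closed by simp
  have wP: "\<omega> \<in> space P" using \<omega>(1) by (simp add: good_def space_P_strip)
  have h: "?h \<in> borel_measurable strip"
    using measurable_free_section[OF wP] measurable_compose[OF snd_strip weak_derivative_measurable[OF w]]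
    by (intro borel_measurable_times) (simp_all add: measurable_intensity)
  then have dh: "(\<lambda>z. dens z *\<^sub>R ?h z) \<in> borel_measurable strip"
    using dens_measurable by (intro borel_measurable_scaleR)
  define H where "H z = indicator ?S z *\<^sub>R (dens z *\<^sub>R ?h z)" for z
  have Hm: "H \<in> borel_measurable (lborel \<Otimes>\<^sub>M lborel)"
    using dh unfolding strip_def borel_measurable_restrict_space_iff[OF S] H_def [abs_def]
    by (simp add: lborel_prod)
  have free: "free \<omega> (x, y) = of_bool (y \<le> ?m x)" for x y
    using good_shadow[OF \<omega>(1)] by (simp add: free_def)
  have Heq: "H (x, y) = indicator {0..1} x * (real n * (indicator {g x..?m x} y *\<^sub>R \<Phi>' y))" for x y
    by (simp add: H_def dens_def free indicator_def)
  have mc: "continuous_on {0..1} ?m" using mle_continuous[OF \<omega>(1)] by (rule continuous_on_subset) simp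
  have gc: "continuous_on {0..1} g" by (rule holder_ball_continuous[OF g])
  define a where "a = g 0 - R"
  obtain b where b: "\<And>x. x \<in> {0..1} \<Longrightarrow> ?m x \<le> b"
    using continuous_attains_sup[OF compact_Icc _ mc] by fastforce
  have si: "set_integrable lborel {c..d} \<Phi>'" for c d using w by (simp add: weak_derivative_def)
  have dom: "integrable (lborel \<Otimes>\<^sub>M lborel) (\<lambda>p. (indicator {0..1::real} (fst p) * real n) * norm (indicator {a..b} (snd p) *\<^sub>R \<Phi>' (snd p)))"
  proof -
    have i1: "integrable lborel (\<lambda>x. indicator {0..1::real} x * real n)"
      by (intro integrable_mult_left integrable_real_indicator) auto
    have i2: "integrable lborel (\<lambda>y. norm (indicator {a..b} y *\<^sub>R \<Phi>' y))"
      by (intro integrable_norm si[of a b, unfolded set_integrable_def])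
    show ?thesis by (rule lborel_pair.integrable_mult_pair[OF i1 i2])
  qed
  have Hi: "integrable (lborel \<Otimes>\<^sub>M lborel) H"
  proof (rule Bochner_Integration.integrable_bound[OF dom Hm], rule AE_I2)
    fix p :: "real \<times> real"
    have "norm (H (fst p, snd p)) \<le> (indicator {0..1} (fst p) * real n) * norm (indicator {a..b} (snd p) *\<^sub>R \<Phi>' (snd p))"
      using holder_ball_bounds(1)[OF g, of "fst p"] b[of "fst p"] unfolding Heq a_def
      by (auto simp: indicator_def abs_mult)
    then show "norm (H p) \<le> norm ((indicator {0..1} (fst p) * real n) * norm (indicator {a..b} (snd p) *\<^sub>R \<Phi>' (snd p)))"
      by (simp add: abs_mult)
  qed
  show "integrable \<mu> ?h"
  proof -
    have "integrable strip (\<lambda>z. dens z *\<^sub>R ?h z)"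
      unfolding strip_def integrable_restrict_space[OF S] using Hi by (simp add: H_def [abs_def] lborel_prod)
    then show ?thesis
      unfolding intensity_eq by (subst integrable_density[OF h dens_measurable]) (auto simp: dens_nonneg)
  qed
  have "compensator (\<lambda>z. \<Phi>' (snd z)) \<omega> = (LINT z|density strip (\<lambda>z. ennreal (dens z)). ?h z)"
    unfolding compensator_def by (rule arg_cong[OF intensity_eq, where f = "\<lambda>m. integral\<^sup>L m ?h"])
  also have "\<dots> = (LINT z|strip. dens z *\<^sub>R ?h z)"
    by (rule integral_density[OF h dens_measurable]) (simp add: dens_nonneg)
  also have "\<dots> = (LINT p|(lborel \<Otimes>\<^sub>M lborel). H p)"
    unfolding strip_def integral_restrict_space[OF S] by (simp add: H_def [abs_def] lborel_prod)
  also have "\<dots> = (LINT x|lborel. LINT y|lborel. H (x, y))"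
    by (rule lborel_pair.integral_fst'[OF Hi, symmetric])
  also have "\<dots> = (LINT x|lborel. real n * (indicator {0..1} x *\<^sub>R \<Phi> (?m x) - indicator {0..1} x *\<^sub>R \<Phi> (g x)))"
  proof (rule Bochner_Integration.integral_cong[OF refl])
    fix x :: real
    show "(LINT y|lborel. H (x, y)) = real n * (indicator {0..1} x *\<^sub>R \<Phi> (?m x) - indicator {0..1} x *\<^sub>R \<Phi> (g x))"
    proof (cases "x \<in> {0..1}")
      case True
      have "(LINT y|lborel. indicator {g x..?m x} y *\<^sub>R \<Phi>' y) = \<Phi> (?m x) - \<Phi> (g x)"
        using weak_derivative_diff[OF w mle_above[OF \<omega> True]] by (simp add: set_lebesgue_integral_def)
      moreover have "(LINT y|lborel. H (x, y)) = (LINT y|lborel. real n * (indicator {g x..?m x} y *\<^sub>R \<Phi>' y))"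
        using True by (simp only: Heq indicator_simps mult_1_left)
      moreover have "\<dots> = real n * (LINT y|lborel. indicator {g x..?m x} y *\<^sub>R \<Phi>' y)"
        by (rule integral_mult_right_zero)
      ultimately show ?thesis using True by simp
    next
      case False
      then show ?thesis unfolding Heq by simp
    qed
  qed
  also have "\<dots> = real n * (functional \<Phi> ?m - functional \<Phi> g)"
  proof -
    have "set_integrable lborel {0..1} (\<lambda>x. \<Phi> (?m x))" "set_integrable lborel {0..1} (\<lambda>x. \<Phi> (g x))"
      using continuous_on_compose2[OF weak_derivative_continuous[OF w] mc] continuous_on_compose2[OF weak_derivative_continuous[OF w] gc]
      by (auto intro: borel_integrable_atLeastAtMost')
    then show ?thesis
      unfolding functional_def set_lebesgue_integral_def set_integrable_def by simp
  qed
  finally show "compensator (\<lambda>z. \<Phi>' (snd z)) \<omega> = real n * (functional \<Phi> ?m - functional \<Phi> g)" .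
qed

lemma free_touching:
  assumes "good \<omega>"
  shows "{z \<in> \<omega>. free \<omega> z \<noteq> 0} = touching \<omega>"
proof -
  have "free \<omega> z = of_bool (snd z \<le> mle \<beta> R \<omega> (fst z))" for z
    using good_shadow[OF assms, of "fst z" "snd z"] by (simp add: free_def)
  then show ?thesis by (simp add: touching_def)
qed

lemma point_sum_touching:
  assumes "good \<omega>"
  shows "point_sum f \<omega> = (\<Sum>z\<in>touching \<omega>. f z)"
proof -
  have "{z \<in> \<omega>. f z * free \<omega> z \<noteq> 0} \<subseteq> touching \<omega>" using free_touching[OF assms] by auto
  moreover from this have fin: "finite {z \<in> \<omega>. f z * free \<omega> z \<noteq> 0}" using finite_touching[OF assms] by (rule finite_subset)
  then have "point_sum f \<omega> = (\<Sum>z | z \<in> \<omega> \<and> f z * free \<omega> z \<noteq> 0. f z * free \<omega> z)"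
    unfolding point_sum_def by (rule lebesgue_integral_count_space_finite_support)
  ultimately have "point_sum f \<omega> = (\<Sum>z\<in>touching \<omega>. f z * free \<omega> z)"
    using finite_touching[OF assms] free_touching[OF assms]
    by (simp only:) (rule sum.mono_neutral_left, auto simp: touching_def)
  also have "\<dots> = (\<Sum>z\<in>touching \<omega>. f z)"
    using free_touching[OF assms] by (intro sum.cong) (auto simp: free_def split: if_splits)
  finally show ?thesis .
qed

lemma estimator_eq:
  assumes w: "weak_derivative \<Phi> \<Phi>'" and \<omega>: "good \<omega>" "\<omega> \<inter> subgraph g = {}"
  shows "functional_estimator \<beta> R n \<Phi> \<Phi>' \<omega> = functional \<Phi> g - 1 / real n * compensated (\<lambda>z. \<Phi>' (snd z)) \<omega>"
proof -
  have "1 / real n * (real n * x) = x" for x using n by simp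
  then show ?thesis
    unfolding functional_estimator_def functional_def[of \<Phi>, symmetric] compensated_def compensator_eq(2)[OF assms]
      infsum_touching[OF \<omega>(1)] point_sum_touching[OF \<omega>(1)]
    by (simp only: right_diff_distrib)
qed

text \<open>Substituting \<open>y = g x + u\<close> turns the integral over the intensity into
  \<open>n\<close> times the double integral. This \<open>n\<close> cancels one of the factors
  \<open>1 / n\<close> from the squared error.\<close>

lemma variance_formula_eq:
  assumes w: "weak_derivative \<Phi> \<Phi>'"
  shows "variance_formula \<beta> R n \<Phi>' P g = ennreal ((1 / real n)\<^sup>2) * (\<integral>\<^sup>+z. ennreal ((\<Phi>' (snd z))\<^sup>2) * hit z \<partial>\<mu>)"
proof -
  let ?F = "\<lambda>z. ennreal ((\<Phi>' (snd z))\<^sup>2) * hit z"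
  let ?J = "\<lambda>x. \<integral>\<^sup>+u\<in>{0..}. ennreal ((\<Phi>' (g x + u))\<^sup>2) * emeasure P {\<omega> \<in> space P. mle \<beta> R \<omega> x - g x \<ge> u} \<partial>lborel"
  have Fm: "?F \<in> borel_measurable strip"
    using measurable_hit unfolding measurable_intensity
    by (intro borel_measurable_times_ennreal measurable_compose[OF _ measurable_ennreal] borel_measurable_power
      measurable_compose[OF snd_strip weak_derivative_measurable[OF w]])
  have dFm: "(\<lambda>z. ennreal (dens z) * ?F z) \<in> borel_measurable strip"
    by (intro borel_measurable_times_ennreal[OF measurable_compose[OF dens_measurable measurable_ennreal] Fm])
  have inner: "(\<integral>\<^sup>+y. ennreal (dens (x, y)) * ?F (x, y) \<partial>lborel) = of_nat n * ?J x" if x: "x \<in> {0..1}" for x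
  proof -
    have "(\<lambda>y. (x, y)) \<in> borel \<rightarrow>\<^sub>M strip"
      unfolding strip_def using x by (intro measurable_restrict_space2) auto
    from measurable_compose[OF this dFm]
    have m: "(\<lambda>y. ennreal (dens (x, y)) * ?F (x, y)) \<in> borel_measurable borel" .
    have hit: "hit (x, g x + u) = emeasure P {\<omega> \<in> space P. mle \<beta> R \<omega> x - g x \<ge> u}" for u
    proof -
      have mm: "{\<omega> \<in> space P. mle \<beta> R \<omega> x - g x \<ge> u} \<in> sets P"
      proof -
        have "(\<lambda>\<omega>. mle \<beta> R \<omega> x) \<in> borel_measurable (config_space strip)"
          by (rule mle_measurable(2)[OF _ void_shadow_sets x]) (simp add: space_config_space)
        then have "(\<lambda>\<omega>. mle \<beta> R \<omega> x) \<in> borel_measurable P"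
          by (simp cong: measurable_cong_sets add: sets_P_strip)
        then show ?thesis by (intro borel_measurable_le borel_measurable_const borel_measurable_diff)
      qed
      have "hit (x, g x + u) = (\<integral>\<^sup>+\<omega>. indicator {\<omega> \<in> space P. mle \<beta> R \<omega> x - g x \<ge> u} \<omega> \<partial>P)"
        unfolding hit_def
      proof (rule nn_integral_cong_AE)
        show "AE \<omega> in P. ennreal (free \<omega> (x, g x + u)) = indicator {\<omega> \<in> space P. mle \<beta> R \<omega> x - g x \<ge> u} \<omega>"
          using AE_good AE_space
        proof eventually_elim
          case (elim \<omega>)
          then show ?case using good_shadow[of \<omega> x "g x + u"] by (auto simp: free_def indicator_def algebra_simps)
        qed
      qed
      then show ?thesis using mm by simp
    qed
    have "(\<integral>\<^sup>+y. ennreal (dens (x, y)) * ?F (x, y) \<partial>lborel)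
        = (\<integral>\<^sup>+u. ennreal (dens (x, g x + u)) * ?F (x, g x + u) \<partial>lborel)"
      using nn_integral_real_affine[OF m, of 1 "g x"] by simp
    also have "\<dots> = (\<integral>\<^sup>+u. of_nat n * ((ennreal ((\<Phi>' (g x + u))\<^sup>2) * hit (x, g x + u)) * indicator {0..} u) \<partial>lborel)"
      by (intro nn_integral_cong) (auto simp: dens_def ennreal_of_nat_eq_real_of_nat indicator_def)
    also have "\<dots> = of_nat n * (\<integral>\<^sup>+u. (ennreal ((\<Phi>' (g x + u))\<^sup>2) * hit (x, g x + u)) * indicator {0..} u \<partial>lborel)"
    proof (rule nn_integral_cmult)
      have "(\<lambda>u. (x, g x + u)) \<in> borel \<rightarrow>\<^sub>M strip"
        unfolding strip_def using x by (intro measurable_restrict_space2) auto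
      from measurable_compose[OF this Fm]
      have m2: "(\<lambda>u. ennreal ((\<Phi>' (g x + u))\<^sup>2) * hit (x, g x + u)) \<in> borel_measurable borel" by simp
      have lb: "borel_measurable lborel = (borel_measurable borel :: (real \<Rightarrow> ennreal) set)"
        by (rule measurable_cong_sets) simp_all
      show "(\<lambda>u. (ennreal ((\<Phi>' (g x + u))\<^sup>2) * hit (x, g x + u)) * indicator {0..} u) \<in> borel_measurable lborel"
        unfolding lb by (intro borel_measurable_times_ennreal[OF m2] borel_measurable_indicator atLeast_borel)
    qed
    finally show ?thesis by (simp only: hit)
  qed
  let ?K = "\<lambda>x. (\<integral>\<^sup>+y. ennreal (dens (x, y)) * ?F (x, y) \<partial>lborel) * indicator {0..1} x"
  have "ennreal (1 / real n) * of_nat n = ennreal (1 / real n * real n)"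
    by (simp only: ennreal_of_nat_eq_real_of_nat ennreal_mult' of_nat_0_le_iff divide_nonneg_nonneg zero_le_one)
  then have nn: "ennreal (1 / real n) * of_nat n = 1" using n by simp
  have "(\<integral>\<^sup>+x\<in>{0..1}. ?J x \<partial>lborel) = (\<integral>\<^sup>+x. ennreal (1 / real n) * ?K x \<partial>lborel)"
  proof (rule nn_integral_cong)
    fix x
    show "?J x * indicator {0..1} x = ennreal (1 / real n) * ?K x"
      using nn inner[of x] by (cases "x \<in> {0..1}") (simp_all add: mult.assoc[symmetric])
  qed
  also have "\<dots> = ennreal (1 / real n) * (\<integral>\<^sup>+x. ?K x \<partial>lborel)"
    by (rule nn_integral_cmult[OF nn_integral_strip(2)[OF dFm]])
  also have "(\<integral>\<^sup>+x. ?K x \<partial>lborel) = (\<integral>\<^sup>+z. ?F z \<partial>\<mu>)"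
    unfolding nn_integral_intensity[OF Fm] nn_integral_strip(1)[OF dFm] ..
  finally have J: "(\<integral>\<^sup>+x\<in>{0..1}. ?J x \<partial>lborel) = ennreal (1 / real n) * (\<integral>\<^sup>+z. ?F z \<partial>\<mu>)" .
  have "ennreal ((1 / real n)\<^sup>2) = ennreal (1 / real n) * ennreal (1 / real n)"
    by (simp only: power2_eq_square) (rule ennreal_mult, simp_all)
  then show ?thesis unfolding variance_formula_def J by (simp only: mult.assoc)
qed

theorem estimator_moments:
  assumes w: "weak_derivative \<Phi> \<Phi>'" and V: "variance_formula \<beta> R n \<Phi>' P g < \<infinity>"
  shows "integrable P (functional_estimator \<beta> R n \<Phi> \<Phi>')"
    and "(LINT \<omega>|P. functional_estimator \<beta> R n \<Phi> \<Phi>' \<omega>) = functional \<Phi> g"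
    and "evariance P (functional_estimator \<beta> R n \<Phi> \<Phi>') = variance_formula \<beta> R n \<Phi>' P g"
proof -
  let ?f = "\<lambda>z :: real \<times> real. \<Phi>' (snd z)" and ?E = "functional_estimator \<beta> R n \<Phi> \<Phi>'"
  have fm: "?f \<in> borel_measurable \<mu>"
    using measurable_compose[OF snd_strip weak_derivative_measurable[OF w]] by (simp add: measurable_intensity)
  have Em: "?E \<in> borel_measurable P"
    using functional_estimator_measurable[OF w] by (simp cong: measurable_cong_sets add: sets_P_strip)
  have c: "0 < (1 / real n)\<^sup>2" using n by simp
  have V': "(\<integral>\<^sup>+z. ennreal ((?f z)\<^sup>2) * hit z \<partial>\<mu>) < \<infinity>"
    using V c unfolding variance_formula_eq[OF w] by (auto simp: ennreal_mult_less_top)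
  have fin: "AE \<omega> in P. finite {z \<in> \<omega>. free \<omega> z \<noteq> 0}"
    using AE_good by eventually_elim (simp add: free_touching finite_touching)
  have int: "AE \<omega> in P. integrable \<mu> (\<lambda>z. ?f z * free \<omega> z)"
    using AE_good by eventually_elim (simp add: compensator_eq(1)[OF w])
  note iso = compensated_isometry[OF fm fin int V']
  have eq: "AE \<omega> in P. ?E \<omega> = functional \<Phi> g - 1 / real n * compensated ?f \<omega>"
    using AE_good by eventually_elim (simp only: estimator_eq[OF w])
  have m: "(\<lambda>\<omega>. functional \<Phi> g - 1 / real n * compensated ?f \<omega>) \<in> borel_measurable P"
    using measurable_compensated(3)[OF fm] by (intro borel_measurable_diff borel_measurable_times borel_measurable_const)
  show "integrable P ?E"
    by (subst integrable_cong_AE[OF Em m eq]) (use iso(1) in simp)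
  show mean: "(LINT \<omega>|P. ?E \<omega>) = functional \<Phi> g"
    unfolding integral_cong_AE[OF Em m eq] using iso(1,2) by (simp add: prob_space)
  have "evariance P ?E = (\<integral>\<^sup>+\<omega>. ennreal ((1 / real n)\<^sup>2) * ennreal ((compensated ?f \<omega>)\<^sup>2) \<partial>P)"
    unfolding evariance_def mean
  proof (rule nn_integral_cong_AE)
    show "AE \<omega> in P. ennreal ((?E \<omega> - functional \<Phi> g)\<^sup>2) = ennreal ((1 / real n)\<^sup>2) * ennreal ((compensated ?f \<omega>)\<^sup>2)"
      using eq by eventually_elim (simp add: ennreal_mult[symmetric] power_mult_distrib power_divide)
  qed
  also have "\<dots> = ennreal ((1 / real n)\<^sup>2) * (\<integral>\<^sup>+\<omega>. ennreal ((compensated ?f \<omega>)\<^sup>2) \<partial>P)"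
    using measurable_compensated(3)[OF fm]
    by (intro nn_integral_cmult measurable_compose[OF _ measurable_ennreal] borel_measurable_power)
  also have "\<dots> = variance_formula \<beta> R n \<Phi>' P g"
    unfolding iso(3) variance_formula_eq[OF w] ..
  finally show "evariance P ?E = variance_formula \<beta> R n \<Phi>' P g" .
qed

end

section \<open>Minimality of the variance\<close>

context holder
begin

text \<open>Void events determine both sides. Away from the region below \<open>g\<close> the
  intensity of \<open>g0\<close> is that of \<open>g\<close>, so the probability under
  \<open>P0\<close> that this region and \<open>A\<close> are both empty factorises. Densities let
  integrals be transferred without dividing by the probability of the event.\<close>

lemma likelihood_ratio:
  assumes n: "0 < n" and g: "g \<in> holder_ball \<beta> R" "g0 \<in> holder_ball \<beta> R"
    and le: "\<And>x. x \<in> {0..1} \<Longrightarrow> g0 x \<le> g x"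
    and P: "poisson_process (boundary_intensity n g) P" "poisson_process (boundary_intensity n g0) P0"
  shows "density P0 (\<lambda>\<omega>. ennreal (indicator (void strip (subgraph g)) \<omega>))
    = density P (\<lambda>_. ennreal (measure P0 (void strip (subgraph g))))"
proof -
  interpret M0: boundary_model \<beta> R n g0 P0 using n g P by unfold_locales
  interpret M1: boundary_model \<beta> R n g P using n g P by unfold_locales
  let ?S = "subgraph g"
  have S: "?S \<in> sets strip" by (rule subgraph_sets[OF g(1)])
  have VS: "void strip A \<in> sets P0" "void strip A \<in> sets P" if "A \<in> sets strip" for A
    using void_in_sets[OF that] by (simp_all add: M0.sets_P_strip M1.sets_P_strip)
  \<comment> \<open>Under \<open>g0\<close> only the part of the region between the two curves
    carries intensity, and this part is bounded.\<close>
  have S_fin: "emeasure M0.\<mu> ?S < \<infinity>"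
  proof -
    have "emeasure M0.\<mu> ?S \<le> emeasure M0.\<mu> (?S - subgraph g0) + emeasure M0.\<mu> (subgraph g0)"
    proof (rule order_trans[OF emeasure_mono emeasure_subadditive])
      show "?S - subgraph g0 \<in> sets M0.\<mu>" "subgraph g0 \<in> sets M0.\<mu>"
        using S subgraph_sets[OF g(2)] by (auto simp: M0.sets_intensity)
      then show "?S - subgraph g0 \<union> subgraph g0 \<in> sets M0.\<mu>" by (rule sets.Un)
    qed blast
    also have "\<dots> = emeasure M0.\<mu> (?S - subgraph g0)" by (simp add: M0.subgraph_null)
    also have "\<dots> < \<infinity>"
    proof (rule M0.bounded_finite)
      have "?S - subgraph g0 \<subseteq> {0..1} \<times> {g0 0 - R..g 0 + R}"
      proof
        fix z assume z: "z \<in> ?S - subgraph g0"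
        then have x: "fst z \<in> {0..1}" by (auto simp: subgraph_def space_strip)
        have "g0 (fst z) \<le> snd z" "snd z < g (fst z)" using z by (auto simp: subgraph_def)
        then show "z \<in> {0..1} \<times> {g0 0 - R..g 0 + R}"
          using x holder_ball_bounds(1)[OF g(2) x] holder_ball_bounds(2)[OF g(1) x] by (auto simp: mem_Times_iff)
      qed
      then show "bounded (?S - subgraph g0)" by (rule bounded_subset[rotated]) (intro bounded_Times bounded_closed_interval)
      show "?S - subgraph g0 \<in> sets M0.\<mu>" using S subgraph_sets[OF g(2)] by (auto simp: M0.sets_intensity)
    qed
    finally show ?thesis .
  qed
  have prod: "measure P0 (void strip (?S \<union> A)) = measure P0 (void strip ?S) * measure P (void strip A)" if A: "A \<in> sets strip" for A
  proof -
    have "emeasure M0.\<mu> (A - ?S) = emeasure M1.\<mu> A"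
    proof -
      have AS: "A - ?S \<in> sets strip" using A S by auto
      show ?thesis
        unfolding M0.emeasure_intensity[OF AS] M1.emeasure_intensity[OF A]
      proof (rule nn_integral_cong)
        fix z assume z: "z \<in> space strip"
        then have "fst z \<in> {0..1}" by (auto simp: space_strip)
        then have "g0 (fst z) \<le> g (fst z)" by (rule le)
        then show "ennreal (M0.dens z) * indicator (A - ?S) z = ennreal (M1.dens z) * indicator A z"
          using z by (auto simp: M0.dens_def M1.dens_def subgraph_def indicator_def)
      qed
    qed
    moreover have "emeasure M0.\<mu> (?S \<union> A) = emeasure M0.\<mu> ?S + emeasure M0.\<mu> (A - ?S)"
      using A S by (subst plus_emeasure) (auto simp: M0.sets_intensity intro!: arg_cong[where f = "emeasure _"])
    ultimately have e: "emeasure M0.\<mu> (?S \<union> A) = emeasure M0.\<mu> ?S + emeasure M1.\<mu> A" by simp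
    have "measure P0 (void strip (?S \<union> A)) = (if emeasure M0.\<mu> (?S \<union> A) < \<infinity> then exp (- measure M0.\<mu> (?S \<union> A)) else 0)"
      using M0.prob_void[of "?S \<union> A"] A S by (simp add: M0.void_intensity M0.sets_intensity)
    moreover have "measure P0 (void strip ?S) = exp (- measure M0.\<mu> ?S)"
      using M0.prob_void[of ?S] S S_fin by (simp add: M0.void_intensity M0.sets_intensity)
    moreover have "measure P (void strip A) = (if emeasure M1.\<mu> A < \<infinity> then exp (- measure M1.\<mu> A) else 0)"
      using M1.prob_void[of A] A by (simp add: M1.void_intensity M1.sets_intensity)
    moreover have "measure M0.\<mu> (?S \<union> A) = measure M0.\<mu> ?S + measure M1.\<mu> A" if "emeasure M1.\<mu> A < \<infinity>"
      using that S_fin by (simp add: measure_def e enn2real_plus)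
    ultimately show ?thesis using S_fin by (auto simp: e exp_add[symmetric] less_top[symmetric])
  qed
  show ?thesis
  proof (rule emeasure_void_unique[OF open_strip])
    show "sets (density P0 (\<lambda>\<omega>. ennreal (indicator (void strip ?S) \<omega>))) = sets (config_space strip)"
      "sets (density P (\<lambda>_. ennreal (measure P0 (void strip ?S)))) = sets (config_space strip)"
      by (simp_all add: M0.sets_P_strip M1.sets_P_strip)
    have eq: "emeasure (density P0 (\<lambda>\<omega>. ennreal (indicator (void strip ?S) \<omega>))) B = emeasure P0 (void strip ?S \<inter> B)"
      if B: "B \<in> sets P0" for B
    proof -
      have "emeasure (density P0 (\<lambda>\<omega>. ennreal (indicator (void strip ?S) \<omega>))) B
        = (\<integral>\<^sup>+\<omega>. ennreal (indicator (void strip ?S) \<omega>) * indicator B \<omega> \<partial>P0)"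
        using VS(1)[OF S] B by (intro emeasure_density) (simp_all add: borel_measurable_indicator)
      also have "\<dots> = (\<integral>\<^sup>+\<omega>. indicator (void strip ?S \<inter> B) \<omega> \<partial>P0)"
        by (intro nn_integral_cong) (auto split: split_indicator)
      also have "\<dots> = emeasure P0 (void strip ?S \<inter> B)"
        using VS(1)[OF S] B by (intro nn_integral_indicator sets.Int)
      finally show ?thesis .
    qed
    show "emeasure (density P0 (\<lambda>\<omega>. ennreal (indicator (void strip ?S) \<omega>)))
       (space (density P0 (\<lambda>\<omega>. ennreal (indicator (void strip ?S) \<omega>)))) \<noteq> \<infinity>"
      by (simp add: eq[OF sets.top] M0.emeasure_eq_measure)
    fix A assume A: "A \<in> sets strip"
    have "emeasure (density P (\<lambda>_. ennreal (measure P0 (void strip ?S)))) (void strip A)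
      = ennreal (measure P0 (void strip ?S)) * emeasure P (void strip A)"
      by (rule emeasure_density_const[OF VS(2)[OF A]])
    also have "\<dots> = ennreal (measure P0 (void strip (?S \<union> A)))"
      by (simp add: prod[OF A] M1.emeasure_eq_measure ennreal_mult)
    also have "\<dots> = emeasure (density P0 (\<lambda>\<omega>. ennreal (indicator (void strip ?S) \<omega>))) (void strip A)"
      unfolding eq[OF VS(1)[OF A]] void_Int by (simp add: M0.emeasure_eq_measure)
    finally show "emeasure (density P0 (\<lambda>\<omega>. ennreal (indicator (void strip ?S) \<omega>))) (void strip A)
      = emeasure (density P (\<lambda>_. ennreal (measure P0 (void strip ?S)))) (void strip A)" by simp
  qed
qed

text \<open>The sigma-algebra generated by the maximum likelihood estimator: \<open>mle\<close> lies above the curve \<open>h\<close>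
  precisely if no point lies below \<open>h\<close>.\<close>

definition mle_algebra :: "(real \<times> real) set measure" where
  "mle_algebra = sigma (configurations (space strip)) {void strip (subgraph h) |h. h \<in> holder_ball \<beta> R}"

lemma space_mle_algebra: "space mle_algebra = configurations (space strip)"
  unfolding mle_algebra_def by (rule space_measure_of) (auto simp: void_def)

lemma sets_mle_algebra:
  "sets mle_algebra = sigma_sets (configurations (space strip)) {void strip (subgraph h) |h. h \<in> holder_ball \<beta> R}"
  unfolding mle_algebra_def by (rule sets_measure_of) (auto simp: void_def)

lemma mle_algebra_le: "sets mle_algebra \<subseteq> sets (config_space strip)"
proof -
  have "sigma_sets (space (config_space strip)) {void strip (subgraph h) |h. h \<in> holder_ball \<beta> R} \<subseteq> sets (config_space strip)"
    by (rule sets.sigma_sets_subset) (auto intro: void_in_sets subgraph_sets)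
  then show ?thesis by (simp add: sets_mle_algebra space_config_space)
qed

lemma mle_algebra_shadow: "{\<omega> \<in> space mle_algebra. \<omega> \<inter> shadow (q, t) = {}} \<in> sets mle_algebra"
  unfolding space_mle_algebra void_shadow sets_mle_algebra using holder_ball_reflected_cusp by (intro sigma_sets.Basic) blast

text \<open>For the generating event of a curve \<open>h\<close>, the mean of \<open>U\<close> is
  used at the maximum of \<open>g0\<close> and \<open>h\<close>: under \<open>g0\<close> almost
  surely no point lies below \<open>g0\<close>, so emptiness below \<open>h\<close> amounts to
  emptiness below the maximum. For complements the mean at \<open>g0\<close> itself is used.\<close>

lemma zero_estimator_orthogonal:
  fixes U :: "(real \<times> real) set \<Rightarrow> real"
  assumes n: "0 < n"
    and P: "\<And>g. g \<in> holder_ball \<beta> R \<Longrightarrow> poisson_process (boundary_intensity n g) (P g)"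
    and U: "\<And>g. g \<in> holder_ball \<beta> R \<Longrightarrow> integrable (P g) U" "\<And>g. g \<in> holder_ball \<beta> R \<Longrightarrow> (LINT \<omega>|P g. U \<omega>) = 0"
    and g0: "g0 \<in> holder_ball \<beta> R" and A: "A \<in> sets mle_algebra"
  shows "(LINT \<omega>:A|P g0. U \<omega>) = 0"
proof -
  interpret M0: boundary_model \<beta> R n g0 "P g0" using n g0 P by unfold_locales auto
  let ?G = "{void strip (subgraph h) |h. h \<in> holder_ball \<beta> R}"
  have sub: "B \<in> sets (P g0)" if "B \<in> sets mle_algebra" for B
    using that mle_algebra_le by (auto simp: M0.sets_P_strip)
  have si: "set_integrable (P g0) B U" if "B \<in> sets (P g0)" for B
    unfolding set_integrable_def using that U(1)[OF g0] by (rule integrable_mult_indicator)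
  have "Int_stable ?G"
  proof (rule Int_stableI)
    fix a b assume "a \<in> ?G" "b \<in> ?G"
    then obtain h h' where h: "a = void strip (subgraph h)" "b = void strip (subgraph h')"
      "h \<in> holder_ball \<beta> R" "h' \<in> holder_ball \<beta> R" by blast
    have "subgraph h \<union> subgraph h' = subgraph (\<lambda>x. max (h x) (h' x))" by (auto simp: subgraph_def)
    then have "a \<inter> b = void strip (subgraph (\<lambda>x. max (h x) (h' x)))" by (simp add: h void_Int)
    then show "a \<inter> b \<in> ?G" using holder_ball_max[OF h(3,4)] by blast
  qed
  moreover have "?G \<subseteq> Pow (configurations (space strip))" by (auto simp: void_def)
  ultimately show ?thesis using A unfolding sets_mle_algebra
  proof (induct rule: sigma_sets_induct_disjoint)
    case (basic B)
    then obtain h where h: "B = void strip (subgraph h)" "h \<in> holder_ball \<beta> R" by blast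
    define g where "g = (\<lambda>x. max (g0 x) (h x))"
    have g: "g \<in> holder_ball \<beta> R" unfolding g_def by (rule holder_ball_max[OF g0 h(2)])
    let ?V = "void strip (subgraph g)"
    have V: "?V \<in> sets (P g0)" and B: "B \<in> sets (P g0)"
      using void_in_sets[OF subgraph_sets[OF g]] void_in_sets[OF subgraph_sets[OF h(2)]] by (simp_all add: M0.sets_P_strip h)
    have Um: "U \<in> borel_measurable (P g0)" using U(1)[OF g0] by (rule borel_measurable_integrable)
    have Um': "U \<in> borel_measurable (P g)" using U(1)[OF g] by (rule borel_measurable_integrable)
    have gU: "subgraph g = subgraph g0 \<union> subgraph h" by (auto simp: g_def subgraph_def less_max_iff_disj)
    have "(LINT \<omega>:B|P g0. U \<omega>) = (LINT \<omega>|P g0. indicator ?V \<omega> *\<^sub>R U \<omega>)"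
      unfolding set_lebesgue_integral_def
    proof (rule integral_cong_AE)
      show "AE \<omega> in P g0. indicator B \<omega> *\<^sub>R U \<omega> = indicator ?V \<omega> *\<^sub>R U \<omega>"
        using M0.AE_above by eventually_elim (auto simp: h gU void_def indicator_def)
      show "(\<lambda>\<omega>. indicator B \<omega> *\<^sub>R U \<omega>) \<in> borel_measurable (P g0)" "(\<lambda>\<omega>. indicator ?V \<omega> *\<^sub>R U \<omega>) \<in> borel_measurable (P g0)"
        by (intro borel_measurable_scaleR borel_measurable_indicator Um B V)+
    qed
    also have "\<dots> = integral\<^sup>L (density (P g0) (\<lambda>\<omega>. ennreal (indicator ?V \<omega>))) U"
      by (rule integral_density[symmetric, OF Um borel_measurable_indicator[OF V]]) simp
    also have "\<dots> = integral\<^sup>L (density (P g) (\<lambda>_. ennreal (measure (P g0) ?V))) U"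
      by (subst likelihood_ratio[OF n g g0 _ P[OF g] P[OF g0]]) (auto simp: g_def)
    also have "\<dots> = (LINT \<omega>|P g. measure (P g0) ?V *\<^sub>R U \<omega>)"
      by (rule integral_density[OF Um' borel_measurable_const]) simp
    also have "\<dots> = 0" using U(2)[OF g] by simp
    finally show ?case .
  next
    case empty
    show ?case by (simp add: set_lebesgue_integral_def)
  next
    case (compl B)
    then have B: "B \<in> sets (P g0)" using sub by (simp add: sets_mle_algebra)
    have "(LINT \<omega>:configurations (space strip) - B|P g0. U \<omega>) = (LINT \<omega>|P g0. U \<omega> - indicator B \<omega> *\<^sub>R U \<omega>)"
      unfolding set_lebesgue_integral_def
      by (rule Bochner_Integration.integral_cong) (auto simp: M0.space_P_strip indicator_def)
    also have "\<dots> = (LINT \<omega>|P g0. U \<omega>) - (LINT \<omega>:B|P g0. U \<omega>)"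
      using si[OF B] U(1)[OF g0] unfolding set_integrable_def set_lebesgue_integral_def by (intro Bochner_Integration.integral_diff)
    also have "\<dots> = 0" using U(2)[OF g0] compl(2) by simp
    finally show ?case .
  next
    case (union B)
    have B: "B i \<in> sets (P g0)" for i using union(2) sub by (auto simp: sets_mle_algebra)
    have "(LINT \<omega>:(\<Union>i. B i)|P g0. U \<omega>) = (\<Sum>i. LINT \<omega>:B i|P g0. U \<omega>)"
      using union(1) B by (intro lebesgue_integral_countable_add si) (auto simp: disjoint_family_on_def)
    then show ?case using union(3) by simp
  qed
qed

text \<open>The conditional expectation of \<open>U\<close> given the algebra vanishes by
  \<open>zero_estimator_orthogonal\<close>, and \<open>G\<close> is pulled out of it. This route
  covers unbounded \<open>G\<close> as long as the product is integrable.\<close>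

lemma zero_estimator_orthogonal_mult:
  fixes U :: "(real \<times> real) set \<Rightarrow> real"
  assumes n: "0 < n"
    and P: "\<And>g. g \<in> holder_ball \<beta> R \<Longrightarrow> poisson_process (boundary_intensity n g) (P g)"
    and U: "\<And>g. g \<in> holder_ball \<beta> R \<Longrightarrow> integrable (P g) U" "\<And>g. g \<in> holder_ball \<beta> R \<Longrightarrow> (LINT \<omega>|P g. U \<omega>) = 0"
    and g0: "g0 \<in> holder_ball \<beta> R"
    and G: "G \<in> borel_measurable mle_algebra" "integrable (P g0) (\<lambda>\<omega>. G \<omega> * U \<omega>)"
  shows "(LINT \<omega>|P g0. G \<omega> * U \<omega>) = 0"
proof -
  interpret M0: boundary_model \<beta> R n g0 "P g0" using n g0 P by unfold_locales auto
  interpret S: finite_measure_subalgebra "P g0" mle_algebra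
    by unfold_locales (use mle_algebra_le in \<open>auto simp: subalgebra_def space_mle_algebra M0.space_P_strip M0.sets_P_strip\<close>)
  have Um: "U \<in> borel_measurable (P g0)" using U(1)[OF g0] by (rule borel_measurable_integrable)
  have "AE \<omega> in P g0. real_cond_exp (P g0) mle_algebra U \<omega> = 0"
    by (rule S.real_cond_exp_charact)
      (use zero_estimator_orthogonal[OF n P U g0] U(1)[OF g0] in \<open>simp_all add: set_lebesgue_integral_def\<close>)
  then have "AE \<omega> in P g0. G \<omega> * real_cond_exp (P g0) mle_algebra U \<omega> = 0" by eventually_elim simp
  then have "(LINT \<omega>|P g0. G \<omega> * real_cond_exp (P g0) mle_algebra U \<omega>) = 0"
    by (rule integral_eq_zero_AE)
  then show ?thesis using S.real_cond_exp_intg(2)[OF G(2,1) Um] by simp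
qed

end

text \<open>The apexes of the cusps that form the graph of \<open>mle\<close> are recovered from \<open>mle\<close> by
  \<open>valley_sum_eventually\<close>.\<close>

lemma (in boundary_model) estimator_mle_algebra:
  assumes w: "weak_derivative \<Phi> \<Phi>'"
  obtains G where "G \<in> borel_measurable mle_algebra" "AE \<omega> in P. functional_estimator \<beta> R n \<Phi> \<Phi>' \<omega> = G \<omega>"
proof
  \<comment> \<open>\<open>lim\<close> is unspecified where the sequence diverges, but for simple
    configurations, hence almost surely, the sequence is eventually constant.\<close>
  let ?G = "\<lambda>\<omega>. functional \<Phi> (mle \<beta> R \<omega>) - 1 / real n * lim (\<lambda>m. valley_sum \<Phi>' m \<omega>)"
  have sp: "space mle_algebra \<subseteq> configurations (space strip)" by (simp add: space_mle_algebra)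
  have "(\<lambda>\<omega>. lim (\<lambda>m. valley_sum \<Phi>' m \<omega>)) \<in> borel_measurable mle_algebra"
    by (intro borel_measurable_lim_metric valley_sum_measurable[OF sp mle_algebra_shadow] weak_derivative_measurable[OF w])
  then show "?G \<in> borel_measurable mle_algebra"
    by (intro borel_measurable_diff borel_measurable_times borel_measurable_const
      functional_mle_measurable[OF weak_derivative_continuous[OF w] sp mle_algebra_shadow])
  show "AE \<omega> in P. functional_estimator \<beta> R n \<Phi> \<Phi>' \<omega> = ?G \<omega>"
    using AE_simple
  proof eventually_elim
    case (elim \<omega>)
    have g: "good \<omega>" using elim by (simp add: simple_def)
    have "(\<lambda>m. valley_sum \<Phi>' m \<omega>) \<longlonglongrightarrow> (\<Sum>z\<in>touching \<omega>. \<Phi>' (snd z))"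
      using valley_sum_eventually[OF elim] by (rule tendsto_eventually)
    then have "lim (\<lambda>m. valley_sum \<Phi>' m \<omega>) = (\<Sum>z\<in>touching \<omega>. \<Phi>' (snd z))" by (rule limI)
    then show ?case
      unfolding functional_estimator_def functional_def[of \<Phi>, symmetric] infsum_touching[OF g] by (simp only:)
  qed
qed

theorem theorem2p4:
  fixes \<beta> R :: real and n :: nat
    and \<Phi> \<Phi>' :: "real \<Rightarrow> real"
    and P :: "(real \<Rightarrow> real) \<Rightarrow> (real \<times> real) set measure"
  assumes "0 < \<beta>" "\<beta> \<le> 1" "0 < R" "0 < n"
    and "weak_derivative \<Phi> \<Phi>'"
    and "\<And>g. g \<in> holder_ball \<beta> R \<Longrightarrow> poisson_process (boundary_intensity n g) (P g)"
    and "\<And>g. g \<in> holder_ball \<beta> R \<Longrightarrow> variance_formula \<beta> R n \<Phi>' (P g) g < \<infinity>"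
  shows "UMVU (config_space strip) P (holder_ball \<beta> R) (functional \<Phi>)
           (functional_estimator \<beta> R n \<Phi> \<Phi>')
       \<and> (\<forall>g\<in>holder_ball \<beta> R.
            evariance (P g) (functional_estimator \<beta> R n \<Phi> \<Phi>') = variance_formula \<beta> R n \<Phi>' (P g) g)"
proof -
  interpret holder \<beta> R using assms by unfold_locales
  let ?\<Theta> = "holder_ball \<beta> R" and ?E = "functional_estimator \<beta> R n \<Phi> \<Phi>'"
  have model: "boundary_model \<beta> R n g (P g)" if "g \<in> ?\<Theta>" for g
    using assms that by unfold_locales auto
  note moments = boundary_model.estimator_moments[OF model assms(5,7)]
  have unb: "unbiased_estimator (config_space strip) P ?\<Theta> (functional \<Phi>) ?E"
    unfolding unbiased_estimator_def using functional_estimator_measurable[OF assms(5)] moments by blast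
  have "evariance (P g) ?E \<le> evariance (P g) F"
    if F: "unbiased_estimator (config_space strip) P ?\<Theta> (functional \<Phi>) F" and g: "g \<in> ?\<Theta>" for F g
  \<comment> \<open>A competitor of infinite variance cannot be better; a finite variance makes the
    cross term below integrable.\<close>
  proof (cases "evariance (P g) F < \<infinity>")
    case False
    then show ?thesis by (simp add: less_top[symmetric])
  next
    case True
    interpret M: boundary_model \<beta> R n g "P g" by (rule model[OF g])
    let ?c = "functional \<Phi> g"
    define U where "U \<omega> = F \<omega> - ?E \<omega>" for \<omega>
    have U: "integrable (P g) U" "(LINT \<omega>|P g. U \<omega>) = 0" if "g \<in> ?\<Theta>" for g
      using F unb that unfolding U_def [abs_def] unbiased_estimator_def by simp_all
    have iF: "integrable (P g) F" "(LINT \<omega>|P g. F \<omega>) = ?c" and iE: "integrable (P g) ?E" "(LINT \<omega>|P g. ?E \<omega>) = ?c"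
      using F unb g by (simp_all add: unbiased_estimator_def)
    have Fm: "F \<in> borel_measurable (P g)" and Em: "?E \<in> borel_measurable (P g)" and Um: "U \<in> borel_measurable (P g)"
      using iF iE U(1)[OF g] by auto
    have sqF: "integrable (P g) (\<lambda>\<omega>. (F \<omega> - ?c)\<^sup>2)"
      using True Fm unfolding evariance_def iF(2)
      by (intro integrableI_bounded borel_measurable_power borel_measurable_diff borel_measurable_const) simp_all
    have "evariance (P g) ?E < \<infinity>" using assms(7)[OF g] moments(3)[OF g g] by simp
    then have sqE: "integrable (P g) (\<lambda>\<omega>. (?E \<omega> - ?c)\<^sup>2)"
      using Em unfolding evariance_def iE(2)
      by (intro integrableI_bounded borel_measurable_power borel_measurable_diff borel_measurable_const) simp_all
    have sqU: "integrable (P g) (\<lambda>\<omega>. (U \<omega>)\<^sup>2)"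
    proof (rule Bochner_Integration.integrable_bound)
      show "integrable (P g) (\<lambda>\<omega>. 2 * (F \<omega> - ?c)\<^sup>2 + 2 * (?E \<omega> - ?c)\<^sup>2)" using sqF sqE by simp
      have "(U \<omega>)\<^sup>2 \<le> 2 * (F \<omega> - ?c)\<^sup>2 + 2 * (?E \<omega> - ?c)\<^sup>2" for \<omega>
        using zero_le_power2[of "F \<omega> + ?E \<omega> - 2 * ?c"] by (simp add: U_def power2_eq_square algebra_simps)
      then show "AE \<omega> in P g. norm ((U \<omega>)\<^sup>2) \<le> norm (2 * (F \<omega> - ?c)\<^sup>2 + 2 * (?E \<omega> - ?c)\<^sup>2)"
        by (intro AE_I2) simp
    qed (intro borel_measurable_power Um)
    have cross: "integrable (P g) (\<lambda>\<omega>. (?E \<omega> - ?c) * U \<omega>)"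
    proof (rule Bochner_Integration.integrable_bound)
      show "integrable (P g) (\<lambda>\<omega>. (?E \<omega> - ?c)\<^sup>2 + (U \<omega>)\<^sup>2)" using sqE sqU by simp
      have "\<bar>(?E \<omega> - ?c) * U \<omega>\<bar> \<le> (?E \<omega> - ?c)\<^sup>2 + (U \<omega>)\<^sup>2" for \<omega>
      proof -
        have "2 * (\<bar>?E \<omega> - ?c\<bar> * \<bar>U \<omega>\<bar>) \<le> (?E \<omega> - ?c)\<^sup>2 + (U \<omega>)\<^sup>2"
          using sum_squares_bound[of "\<bar>?E \<omega> - ?c\<bar>" "\<bar>U \<omega>\<bar>"] by simp
        moreover have "0 \<le> \<bar>?E \<omega> - ?c\<bar> * \<bar>U \<omega>\<bar>" by simp
        ultimately show ?thesis unfolding abs_mult by linarith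
      qed
      then show "AE \<omega> in P g. norm ((?E \<omega> - ?c) * U \<omega>) \<le> norm ((?E \<omega> - ?c)\<^sup>2 + (U \<omega>)\<^sup>2)"
        by (intro AE_I2) simp
    qed (intro borel_measurable_times borel_measurable_diff borel_measurable_const Em Um)
    \<comment> \<open>\<open>?E\<close> agrees with a function of the \<open>mle\<close> only almost
      surely, so the orthogonality is applied to \<open>G\<close> and then transferred.\<close>
    obtain G where G: "G \<in> borel_measurable mle_algebra" "AE \<omega> in P g. ?E \<omega> = G \<omega>"
      using M.estimator_mle_algebra[OF assms(5)] by blast
    have "subalgebra (P g) mle_algebra"
      using mle_algebra_le by (simp add: subalgebra_def space_mle_algebra M.space_P_strip M.sets_P_strip)
    then have Gm: "G \<in> borel_measurable (P g)" using G(1) by (rule measurable_from_subalg)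
    have eq: "AE \<omega> in P g. (?E \<omega> - ?c) * U \<omega> = (G \<omega> - ?c) * U \<omega>" using G(2) by eventually_elim simp
    have m1: "(\<lambda>\<omega>. (?E \<omega> - ?c) * U \<omega>) \<in> borel_measurable (P g)" "(\<lambda>\<omega>. (G \<omega> - ?c) * U \<omega>) \<in> borel_measurable (P g)"
      by (intro borel_measurable_times borel_measurable_diff borel_measurable_const Em Gm Um)+
    have "integrable (P g) (\<lambda>\<omega>. (G \<omega> - ?c) * U \<omega>)"
      using cross integrable_cong_AE[OF m1 eq] by simp
    then have "(LINT \<omega>|P g. (G \<omega> - ?c) * U \<omega>) = 0"
      by (intro zero_estimator_orthogonal_mult[OF assms(4,6) U g] borel_measurable_diff borel_measurable_const G(1))
    then have orth: "(LINT \<omega>|P g. (?E \<omega> - ?c) * U \<omega>) = 0" using integral_cong_AE[OF m1 eq] by simp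
    \<comment> \<open>Pythagoras for \<open>F - ?c\<close> as the sum of \<open>?E - ?c\<close> and
      \<open>U\<close>; the cross term vanishes by \<open>orth\<close>.\<close>
    have "(LINT \<omega>|P g. (F \<omega> - ?c)\<^sup>2) = (LINT \<omega>|P g. ((?E \<omega> - ?c)\<^sup>2 + (U \<omega>)\<^sup>2) + 2 * ((?E \<omega> - ?c) * U \<omega>))"
      by (intro Bochner_Integration.integral_cong) (simp_all add: U_def power2_eq_square algebra_simps)
    also have "\<dots> = (LINT \<omega>|P g. (?E \<omega> - ?c)\<^sup>2) + (LINT \<omega>|P g. (U \<omega>)\<^sup>2)"
      using sqE sqU cross orth by simp
    finally have "(LINT \<omega>|P g. (?E \<omega> - ?c)\<^sup>2) \<le> (LINT \<omega>|P g. (F \<omega> - ?c)\<^sup>2)" by simp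
    then show ?thesis
      unfolding evariance_def iE(2) iF(2)
      by (simp add: nn_integral_eq_integral sqE sqF ennreal_leI)
  qed
  then show ?thesis unfolding UMVU_def using unb moments(3) by blast
qed

end
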